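(* If $G$ is an amenable, $\sigma$-compact, non-unimodular locally compact group, then $\mathrm{TLIM}_0(G)\ne\mathrm{TLIM}(G)$.
   Context: All groups are Hausdorff; $|E|$ is the left Haar measure of $E\subset G$. $L_\infty(G)$ is the algebra of bounded locally measurable functions modulo equality off locally null sets, the dual of $L_1(G)$. $M(G)$ is the set of means on $L_\infty(G)$: linear functionals $\mu$ with $\|\mu\|=1$, $\mu\ge0$; write $\mu(E)=\mu(\mathbb 1_E)$. $G$ is amenable if there is $\mu\in M(G)$ with $\mu(l_x\phi)=\mu(\phi)$ for all $x\in G$, $\phi\in L_\infty(G)$, where $l_x\phi(y)=\phi(x^{-1}y)$. $P_1(G)=\{f\in L_1(G):f\ge0,\ \|f\|_1=1\}$. $\mathrm{TLIM}(G)$ is the set of $\mu\in M(G)$ with $\mu(f*\phi)=\mu(\phi)$ for all $f\in P_1(G)$, $\phi\in L_\infty(G)$. For a finite measurable partition $\mathcal P$ of $G$ and $\epsilon\in(0,1)$, $\mathcal N(\mu,\mathcal P,\epsilon)=\{\nu\in M(G):|\mu(E)-\nu(E)|<\epsilon\ \text{for all }E\in\mathcal P\}$. For compact $A\subset G$ with $|A|>0$, $\mu_A=\mathbb 1_A/|A|$, regarded as a mean on $L_\infty(G)$. For compact $K\subset G$ and $\epsilon\in(0,1)$, $\mathscr C^+(K,\epsilon)$ is the set of compact $A\subset G$ with $|A|>0$ and $|xA\,\triangle\,A|/|A|<\epsilon$ for each $x\in K$. Then $\mathrm{TLIM}_0(G)$ is the set of $\mu\in\mathrm{TLIM}(G)$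 such that for all finite measurable partitions $\mathcal P$ of $G$, compact $K\subset G$ and $\epsilon\in(0,1)$ there exists $A\in\mathscr C^+(K,\epsilon)$ with $\mu_A\in\mathcal N(\mu,\mathcal P,\epsilon)$ (i.e. $\mu$ is a limit point of a topological Følner net). *)

theory Defs
  imports "HOL-Analysis.Analysis"
begin

text \<open>
  Groups are written additively: the class \<^class>\<open>topological_group_add\<close> does not assume
  commutativity. Thus the translate \<open>x\<^sup>-\<^sup>1y\<close> of the multiplicative notation is
  \<open>- x + y\<close>, and \<open>xA\<close> is \<open>(+) x ` A\<close>.
\<close>

definition sigma_compact_space :: "'a topology \<Rightarrow> bool" where
  "sigma_compact_space X \<longleftrightarrow>
     (\<exists>\<C>. countable \<C> \<and> (\<forall>K\<in>\<C>. compactin X K) \<and> \<Union>\<C> = topspace X)"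

text \<open>A left Haar measure is a nonzero left-invariant Radon measure on the Borel sets.\<close>

definition left_haar_measure ::
  "'a :: {topological_group_add, t2_space} measure \<Rightarrow> bool" where
  "left_haar_measure \<Lambda> \<longleftrightarrow>
     sets \<Lambda> = sets borel \<and>
     emeasure \<Lambda> UNIV \<noteq> 0 \<and>
     (\<forall>K. compact K \<longrightarrow> emeasure \<Lambda> K < \<infinity>) \<and>
     (\<forall>A\<in>sets borel. emeasure \<Lambda> A = (INF U\<in>{U. open U \<and> A \<subseteq> U}. emeasure \<Lambda> U)) \<and>
     (\<forall>U. open U \<longrightarrow> emeasure \<Lambda> U = (SUP K\<in>{K. compact K \<and> K \<subseteq> U}. emeasure \<Lambda> K)) \<and>
     (\<forall>x. \<forall>A\<in>sets borel. emeasure \<Lambda> ((+) x ` A) = emeasure \<Lambda> A)"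

definition unimodular :: "'a :: {topological_group_add, t2_space} measure \<Rightarrow> bool" where
  "unimodular \<Lambda> \<longleftrightarrow>
     (\<forall>x. \<forall>A\<in>sets borel. emeasure \<Lambda> ((\<lambda>y. y + x) ` A) = emeasure \<Lambda> A)"

definition locally_measurable_set :: "'a measure \<Rightarrow> 'a set \<Rightarrow> bool" where
  "locally_measurable_set M E \<longleftrightarrow>
     E \<subseteq> space M \<and> (\<forall>F\<in>fmeasurable M. E \<inter> F \<in> sets M)"

definition locally_null :: "'a measure \<Rightarrow> 'a set \<Rightarrow> bool" where
  "locally_null M E \<longleftrightarrow> E \<subseteq> space M \<and> (\<forall>F\<in>fmeasurable M. E \<inter> F \<in> null_sets M)"

text \<open>
  Elements of \<open>L\<^sub>\<infinity>\<close> are represented by bounded locally measurable functions; a functional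
  on \<open>L\<^sub>\<infinity>\<close> is a functional on these representatives that takes equal values on functions
  which agree off a locally null set. Functionals are made extensional, so that equality of
  functionals is equality on \<open>L\<^sub>\<infinity>\<close>.
\<close>

definition Linf :: "'a measure \<Rightarrow> ('a \<Rightarrow> real) set" where
  "Linf M = {\<phi>. bounded (\<phi> ` space M) \<and>
     (\<forall>B\<in>sets borel. locally_measurable_set M (\<phi> -` B \<inter> space M))}"

definition Linf_norm :: "'a measure \<Rightarrow> ('a \<Rightarrow> real) \<Rightarrow> real" where
  "Linf_norm M \<phi> = Inf {c. 0 \<le> c \<and> locally_null M {x \<in> space M. c < \<bar>\<phi> x\<bar>}}"

definition Linf_linear_functionals :: "'a measure \<Rightarrow> (('a \<Rightarrow> real) \<Rightarrow> real) set" where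
  "Linf_linear_functionals M = {\<mu> \<in> extensional (Linf M).
     (\<forall>\<phi>\<in>Linf M. \<forall>\<psi>\<in>Linf M.
        locally_null M {x \<in> space M. \<phi> x \<noteq> \<psi> x} \<longrightarrow> \<mu> \<phi> = \<mu> \<psi>) \<and>
     (\<forall>\<phi>\<in>Linf M. \<forall>\<psi>\<in>Linf M. \<mu> (\<lambda>x. \<phi> x + \<psi> x) = \<mu> \<phi> + \<mu> \<psi>) \<and>
     (\<forall>c. \<forall>\<phi>\<in>Linf M. \<mu> (\<lambda>x. c * \<phi> x) = c * \<mu> \<phi>)}"

definition Linf_dual_norm :: "'a measure \<Rightarrow> (('a \<Rightarrow> real) \<Rightarrow> real) \<Rightarrow> ereal" where
  "Linf_dual_norm M \<mu> = (SUP \<phi>\<in>{\<phi> \<in> Linf M. Linf_norm M \<phi> \<le> 1}. ereal \<bar>\<mu> \<phi>\<bar>)"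

definition means :: "'a measure \<Rightarrow> (('a \<Rightarrow> real) \<Rightarrow> real) set" where
  "means M = {\<mu> \<in> Linf_linear_functionals M.
     Linf_dual_norm M \<mu> = 1 \<and>
     (\<forall>\<phi>\<in>Linf M. locally_null M {x \<in> space M. \<phi> x < 0} \<longrightarrow> 0 \<le> \<mu> \<phi>)}"

definition amenable :: "'a :: {topological_group_add, t2_space} measure \<Rightarrow> bool" where
  "amenable \<Lambda> \<longleftrightarrow>
     (\<exists>\<mu>\<in>means \<Lambda>. \<forall>x. \<forall>\<phi>\<in>Linf \<Lambda>. \<mu> (\<lambda>y. \<phi> (- x + y)) = \<mu> \<phi>)"

definition P1 :: "'a measure \<Rightarrow> ('a \<Rightarrow> real) set" where
  "P1 M = {f. integrable M f \<and> (AE x in M. 0 \<le> f x) \<and> (LINT x|M. f x) = 1}"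

definition convolution ::
  "'a :: {topological_group_add, t2_space} measure \<Rightarrow>
     ('a \<Rightarrow> real) \<Rightarrow> ('a \<Rightarrow> real) \<Rightarrow> 'a \<Rightarrow> real" where
  "convolution \<Lambda> f \<phi> = (\<lambda>x. LINT y|\<Lambda>. f y * \<phi> (- y + x))"

definition TLIM ::
  "'a :: {topological_group_add, t2_space} measure \<Rightarrow> (('a \<Rightarrow> real) \<Rightarrow> real) set" where
  "TLIM \<Lambda> = {\<mu> \<in> means \<Lambda>. \<forall>f\<in>P1 \<Lambda>. \<forall>\<phi>\<in>Linf \<Lambda>. \<mu> (convolution \<Lambda> f \<phi>) = \<mu> \<phi>}"

definition finite_measurable_partition :: "'a measure \<Rightarrow> 'a set set \<Rightarrow> bool" where
  "finite_measurable_partition M \<P> \<longleftrightarrow>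
     finite \<P> \<and> \<P> \<subseteq> sets M \<and> partition_on (space M) \<P>"

definition mean_nbhd ::
  "'a measure \<Rightarrow> (('a \<Rightarrow> real) \<Rightarrow> real) \<Rightarrow> 'a set set \<Rightarrow> real \<Rightarrow> (('a \<Rightarrow> real) \<Rightarrow> real) set" where
  "mean_nbhd M \<mu> \<P> \<epsilon> =
     {\<nu> \<in> means M. \<forall>E\<in>\<P>. \<bar>\<mu> (indicator E) - \<nu> (indicator E)\<bar> < \<epsilon>}"

definition mean_of_set :: "'a measure \<Rightarrow> 'a set \<Rightarrow> ('a \<Rightarrow> real) \<Rightarrow> real" where
  "mean_of_set M A = (\<lambda>\<phi>\<in>Linf M. (LINT x:A|M. \<phi> x) / measure M A)"

definition Folner_sets ::
  "'a :: {topological_group_add, t2_space} measure \<Rightarrow> 'a set \<Rightarrow> real \<Rightarrow> 'a set set" where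
  "Folner_sets \<Lambda> K \<epsilon> = {A. compact A \<and> 0 < measure \<Lambda> A \<and>
     (\<forall>x\<in>K. measure \<Lambda> (sym_diff ((+) x ` A) A) / measure \<Lambda> A < \<epsilon>)}"

definition TLIM0 ::
  "'a :: {topological_group_add, t2_space} measure \<Rightarrow> (('a \<Rightarrow> real) \<Rightarrow> real) set" where
  "TLIM0 \<Lambda> = {\<mu> \<in> TLIM \<Lambda>. \<forall>\<P> K \<epsilon>.
     finite_measurable_partition \<Lambda> \<P> \<and> compact K \<and> 0 < \<epsilon> \<and> \<epsilon> < 1 \<longrightarrow>
       (\<exists>A\<in>Folner_sets \<Lambda> K \<epsilon>. mean_of_set \<Lambda> A \<in> mean_nbhd \<Lambda> \<mu> \<P> \<epsilon>)}"

end

theory Submission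
  imports Defs
begin

text \<open>
  Let \<open>D(y) = 1 / \<Delta>(y)\<close> be the reciprocal of the modular function and let \<open>K\<^sub>n\<close> exhaust \<open>G\<close> by
  compact sets. Since \<open>D\<close> is unbounded, there are \<open>x\<^sub>n\<close> such that \<open>D > 1\<close> on
  \<open>E\<^sub>1 = \<Union>\<^sub>n K\<^sub>nx\<^sub>n\<close> and \<open>|E\<^sub>1| \<le> 1\<close>, and \<open>y\<^sub>n\<close> such that \<open>E\<^sub>2 = {D \<le> 1}\<close> contains all
  \<open>K\<^sub>ny\<^sub>n\<close>. A set that contains a right translate of every compact set supports an element of
  TLIM, so there is \<open>\<mu>\<close> in TLIM with \<open>\<mu>(E\<^sub>1) = \<mu>(E\<^sub>2) = 1/2\<close>. If a Folner set \<open>A\<close> gives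
  \<open>E\<^sub>1\<close> and \<open>E\<^sub>2\<close> nearly these weights, then \<open>|A| < 5/2\<close>, as \<open>|A \<inter> E\<^sub>1| \<le> 1\<close>.
  Take \<open>U\<close> compact with \<open>D \<le> 1\<close> on \<open>U\<close> and \<open>|U| \<ge> 8\<close>, and let \<open>A\<close> be nearly invariant under
  \<open>U\<^sup>-\<^sup>1\<close>. As \<open>UE\<^sub>2 \<subseteq> E\<^sub>2\<close>, the set \<open>B = A \<inter> E\<^sub>2\<close> inherits this invariance, so for some
  \<open>y \<in> B\<close> at least half of \<open>U\<close> lies in \<open>By\<^sup>-\<^sup>1\<close>, up to a small error. Since \<open>|By\<^sup>-\<^sup>1| \<le> |B|\<close>,
  this bounds \<open>|A|\<close> from below by about \<open>|U| / 2\<close>, a contradiction.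

  The mean supported on a thick set \<open>E \<supseteq> \<Union>\<^sub>n K\<^sub>ns\<^sub>n\<close> comes from a left-invariant mean \<open>m\<close>: send
  \<open>\<phi>\<close> to \<open>m\<close> applied to \<open>x \<mapsto> LIM\<^sub>n (f * \<phi>)(xs\<^sub>n)\<close>, where \<open>f\<close> is a fixed bump function and
  \<open>LIM\<close> is a mean on bounded sequences that vanishes on finite sets. Its topological invariance
  follows from the uniqueness of left-invariant functionals on compactly supported continuous
  functions.
\<close>

section \<open>Compactly supported and uniformly continuous functions\<close>

definition Cc :: "('a::topological_space \<Rightarrow> real) set" where
  "Cc = {f. continuous_on UNIV f \<and> (\<exists>K. compact K \<and> (\<forall>x. x \<notin> K \<longrightarrow> f x = 0))}"

text \<open>Norm continuity of \<open>x \<mapsto> \<psi>(x\<cdot>)\<close>; the convolutions \<open>f * \<phi>\<close> have this property.\<close>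

definition UC :: "('a::topological_group_add \<Rightarrow> real) set" where
  "UC = {\<psi>. bounded (range \<psi>) \<and> (\<forall>x0. \<forall>\<epsilon>>0. \<exists>V. open V \<and> x0 \<in> V \<and>
     (\<forall>x\<in>V. \<forall>t. \<bar>\<psi> (x + t) - \<psi> (x0 + t)\<bar> \<le> \<epsilon>))}"

section \<open>Closure properties of \<open>Cc\<close>\<close>

lemma CcI: "continuous_on UNIV f \<Longrightarrow> compact K \<Longrightarrow> (\<And>x. x \<notin> K \<Longrightarrow> f x = 0) \<Longrightarrow> f \<in> Cc"
  unfolding Cc_def by blast

lemma CcE:
  assumes "f \<in> Cc"
  obtains K where "compact K" "continuous_on UNIV f" "\<And>x. x \<notin> K \<Longrightarrow> f x = 0"
  using assms unfolding Cc_def by blast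

lemma Cc_bounded:
  assumes "f \<in> Cc"
  obtains C where "0 \<le> C" "\<And>x. \<bar>f x\<bar> \<le> C"
proof -
  obtain K where K: "compact K" "continuous_on UNIV f" "\<And>x. x \<notin> K \<Longrightarrow> f x = 0"
    using assms by (elim CcE) blast
  have "compact (f ` K)"
    using K by (meson compact_continuous_image continuous_on_subset subset_UNIV)
  then obtain C where C: "\<forall>y\<in>f ` K. norm y \<le> C"
    using compact_imp_bounded bounded_iff by blast
  show thesis
  proof (rule that[of "max C 0"])
    show "\<bar>f x\<bar> \<le> max C 0" for x
    proof (cases "x \<in> K")
      case True
      then show ?thesis using C by fastforce
    qed (simp add: K)
  qed simp
qed

lemma Cc_add:
  assumes "f \<in> Cc" "g \<in> Cc" shows "(\<lambda>x. f x + g x) \<in> Cc"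
proof -
  obtain K where "compact K" "continuous_on UNIV f" "\<And>x. x \<notin> K \<Longrightarrow> f x = 0"
    using assms(1) by (elim CcE) blast
  moreover obtain L where "compact L" "continuous_on UNIV g" "\<And>x. x \<notin> L \<Longrightarrow> g x = 0"
    using assms(2) by (elim CcE) blast
  ultimately show ?thesis
    by (intro CcI[of _ "K \<union> L"] continuous_intros) auto
qed

lemma Cc_cmult:
  assumes "f \<in> Cc" shows "(\<lambda>x. c * f x) \<in> Cc"
  using assms by (elim CcE) (auto intro!: CcI continuous_intros)

lemma Cc_diff:
  assumes "f \<in> Cc" "g \<in> Cc" shows "(\<lambda>x. f x - g x) \<in> Cc"
  using Cc_add[OF assms(1) Cc_cmult[OF assms(2), of "-1"]] by simp

text \<open>If \<open>f (h x)\<close> is nonzero, then \<open>h x\<close> lies in \<open>K\<close>,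
  so \<open>x = k (h x)\<close> lies in the image of \<open>K\<close> under \<open>k\<close>, which
  is compact.\<close>

lemma Cc_comp_homeo:
  assumes "f \<in> Cc" "continuous_on UNIV h" "continuous_on UNIV k" "\<And>x. k (h x) = x"
  shows "(\<lambda>x. f (h x)) \<in> Cc"
proof -
  obtain K where K: "compact K" "continuous_on UNIV f" "\<And>x. x \<notin> K \<Longrightarrow> f x = 0"
    using assms(1) by (elim CcE) blast
  show ?thesis
  proof (rule CcI[of _ "k ` K"])
    show "continuous_on UNIV (\<lambda>x. f (h x))"
      using continuous_on_compose2[OF K(2) assms(2)] by simp
    show "compact (k ` K)"
      using K(1) assms(3) by (meson compact_continuous_image continuous_on_subset subset_UNIV)
    show "f (h x) = 0" if "x \<notin> k ` K" for x
      using that K(3)[of "h x"] assms(4)[of x] by (metis image_eqI)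
  qed
qed

lemma Cc_left:
  fixes f :: "'a::{topological_group_add} \<Rightarrow> real"
  shows "f \<in> Cc \<Longrightarrow> (\<lambda>x. f (a + x)) \<in> Cc"
  by (erule Cc_comp_homeo[where k="\<lambda>x. - a + x"]) (auto intro!: continuous_intros simp: add.assoc[symmetric])

lemma Cc_right:
  fixes f :: "'a::{topological_group_add} \<Rightarrow> real"
  shows "f \<in> Cc \<Longrightarrow> (\<lambda>x. f (x + a)) \<in> Cc"
  by (erule Cc_comp_homeo[where k="\<lambda>x. x - a"]) (auto intro!: continuous_intros)

lemma Cc_minus:
  fixes f :: "'a::{topological_group_add} \<Rightarrow> real"
  shows "f \<in> Cc \<Longrightarrow> (\<lambda>x. f (- x)) \<in> Cc"
  by (erule Cc_comp_homeo[where k="\<lambda>x. - x"]) (auto intro!: continuous_intros)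

lemma compact_add_sets:
  fixes S T :: "'a::topological_monoid_add set"
  assumes "compact S" "compact T"
  shows "compact {x + y |x y. x \<in> S \<and> y \<in> T}"
proof -
  have "{x + y |x y. x \<in> S \<and> y \<in> T} = (\<lambda>p. fst p + snd p) ` (S \<times> T)"
    by force
  then show ?thesis
    using compact_Times[OF assms] by (auto intro!: compact_continuous_image continuous_intros)
qed

section \<open>Urysohn functions and uniform continuity on a locally compact group\<close>

locale haar_group =
  fixes \<Lambda> :: "'a :: {topological_group_add, t2_space} measure"
  assumes lc: "locally_compact_space (euclidean :: 'a topology)"
    and haar: "left_haar_measure \<Lambda>"
begin

lemma Hausdorff_euclidean: "Hausdorff_space (euclidean :: 'a topology)"
  unfolding Hausdorff_space_def by (simp add: disjnt_def, metis hausdorff)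

lemma compact_nbhd:
  fixes K :: "'a set"
  assumes "compact K"
  obtains U L where "open U" "compact L" "K \<subseteq> U" "U \<subseteq> L"
proof -
  have "\<forall>K. compactin (euclidean :: 'a topology) K \<longrightarrow>
      (\<exists>U L. openin (euclidean :: 'a topology) U \<and> compactin euclidean L \<and> closedin euclidean L \<and> K \<subseteq> U \<and> U \<subseteq> L)"
    using lc Hausdorff_euclidean locally_compact_space_compact_closed_compact[of "euclidean :: 'a topology"] by simp
  then show thesis using assms that by auto
qed

text \<open>Locally compact Hausdorff spaces are completely regular. Separating \<open>K\<close>
  from the complement of \<open>O' \<inter> U\<close>, where \<open>U\<close> is relatively compact,
  makes the separating function compactly supported.\<close>

lemma Cc_Urysohn:
  fixes K O' :: "'a set"
  assumes "compact K" "open O'" "K \<subseteq> O'"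
  obtains h where "h \<in> Cc" "\<And>x. 0 \<le> h x" "\<And>x. h x \<le> 1" "\<And>x. x \<in> K \<Longrightarrow> h x = 1"
    "\<And>x. x \<notin> O' \<Longrightarrow> h x = 0"
proof -
  obtain U L where U: "open U" "compact L" "K \<subseteq> U" "U \<subseteq> L"
    using compact_nbhd[OF assms(1)] .
  have cr: "completely_regular_space (euclidean :: 'a topology)"
    using lc locally_compact_regular_imp_completely_regular_space Hausdorff_euclidean by blast
  obtain f where f: "continuous_map (euclidean :: 'a topology) (subtopology euclidean {0..1::real}) f"
     "f ` (- (O' \<inter> U)) \<subseteq> {0}" "f ` K \<subseteq> {1}"
  proof (rule Urysohn_completely_regular_compact_closed[of 0 1 "euclidean :: 'a topology" K "- (O' \<inter> U)"])
    show "closedin (euclidean :: 'a topology) (- (O' \<inter> U))"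
      using assms(2) U(1) by (simp add: closed_Compl open_Int closed_Un)
  qed (use cr assms U in \<open>auto simp: disjnt_def\<close>)
  have ran: "f x \<in> {0..1}" for x
    using f(1) by (auto simp: continuous_map_in_subtopology)
  show thesis
  proof (rule that)
    show "f \<in> Cc"
      using f U by (intro CcI[of f L]) (auto simp: continuous_map_in_subtopology image_subset_iff)
  qed (use ran f(2,3) in \<open>auto simp: image_subset_iff\<close>)
qed

text \<open>For \<open>x\<close> in a compact neighbourhood \<open>L\<close> of \<open>x0\<close>,
  all functions \<open>t \<mapsto> f (x + t)\<close> vanish off the compact set
  \<open>M = - L + K\<close>. On \<open>M\<close>, joint continuity and compactness make the
  estimate uniform in \<open>t\<close>.\<close>

lemma Cc_subset_UC:
  fixes f :: "'a \<Rightarrow> real"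
  assumes "f \<in> Cc" shows "f \<in> UC"
proof -
  obtain K where K: "compact K" "continuous_on UNIV f" "\<And>x. x \<notin> K \<Longrightarrow> f x = 0"
    using assms by (elim CcE) blast
  have "\<exists>V. open V \<and> x0 \<in> V \<and> (\<forall>x\<in>V. \<forall>t. \<bar>f (x + t) - f (x0 + t)\<bar> \<le> \<epsilon>)" if eps: "\<epsilon> > 0" for x0 and \<epsilon> :: real
  proof -
    obtain U L where U: "open U" "compact L" "{x0} \<subseteq> U" "U \<subseteq> L"
      by (rule compact_nbhd[of "{x0}"]) auto
    define M where "M = {x + y |x y. x \<in> uminus ` L \<and> y \<in> K}"
    have "compact (uminus ` L)"
      using U by (intro compact_continuous_image continuous_intros)
    then have M: "compact M" unfolding M_def using K(1) by (rule compact_add_sets)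
    have cont: "continuous_on (UNIV \<times> M) (\<lambda>p. f (fst p + snd p))"
      by (rule continuous_on_compose2[OF K(2)]) (auto intro!: continuous_intros)
    obtain X0 where X0: "x0 \<in> X0" "open X0"
      "\<forall>x\<in>X0 \<inter> UNIV. \<forall>t\<in>M. dist (f (fst (x, t) + snd (x, t))) (f (fst (x0, t) + snd (x0, t))) \<le> \<epsilon>"
      by (rule continuous_on_prod_compactE[OF cont M UNIV_I[of x0] eps])
    have out: "f (x + t) = 0" if "x \<in> L" "t \<notin> M" for x t
    proof (rule K(3), rule notI)
      assume "x + t \<in> K"
      moreover have "t = - x + (x + t)" by (simp add: add.assoc[symmetric])
      ultimately show False using that unfolding M_def by blast
    qed
    show ?thesis
    proof (intro exI[of _ "X0 \<inter> U"] conjI ballI allI)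
      fix x t assume x: "x \<in> X0 \<inter> U"
      show "\<bar>f (x + t) - f (x0 + t)\<bar> \<le> \<epsilon>"
      proof (cases "t \<in> M")
        case True
        then show ?thesis using X0(3) x by (auto simp: dist_real_def)
      next
        case False
        have "f (x + t) = 0" "f (x0 + t) = 0" using False x U by (auto intro!: out)
        then show ?thesis using eps by simp
      qed
    qed (use X0 U in auto)
  qed
  moreover have "bounded (range f)"
    using Cc_bounded[OF assms] by (metis (mono_tags) boundedI rangeE real_norm_def)
  ultimately show ?thesis unfolding UC_def by blast
qed

end

lemma UC_cont:
  assumes "\<psi> \<in> UC" shows "continuous_on UNIV \<psi>"
  unfolding continuous_on_def
proof (intro ballI tendstoI)
  fix x0 and e :: real assume "e > 0"
  then obtain V where V: "open V" "x0 \<in> V" "\<forall>x\<in>V. \<forall>t. \<bar>\<psi> (x + t) - \<psi> (x0 + t)\<bar> \<le> e/2"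
    using assms unfolding UC_def mem_Collect_eq by (meson half_gt_zero)
  have "\<forall>x\<in>V. dist (\<psi> x) (\<psi> x0) < e"
  proof
    fix x assume "x \<in> V"
    then have "\<bar>\<psi> (x + 0) - \<psi> (x0 + 0)\<bar> \<le> e/2" using V(3) by blast
    then show "dist (\<psi> x) (\<psi> x0) < e" using \<open>e > 0\<close> by (simp add: dist_real_def)
  qed
  then show "\<forall>\<^sub>F x in at x0. dist (\<psi> x) (\<psi> x0) < e"
    using V eventually_at_topological by blast
qed

section \<open>Integration against Haar measure\<close>

context haar_group
begin

lemma sets_Haar [simp, measurable_cong]: "sets \<Lambda> = sets borel"
  using haar by (simp add: left_haar_measure_def)

lemma space_Haar [simp]: "space \<Lambda> = UNIV"
  using sets_eq_imp_space_eq[OF sets_Haar] by simp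

lemma Haar_UNIV: "emeasure \<Lambda> UNIV \<noteq> 0"
  using haar[unfolded left_haar_measure_def, THEN conjunct2, THEN conjunct1] .

lemma Haar_outer: "A \<in> sets borel \<Longrightarrow> emeasure \<Lambda> A = (INF U\<in>{U. open U \<and> A \<subseteq> U}. emeasure \<Lambda> U)"
  using haar[unfolded left_haar_measure_def, THEN conjunct2, THEN conjunct2, THEN conjunct2, THEN conjunct1] by (rule bspec)

lemma Haar_inner: "open U \<Longrightarrow> emeasure \<Lambda> U = (SUP K\<in>{K. compact K \<and> K \<subseteq> U}. emeasure \<Lambda> K)"
  using haar[unfolded left_haar_measure_def, THEN conjunct2, THEN conjunct2, THEN conjunct2, THEN conjunct2, THEN conjunct1]
  by (elim allE impE)

lemma Haar_left: "A \<in> sets borel \<Longrightarrow> emeasure \<Lambda> ((+) x ` A) = emeasure \<Lambda> A"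
  using haar[unfolded left_haar_measure_def, THEN conjunct2, THEN conjunct2, THEN conjunct2, THEN conjunct2, THEN conjunct2]
  by (elim allE) (rule bspec)

lemma emeasure_compact: "compact K \<Longrightarrow> emeasure \<Lambda> K < \<infinity>"
  using haar[unfolded left_haar_measure_def, THEN conjunct2, THEN conjunct2, THEN conjunct1] by (elim allE impE)

lemma compact_borel: "compact (K :: 'a set) \<Longrightarrow> K \<in> sets borel"
  by (simp add: compact_imp_closed)

lemma compact_fmeasurable: "compact K \<Longrightarrow> K \<in> fmeasurable \<Lambda>"
  using emeasure_compact[of K] by (intro fmeasurableI) (auto simp: compact_borel)

lemma measurable_Haar: "borel_measurable \<Lambda> = borel_measurable borel"
  by (rule measurable_cong_sets) auto

lemma measurable_left: "(\<lambda>x. a + x :: 'a) \<in> borel_measurable borel"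
  by (intro borel_measurable_continuous_onI continuous_intros)

lemma measurable_right: "(\<lambda>x. x + a :: 'a) \<in> borel_measurable borel"
  by (intro borel_measurable_continuous_onI continuous_intros)

lemma measurable_minus: "(\<lambda>x. - x :: 'a) \<in> borel_measurable borel"
  by (intro borel_measurable_continuous_onI continuous_intros)

text \<open>Left invariance as an identity of image measures, so that the change of variables
  formula gives the substitution rules for integrals.\<close>

lemma distr_left: "distr \<Lambda> \<Lambda> (\<lambda>x. a + x) = \<Lambda>"
proof (rule measure_eqI)
  fix A assume "A \<in> sets (distr \<Lambda> \<Lambda> (\<lambda>x. a + x))"
  then have A: "A \<in> sets borel" by simp
  have meas: "(\<lambda>x. a + x) \<in> measurable \<Lambda> \<Lambda>"
    using measurable_left[of a] by (simp cong: measurable_cong_sets)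
  have eq: "(\<lambda>x. a + x) -` A = (+) (- a) ` A"
    by (force simp: add.assoc[symmetric] image_iff)
  show "emeasure (distr \<Lambda> \<Lambda> (\<lambda>x. a + x)) A = emeasure \<Lambda> A"
    using A meas by (simp add: emeasure_distr eq Haar_left)
qed simp

lemma integral_left:
  fixes f :: "'a \<Rightarrow> real"
  assumes "f \<in> borel_measurable borel"
  shows "(LINT x|\<Lambda>. f (a + x)) = (LINT x|\<Lambda>. f x)"
proof -
  have "(LINT x|distr \<Lambda> \<Lambda> (\<lambda>x. a + x). f x) = (LINT x|\<Lambda>. f (a + x))"
    using assms measurable_left[of a] by (intro integral_distr) (auto cong: measurable_cong_sets)
  then show ?thesis by (simp add: distr_left)
qed

lemma integrable_left:
  fixes f :: "'a \<Rightarrow> real"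
  assumes "integrable \<Lambda> f"
  shows "integrable \<Lambda> (\<lambda>x. f (a + x))"
proof -
  have "integrable (distr \<Lambda> \<Lambda> (\<lambda>x. a + x)) f"
    using assms by (simp add: distr_left)
  then show ?thesis
    by (rule integrable_distr[rotated]) (use measurable_left[of a] in \<open>simp cong: measurable_cong_sets\<close>)
qed

lemma Cc_measurable: "f \<in> Cc \<Longrightarrow> f \<in> borel_measurable borel"
  by (auto elim!: CcE intro: borel_measurable_continuous_onI)

lemma integrable_compact:
  fixes f :: "'a \<Rightarrow> real"
  assumes "f \<in> borel_measurable borel" "compact K" "\<And>x. x \<notin> K \<Longrightarrow> f x = 0" "\<And>x. \<bar>f x\<bar> \<le> C"
  shows "integrable \<Lambda> f" "\<bar>LINT x|\<Lambda>. f x\<bar> \<le> C * measure \<Lambda> K"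
proof -
  have i: "integrable \<Lambda> (\<lambda>x. C * indicator K x)"
    using compact_fmeasurable[OF assms(2)] by (auto simp: fmeasurable_def)
  have le: "\<bar>f x\<bar> \<le> C * indicator K x" for x
    using assms(3)[of x] assms(4)[of x] by (cases "x \<in> K") auto
  show f: "integrable \<Lambda> f"
    using assms(1) le by (intro Bochner_Integration.integrable_bound[OF i]) (auto simp: measurable_Haar intro!: AE_I2 order_trans[OF le abs_ge_self])
  have "\<bar>LINT x|\<Lambda>. f x\<bar> \<le> (LINT x|\<Lambda>. \<bar>f x\<bar>)"
    by (rule integral_abs_bound)
  also have "\<dots> \<le> (LINT x|\<Lambda>. C * indicator K x)"
    using f i le by (intro integral_mono) auto
  finally show "\<bar>LINT x|\<Lambda>. f x\<bar> \<le> C * measure \<Lambda> K" by simp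
qed

lemma Cc_integrable:
  assumes "f \<in> Cc" shows "integrable \<Lambda> f"
proof -
  obtain K where "compact K" "continuous_on UNIV f" "\<And>x. x \<notin> K \<Longrightarrow> f x = 0"
    using assms by (elim CcE) blast
  moreover obtain C where "\<And>x. \<bar>f x\<bar> \<le> C" using Cc_bounded[OF assms] by metis
  ultimately show ?thesis
    using integrable_compact(1) borel_measurable_continuous_onI by blast
qed

lemma integrable_mult_bounded:
  fixes f g :: "'a \<Rightarrow> real"
  assumes "integrable \<Lambda> f" "g \<in> borel_measurable borel" "\<And>x. \<bar>g x\<bar> \<le> C"
  shows "integrable \<Lambda> (\<lambda>x. f x * g x)" "\<bar>LINT x|\<Lambda>. f x * g x\<bar> \<le> C * (LINT x|\<Lambda>. \<bar>f x\<bar>)"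
proof -
  have "0 \<le> C" using assms(3)[of undefined] by linarith
  then have le: "\<bar>f x * g x\<bar> \<le> C * \<bar>f x\<bar>" for x
    using assms(3)[of x] by (metis abs_ge_zero abs_mult mult.commute mult_left_mono)
  have i: "integrable \<Lambda> (\<lambda>x. C * \<bar>f x\<bar>)" using assms(1) by auto
  show fg: "integrable \<Lambda> (\<lambda>x. f x * g x)"
    using borel_measurable_integrable[OF assms(1)] assms(2) unfolding measurable_Haar
    by (intro Bochner_Integration.integrable_bound[OF i])
       (auto simp: measurable_Haar intro!: AE_I2 order_trans[OF le abs_ge_self] borel_measurable_times)
  have "\<bar>LINT x|\<Lambda>. f x * g x\<bar> \<le> (LINT x|\<Lambda>. \<bar>f x * g x\<bar>)"
    by (rule integral_abs_bound)
  also have "\<dots> \<le> (LINT x|\<Lambda>. C * \<bar>f x\<bar>)"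
    using fg i le by (intro integral_mono) auto
  finally show "\<bar>LINT x|\<Lambda>. f x * g x\<bar> \<le> C * (LINT x|\<Lambda>. \<bar>f x\<bar>)" by simp
qed

text \<open>
  This takes the place of Fubini's theorem: without second countability the Borel sets of \<open>G \<times> G\<close>
  need not lie in the product sigma-algebra.
\<close>

lemma Riemann_sum:
  fixes F :: "'a \<Rightarrow> 'b \<Rightarrow> real"
  assumes K: "compact K" and g: "integrable \<Lambda> g" "\<And>x. x \<notin> K \<Longrightarrow> g x = 0"
    and F: "\<And>x0 \<epsilon>. x0 \<in> K \<Longrightarrow> \<epsilon> > 0 \<Longrightarrow> \<exists>V. open V \<and> x0 \<in> V \<and> (\<forall>x\<in>V. \<forall>t. \<bar>F x t - F x0 t\<bar> \<le> \<epsilon>)"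
    and meas: "\<And>t. (\<lambda>x. F x t) \<in> borel_measurable borel" and bd: "\<And>x t. \<bar>F x t\<bar> \<le> C"
    and \<epsilon>: "0 < \<epsilon>"
  obtains n :: nat and \<alpha> :: "nat \<Rightarrow> real" and p where
    "\<And>j. j < n \<Longrightarrow> p j \<in> K" "(\<Sum>j<n. \<alpha> j) = (LINT x|\<Lambda>. g x)"
    "\<And>t. \<bar>(LINT x|\<Lambda>. g x * F x t) - (\<Sum>j<n. \<alpha> j * F (p j) t)\<bar> \<le> \<epsilon>"
    "\<And>j. (\<And>x. 0 \<le> g x) \<Longrightarrow> 0 \<le> \<alpha> j"
proof -
  \<comment> \<open>The summand 1 keeps the denominator positive when \<open>g\<close> vanishes
    almost everywhere.\<close>
  define \<delta> where "\<delta> = \<epsilon> / ((LINT x|\<Lambda>. \<bar>g x\<bar>) + 1)"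
  have pos: "(LINT x|\<Lambda>. \<bar>g x\<bar>) + 1 > 0"
    using Bochner_Integration.integral_nonneg[of \<Lambda> "\<lambda>x. \<bar>g x\<bar>"] by linarith
  then have \<delta>: "\<delta> > 0" "\<delta> * (LINT x|\<Lambda>. \<bar>g x\<bar>) \<le> \<epsilon>"
    using \<epsilon> by (auto simp: \<delta>_def field_simps)
  have "\<forall>x0\<in>K. \<exists>V. open V \<and> x0 \<in> V \<and> (\<forall>x\<in>V. \<forall>t. \<bar>F x t - F x0 t\<bar> \<le> \<delta>)"
    using F \<delta>(1) by blast
  from bchoice[OF this] obtain V where V: "\<And>x0. x0 \<in> K \<Longrightarrow> open (V x0) \<and> x0 \<in> V x0 \<and> (\<forall>x\<in>V x0. \<forall>t. \<bar>F x t - F x0 t\<bar> \<le> \<delta>)"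
    by blast
  obtain D where D: "D \<subseteq> K" "finite D" "K \<subseteq> (\<Union>c\<in>D. V c)"
    by (rule compactE_image[OF K, of K V]) (use V in auto)
  obtain n and p :: "nat \<Rightarrow> 'a" where p: "D = p ` {..<n}"
    using finite_imp_nat_seg_image_inj_on[OF D(2)] by (auto simp: lessThan_def)
  have pK: "p j \<in> K" if "j < n" for j using that D(1) p by auto
  \<comment> \<open>The finite cover is made disjoint: \<open>P j\<close> keeps the points of
    \<open>V (p j)\<close> that lie in no earlier set, so every point of \<open>K\<close> is in
    exactly one \<open>P j\<close> with \<open>j < n\<close>.\<close>
  define P where "P j = V (p j) - (\<Union>i<j. V (p i))" for j
  have P_meas: "P j \<in> sets borel" if "j < n" for j
    unfolding P_def using V[OF pK] that by (intro sets.Diff sets.finite_UN) auto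
  have pick: "(\<Sum>i<n. indicator (P i) x * a i) = a j" if "j < n" "x \<in> P j" for j x and a :: "nat \<Rightarrow> real"
  proof -
    have "indicator (P i) x * a i = (if i = j then a i else 0)" if "i < n" for i
    proof (cases i j rule: linorder_cases)
      case equal
      then show ?thesis using \<open>x \<in> P j\<close> by simp
    next
      case less
      then have "x \<notin> P i" using \<open>x \<in> P j\<close> unfolding P_def by auto
      then show ?thesis using less by simp
    next
      case greater
      then have "x \<notin> P i" using \<open>x \<in> P j\<close> unfolding P_def by auto
      then show ?thesis using greater by simp
    qed
    then have "(\<Sum>i<n. indicator (P i) x * a i) = (\<Sum>i<n. if i = j then a i else 0)"
      by (intro sum.cong) auto
    then show ?thesis using that by simp
  qed
  have cover: "\<exists>j<n. x \<in> P j" if "x \<in> K" for x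
  proof -
    have ex: "\<exists>j. j < n \<and> x \<in> V (p j)" using that D(3) p by auto
    define j where "j = (LEAST j. j < n \<and> x \<in> V (p j))"
    have "j < n \<and> x \<in> V (p j)" unfolding j_def by (rule LeastI_ex[OF ex])
    moreover have "x \<notin> V (p i)" if "i < j" for i
      using not_less_Least[OF that[unfolded j_def]] that calculation by auto
    ultimately show ?thesis unfolding P_def by auto
  qed
  \<comment> \<open>The weight of the sample point \<open>p j\<close> is the integral of
    \<open>g\<close> over its piece. Since \<open>g\<close> vanishes off \<open>K\<close>, the
    weights add up to the full integral.\<close>
  define \<alpha> where "\<alpha> j = (LINT x|\<Lambda>. indicator (P j) x * g x)" for j
  have ig: "integrable \<Lambda> (\<lambda>x. indicator (P j) x * g x)" if "j < n" for j
    using integrable_mult_indicator[OF _ g(1), of "P j"] P_meas[OF that] by simp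
  have sum_g: "(\<Sum>j<n. indicator (P j) x * g x) = g x" for x
  proof (cases "x \<in> K")
    case True
    then obtain j where "j < n" "x \<in> P j" using cover by blast
    from pick[OF this, of "\<lambda>_. g x"] show ?thesis .
  qed (simp add: g)
  show thesis
  proof (rule that)
    show "(\<Sum>j<n. \<alpha> j) = (LINT x|\<Lambda>. g x)"
      unfolding \<alpha>_def using ig by (subst Bochner_Integration.integral_sum[symmetric]) (auto simp: sum_g)
    fix t
    let ?G = "\<lambda>x. \<Sum>j<n. (indicator (P j) x * g x) * F (p j) t"
    have iG: "integrable \<Lambda> ?G"
      using ig by (intro Bochner_Integration.integrable_sum) auto
    have intG: "(LINT x|\<Lambda>. ?G x) = (\<Sum>j<n. \<alpha> j * F (p j) t)"
      unfolding \<alpha>_def using ig by (subst Bochner_Integration.integral_sum) auto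
    have iF: "integrable \<Lambda> (\<lambda>x. g x * F x t)"
      by (rule integrable_mult_bounded(1)[OF g(1) meas bd])
    have le: "\<bar>g x * F x t - ?G x\<bar> \<le> \<delta> * \<bar>g x\<bar>" for x
    proof (cases "x \<in> K")
      case True
      then obtain j where j: "j < n" "x \<in> P j" using cover by blast
      have "?G x = g x * F (p j) t"
        using pick[OF j, of "\<lambda>i. g x * F (p i) t"] by (simp add: mult.assoc)
      then have "\<bar>g x * F x t - ?G x\<bar> = \<bar>g x\<bar> * \<bar>F x t - F (p j) t\<bar>"
        by (simp add: abs_mult[symmetric] right_diff_distrib)
      also have "\<dots> \<le> \<bar>g x\<bar> * \<delta>"
        using V[OF pK[OF j(1)]] j by (intro mult_left_mono) (auto simp: P_def)
      finally show ?thesis by (simp add: mult.commute)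
    qed (simp add: g)
    have "\<bar>(LINT x|\<Lambda>. g x * F x t) - (LINT x|\<Lambda>. ?G x)\<bar> = \<bar>LINT x|\<Lambda>. g x * F x t - ?G x\<bar>"
      using iF iG by simp
    also have "\<dots> \<le> (LINT x|\<Lambda>. \<bar>g x * F x t - ?G x\<bar>)" by (rule integral_abs_bound)
    also have "\<dots> \<le> (LINT x|\<Lambda>. \<delta> * \<bar>g x\<bar>)"
      using iF iG g(1) le by (intro integral_mono) auto
    also have "\<dots> \<le> \<epsilon>" using \<delta>(2) by simp
    finally show "\<bar>(LINT x|\<Lambda>. g x * F x t) - (\<Sum>j<n. \<alpha> j * F (p j) t)\<bar> \<le> \<epsilon>"
      by (simp add: intG)
  next
    show "0 \<le> \<alpha> j" if "\<And>x. 0 \<le> g x" for j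
      unfolding \<alpha>_def using that by (intro integral_nonneg_AE) auto
  qed (use pK in auto)
qed

section \<open>Positivity on open sets and density of \<open>Cc\<close> in the integrable
  functions\<close>

text \<open>Finitely many left translates of a nonempty open set cover a given compact set. If the
  open set were null, all compact sets would be null, and by inner regularity so would the whole
  group.\<close>

lemma open_emeasure_pos:
  fixes O' :: "'a set"
  assumes "open O'" "O' \<noteq> {}"
  shows "emeasure \<Lambda> O' \<noteq> 0"
proof
  assume O0: "emeasure \<Lambda> O' = 0"
  have "(SUP K\<in>{K. compact K \<and> K \<subseteq> (UNIV::'a set)}. emeasure \<Lambda> K) \<noteq> 0"
    using Haar_UNIV by (subst (asm) Haar_inner[OF open_UNIV])
  moreover have "(SUP K\<in>{K. compact K \<and> K \<subseteq> (UNIV::'a set)}. emeasure \<Lambda> K) \<le> 0"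
    if "\<And>K. compact K \<Longrightarrow> emeasure \<Lambda> K = 0"
    using that by (intro SUP_least) auto
  ultimately obtain K :: "'a set" where K: "compact K" "emeasure \<Lambda> K \<noteq> 0"
    unfolding le_zero_eq by blast
  obtain z where z: "z \<in> O'" using assms by blast
  \<comment> \<open>\<open>T k\<close> is the left translate of \<open>O'\<close> that carries
    \<open>z\<close> to \<open>k\<close>.\<close>
  define T where "T k = (\<lambda>x. z - k + x) -` O'" for k
  have opT: "open (T k)" for k
    unfolding T_def by (intro open_vimage assms continuous_intros)
  have "k \<in> T k" for k using z by (simp add: T_def)
  obtain D where D: "D \<subseteq> K" "finite D" "K \<subseteq> (\<Union>k\<in>D. T k)"
    by (rule compactE_image[OF K(1), of K T]) (use opT \<open>\<And>k. k \<in> T k\<close> in auto)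
  have T0: "emeasure \<Lambda> (T k) = 0" for k
  proof -
    have "T k = (+) (- (z - k)) ` O'"
      unfolding T_def by (force simp: add.assoc[symmetric] image_iff simp del: minus_diff_eq)
    then show ?thesis using O0 assms by (simp add: Haar_left)
  qed
  have "emeasure \<Lambda> K \<le> emeasure \<Lambda> (\<Union>k\<in>D. T k)"
    using D \<open>\<And>k. open (T k)\<close> by (intro emeasure_mono) auto
  also have "\<dots> \<le> (\<Sum>k\<in>D. emeasure \<Lambda> (T k))"
    using D \<open>\<And>k. open (T k)\<close> by (intro emeasure_subadditive_finite) auto
  also have "\<dots> = 0" using T0 by simp
  finally show False using K by simp
qed

text \<open>A vanishing integral would make the nonempty open set where \<open>h\<close> is positive
  a null set.\<close>

lemma Cc_integral_pos:
  assumes "h \<in> Cc" "\<And>x. 0 \<le> h x" "0 < h z"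
  shows "0 < (LINT x|\<Lambda>. h x)"
proof (rule ccontr)
  assume "\<not> ?thesis"
  moreover have "0 \<le> (LINT x|\<Lambda>. h x)" using assms by simp
  ultimately have "(LINT x|\<Lambda>. h x) = 0" by linarith
  then have ae: "AE x in \<Lambda>. h x = 0"
    using integral_nonneg_eq_0_iff_AE[OF Cc_integrable[OF assms(1)]] assms(2) by simp
  have op: "open {x. 0 < h x}"
    using assms(1) by (auto elim!: CcE intro!: open_Collect_less continuous_intros)
  have "emeasure \<Lambda> {x. 0 < h x} = 0"
    using ae op by (intro AE_iff_measurable[THEN iffD1, of _ _ "\<lambda>x. \<not> 0 < h x"]) auto
  then show False using open_emeasure_pos[OF op] assms(3) by auto
qed

text \<open>Induction on integrable functions: multiples of indicators are handled by regularity and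
  Urysohn functions, sums by halving the error, limits by dominated convergence.\<close>

lemma Cc_dense_L1:
  fixes f :: "'a \<Rightarrow> real"
  assumes "integrable \<Lambda> f" "0 < \<epsilon>"
  obtains h where "h \<in> Cc" "(LINT x|\<Lambda>. \<bar>f x - h x\<bar>) < \<epsilon>"
proof -
  have "\<forall>\<epsilon>>0. \<exists>h\<in>Cc. (LINT x|\<Lambda>. \<bar>f x - h x\<bar>) < \<epsilon>"
    using assms(1)
  proof (induction rule: integrable_induct)
    case (base A c)
    show ?case
    proof (intro allI impI)
      fix \<epsilon> :: real assume "\<epsilon> > 0"
      define \<delta> where "\<delta> = \<epsilon> / (2 * \<bar>c\<bar> + 1)"
      have \<delta>: "\<delta> > 0" "2 * \<bar>c\<bar> * \<delta> < \<epsilon>" using \<open>\<epsilon> > 0\<close> by (auto simp: \<delta>_def field_simps)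
      have A: "A \<in> sets borel" "emeasure \<Lambda> A \<noteq> \<infinity>" using base by auto
      have "emeasure \<Lambda> A = (INF U\<in>{U. open U \<and> A \<subseteq> U}. emeasure \<Lambda> U)"
        by (rule Haar_outer[OF A(1)])
      from INF_approx_ennreal[OF _ this A(2), of \<delta>]
      obtain U where U: "open U" "A \<subseteq> U" "emeasure \<Lambda> U < emeasure \<Lambda> A + ennreal \<delta>"
        using \<delta> by auto
      have fU: "emeasure \<Lambda> U \<noteq> \<infinity>"
        using U(3) order_less_le_trans[OF U(3) top_greatest] by (simp add: less_top[symmetric])
      \<comment> \<open>Inner regularity is given for open sets, so \<open>K\<close> is chosen
        inside \<open>U\<close> and not inside \<open>A\<close>. Both \<open>A\<close> and
        \<open>K\<close> miss at most \<open>\<delta>\<close> of the measure of \<open>U\<close>,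
        which yields the error \<open>2 * \<bar>c\<bar> * \<delta>\<close>.\<close>
      have "emeasure \<Lambda> U = (SUP K\<in>{K. compact K \<and> K \<subseteq> U}. emeasure \<Lambda> K)"
        by (rule Haar_inner[OF U(1)])
      from SUP_approx_ennreal[OF _ _ this fU, of \<delta>]
      obtain K where K: "compact K" "K \<subseteq> U" "emeasure \<Lambda> U < emeasure \<Lambda> K + ennreal \<delta>"
        using \<delta> by auto
      obtain h where h: "h \<in> Cc" "\<And>x. 0 \<le> h x" "\<And>x. h x \<le> 1" "\<And>x. x \<in> K \<Longrightarrow> h x = 1" "\<And>x. x \<notin> U \<Longrightarrow> h x = 0"
        using Cc_Urysohn[OF K(1) U(1) K(2)] by metis
      have sets: "A \<in> fmeasurable \<Lambda>" "U \<in> fmeasurable \<Lambda>" "K \<in> fmeasurable \<Lambda>"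
        using A U fU compact_fmeasurable[OF K(1)] by (auto intro!: fmeasurableI simp: less_top[symmetric])
      have m: "measure \<Lambda> U < measure \<Lambda> A + \<delta>" "measure \<Lambda> U < measure \<Lambda> K + \<delta>"
        using U(3) K(3) sets \<delta>(1)
        by (auto simp: emeasure_eq_measure2 fmeasurableD2 emeasure_eq_ennreal_measure ennreal_plus[symmetric] ennreal_less_iff simp del: ennreal_plus)
      \<comment> \<open>Off \<open>U\<close> the indicator of \<open>A\<close> and \<open>h\<close>
        are both 0, and on \<open>A \<inter> K\<close> they are both 1. Every other point lies in
        \<open>U - A\<close> or in \<open>U - K\<close>.\<close>
      let ?b = "\<lambda>x. \<bar>c\<bar> * ((indicator U x - indicator A x) + (indicator U x - indicator K x)) :: real"
      have le: "\<bar>indicator A x *\<^sub>R c - c * h x\<bar> \<le> ?b x" for x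
      proof -
        have "\<bar>indicator A x - h x\<bar> \<le> (indicator U x - indicator A x) + (indicator U x - indicator K x)"
          using h(2)[of x] h(3)[of x] h(4)[of x] h(5)[of x] U(2) K(2)
          by (auto simp: indicator_def)
        then have "\<bar>c\<bar> * \<bar>indicator A x - h x\<bar> \<le> ?b x" by (rule mult_left_mono) simp
        then show ?thesis by (simp add: abs_mult[symmetric] right_diff_distrib mult.commute)
      qed
      have ib: "integrable \<Lambda> ?b" using sets by (auto simp: fmeasurable_def)
      have "integrable \<Lambda> (\<lambda>x. \<bar>indicator A x *\<^sub>R c - c * h x\<bar>)"
        using sets Cc_integrable[OF h(1)] by (auto simp: fmeasurable_def)
      then have "(LINT x|\<Lambda>. \<bar>indicator A x *\<^sub>R c - c * h x\<bar>) \<le> (LINT x|\<Lambda>. ?b x)"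
        using ib le by (intro integral_mono) auto
      also have "\<dots> = \<bar>c\<bar> * ((measure \<Lambda> U - measure \<Lambda> A) + (measure \<Lambda> U - measure \<Lambda> K))"
        using sets by (simp add: fmeasurable_def)
      also have "\<dots> \<le> \<bar>c\<bar> * (\<delta> + \<delta>)"
        using m by (intro mult_left_mono) auto
      also have "\<dots> < \<epsilon>" using \<delta>(2) by (simp add: algebra_simps)
      finally show "\<exists>h\<in>Cc. (LINT x|\<Lambda>. \<bar>indicator A x *\<^sub>R c - h x\<bar>) < \<epsilon>"
        using Cc_cmult[OF h(1), of c] by (intro bexI[of _ "\<lambda>x. c * h x"])
    qed
  next
    case (add f g)
    show ?case
    proof (intro allI impI)
      fix \<epsilon> :: real assume "\<epsilon> > 0"
      then have "\<epsilon>/2 > 0" by simp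
      then obtain h k where h: "h \<in> Cc" "(LINT x|\<Lambda>. \<bar>f x - h x\<bar>) < \<epsilon>/2"
        and k: "k \<in> Cc" "(LINT x|\<Lambda>. \<bar>g x - k x\<bar>) < \<epsilon>/2"
        using add.IH by metis
      note i = Cc_integrable[OF h(1)] Cc_integrable[OF k(1)] add.hyps
      have "(LINT x|\<Lambda>. \<bar>f x + g x - (h x + k x)\<bar>) \<le> (LINT x|\<Lambda>. \<bar>f x - h x\<bar> + \<bar>g x - k x\<bar>)"
        using i by (intro integral_mono) auto
      also have "\<dots> < \<epsilon>" using i h(2) k(2) by (subst Bochner_Integration.integral_add) auto
      finally show "\<exists>h\<in>Cc. (LINT x|\<Lambda>. \<bar>f x + g x - h x\<bar>) < \<epsilon>"
        using Cc_add[OF h(1) k(1)] by (intro bexI[of _ "\<lambda>x. h x + k x"])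
    qed
  next
    case (lim f s)
    show ?case
    proof (intro allI impI)
      fix \<epsilon> :: real assume "\<epsilon> > 0"
      have "(\<lambda>i. LINT x|\<Lambda>. \<bar>f x - s i x\<bar>) \<longlonglongrightarrow> (LINT x|\<Lambda>. 0)"
      \<comment> \<open>The approximating functions are bounded by twice
        \<open>\<bar>f x\<bar>\<close>, whence the factor 3.\<close>
      proof (rule integral_dominated_convergence[where w="\<lambda>x. 3 * \<bar>f x\<bar>"])
        show "AE x in \<Lambda>. (\<lambda>i. \<bar>f x - s i x\<bar>) \<longlonglongrightarrow> 0"
        proof (intro AE_I2 tendsto_rabs_zero)
          fix x assume "x \<in> space \<Lambda>"
          from tendsto_diff[OF tendsto_const[of "f x"] lim.hyps(2)[OF this]]
          show "(\<lambda>i. f x - s i x) \<longlonglongrightarrow> 0" by simp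
        qed
        show "AE x in \<Lambda>. norm \<bar>f x - s i x\<bar> \<le> 3 * \<bar>f x\<bar>" for i
        proof (intro AE_I2)
          fix x assume "x \<in> space \<Lambda>"
          from lim.hyps(3)[OF this, of i] show "norm \<bar>f x - s i x\<bar> \<le> 3 * \<bar>f x\<bar>" by simp
        qed
      qed (use lim.hyps(1,4) in auto)
      then have "\<forall>\<^sub>F i in sequentially. (LINT x|\<Lambda>. \<bar>f x - s i x\<bar>) < \<epsilon>/2"
        using \<open>\<epsilon> > 0\<close> by (intro order_tendstoD(2)[where y=0]) auto
      then obtain i where i: "(LINT x|\<Lambda>. \<bar>f x - s i x\<bar>) < \<epsilon>/2"
        by (meson eventually_sequentially order_refl)
      obtain h where h: "h \<in> Cc" "(LINT x|\<Lambda>. \<bar>s i x - h x\<bar>) < \<epsilon>/2"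
        using lim.IH[of i] \<open>\<epsilon> > 0\<close> by (meson half_gt_zero)
      note ii = Cc_integrable[OF h(1)] lim.hyps(1)[of i] lim.hyps(4)
      have "(LINT x|\<Lambda>. \<bar>f x - h x\<bar>) \<le> (LINT x|\<Lambda>. \<bar>f x - s i x\<bar> + \<bar>s i x - h x\<bar>)"
        using ii by (intro integral_mono) auto
      also have "\<dots> < \<epsilon>" using ii i h(2) by (subst Bochner_Integration.integral_add) auto
      finally show "\<exists>h\<in>Cc. (LINT x|\<Lambda>. \<bar>f x - h x\<bar>) < \<epsilon>"
        using h(1) by blast
    qed
  qed
  then show thesis using assms(2) that by blast
qed

end

section \<open>Closure properties of \<open>UC\<close>\<close>

lemma UC_bounded:
  assumes "\<psi> \<in> UC"
  obtains C where "0 \<le> C" "\<And>x. \<bar>\<psi> x\<bar> \<le> C"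
proof -
  from assms have "bounded (range \<psi>)" by (simp add: UC_def)
  then obtain C where C: "\<And>x. \<bar>\<psi> x\<bar> \<le> C" by (auto simp: bounded_iff)
  show thesis
    by (rule that[of "max C 0"]) (auto intro: order_trans[OF C])
qed

lemma UC_nbhd:
  assumes "\<psi> \<in> UC" "0 < \<epsilon>"
  obtains V where "open V" "z \<in> V" "\<And>x t. x \<in> V \<Longrightarrow> \<bar>\<psi> (x + t) - \<psi> (z + t)\<bar> \<le> \<epsilon>"
proof -
  have "\<exists>V. open V \<and> z \<in> V \<and> (\<forall>x\<in>V. \<forall>t. \<bar>\<psi> (x + t) - \<psi> (z + t)\<bar> \<le> \<epsilon>)"
    using assms by (simp add: UC_def)
  then show thesis using that by (elim exE conjE) simp
qed

text \<open>The form in which the factor \<open>\<psi> (- y + x)\<close> of a convolution meets the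
  continuity hypothesis of \<open>Riemann_sum\<close>.\<close>

lemma UC_nbhd_minus:
  assumes "\<psi> \<in> UC" "0 < \<epsilon>"
  shows "\<exists>V. open V \<and> x0 \<in> V \<and> (\<forall>x\<in>V. \<forall>t. \<bar>\<psi> (- x + t) - \<psi> (- x0 + t)\<bar> \<le> \<epsilon>)"
proof -
  obtain V where V: "open V" "- x0 \<in> V" "\<And>x t. x \<in> V \<Longrightarrow> \<bar>\<psi> (x + t) - \<psi> (- x0 + t)\<bar> \<le> \<epsilon>"
    using UC_nbhd[OF assms, where z="- x0"] by metis
  show ?thesis
  proof (intro exI conjI ballI allI)
    show "open ((\<lambda>x. - x) -` V)" by (intro open_vimage V continuous_intros)
  qed (use V in auto)
qed

lemma UCI:
  assumes "\<And>x. \<bar>\<psi> x\<bar> \<le> C"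
    and "\<And>x0 \<epsilon>. 0 < \<epsilon> \<Longrightarrow> \<exists>V. open V \<and> x0 \<in> V \<and> (\<forall>x\<in>V. \<forall>t. \<bar>\<psi> (x + t) - \<psi> (x0 + t)\<bar> \<le> \<epsilon>)"
  shows "\<psi> \<in> UC"
proof -
  have "bounded (range \<psi>)" using assms(1) by (auto simp: bounded_iff)
  then show ?thesis using assms(2) by (simp add: UC_def)
qed

lemma UC_cmult:
  assumes "\<psi> \<in> UC" shows "(\<lambda>x. c * \<psi> x) \<in> UC"
proof -
  obtain C where C: "0 \<le> C" "\<And>x. \<bar>\<psi> x\<bar> \<le> C" using UC_bounded[OF assms] by metis
  show ?thesis
  proof (rule UCI[of _ "\<bar>c\<bar> * C"])
    show "\<bar>c * \<psi> x\<bar> \<le> \<bar>c\<bar> * C" for x using C(2)[of x] by (simp add: abs_mult mult_left_mono)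
    fix x0 and \<epsilon> :: real assume "0 < \<epsilon>"
    then have "\<epsilon> / (\<bar>c\<bar> + 1) > 0" by simp
    from UC_nbhd[OF assms this, where z=x0]
    obtain V where V: "open V" "x0 \<in> V" "\<And>x t. x \<in> V \<Longrightarrow> \<bar>\<psi> (x + t) - \<psi> (x0 + t)\<bar> \<le> \<epsilon> / (\<bar>c\<bar> + 1)"
      by metis
    show "\<exists>V. open V \<and> x0 \<in> V \<and> (\<forall>x\<in>V. \<forall>t. \<bar>c * \<psi> (x + t) - c * \<psi> (x0 + t)\<bar> \<le> \<epsilon>)"
    proof (intro exI[of _ V] conjI ballI allI V)
      fix x t assume "x \<in> V"
      have "\<bar>c * \<psi> (x + t) - c * \<psi> (x0 + t)\<bar> = \<bar>c\<bar> * \<bar>\<psi> (x + t) - \<psi> (x0 + t)\<bar>"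
        by (simp add: abs_mult[symmetric] right_diff_distrib)
      also have "\<dots> \<le> \<bar>c\<bar> * (\<epsilon> / (\<bar>c\<bar> + 1))" by (intro mult_left_mono V \<open>x \<in> V\<close>) simp
      also have "\<dots> \<le> \<epsilon>" using \<open>0 < \<epsilon>\<close> by (simp add: field_simps)
      finally show "\<bar>c * \<psi> (x + t) - c * \<psi> (x0 + t)\<bar> \<le> \<epsilon>" .
    qed
  qed
qed

lemma UC_add:
  assumes "\<phi> \<in> UC" "\<psi> \<in> UC" shows "(\<lambda>x. \<phi> x + \<psi> x) \<in> UC"
proof -
  obtain C where C: "0 \<le> C" "\<And>x. \<bar>\<phi> x\<bar> \<le> C" using UC_bounded[OF assms(1)] by metis
  obtain D where D: "0 \<le> D" "\<And>x. \<bar>\<psi> x\<bar> \<le> D" using UC_bounded[OF assms(2)] by metis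
  show ?thesis
  proof (rule UCI[of _ "C + D"])
    show "\<bar>\<phi> x + \<psi> x\<bar> \<le> C + D" for x using C(2)[of x] D(2)[of x] by linarith
    fix x0 and \<epsilon> :: real assume "0 < \<epsilon>"
    then have e: "0 < \<epsilon> / 2" by simp
    obtain V where V: "open V" "x0 \<in> V" "\<And>x t. x \<in> V \<Longrightarrow> \<bar>\<phi> (x + t) - \<phi> (x0 + t)\<bar> \<le> \<epsilon> / 2"
      using UC_nbhd[OF assms(1) e, where z=x0] by metis
    obtain W where W: "open W" "x0 \<in> W" "\<And>x t. x \<in> W \<Longrightarrow> \<bar>\<psi> (x + t) - \<psi> (x0 + t)\<bar> \<le> \<epsilon> / 2"
      using UC_nbhd[OF assms(2) e, where z=x0] by metis
    show "\<exists>V. open V \<and> x0 \<in> V \<and> (\<forall>x\<in>V. \<forall>t. \<bar>\<phi> (x + t) + \<psi> (x + t) - (\<phi> (x0 + t) + \<psi> (x0 + t))\<bar> \<le> \<epsilon>)"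
    proof (intro exI[of _ "V \<inter> W"] conjI ballI allI)
      fix x t assume "x \<in> V \<inter> W"
      then have "\<bar>\<phi> (x + t) - \<phi> (x0 + t)\<bar> \<le> \<epsilon> / 2" "\<bar>\<psi> (x + t) - \<psi> (x0 + t)\<bar> \<le> \<epsilon> / 2"
        using V(3) W(3) by auto
      then show "\<bar>\<phi> (x + t) + \<psi> (x + t) - (\<phi> (x0 + t) + \<psi> (x0 + t))\<bar> \<le> \<epsilon>"
        by linarith
    qed (use V W in auto)
  qed
qed

lemma UC_left:
  assumes "\<psi> \<in> UC" shows "(\<lambda>x. \<psi> (a + x)) \<in> UC"
proof -
  obtain C where C: "0 \<le> C" "\<And>x. \<bar>\<psi> x\<bar> \<le> C" using UC_bounded[OF assms] by metis
  show ?thesis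
  proof (rule UCI[of _ C])
    fix x0 and \<epsilon> :: real assume e: "0 < \<epsilon>"
    obtain V where V: "open V" "a + x0 \<in> V" "\<And>x t. x \<in> V \<Longrightarrow> \<bar>\<psi> (x + t) - \<psi> (a + x0 + t)\<bar> \<le> \<epsilon>"
      using UC_nbhd[OF assms e, where z="a + x0"] by metis
    show "\<exists>V. open V \<and> x0 \<in> V \<and> (\<forall>x\<in>V. \<forall>t. \<bar>\<psi> (a + (x + t)) - \<psi> (a + (x0 + t))\<bar> \<le> \<epsilon>)"
    proof (intro exI[of _ "(\<lambda>x. a + x) -` V"] conjI ballI allI)
      show "open ((\<lambda>x. a + x) -` V)" by (intro open_vimage V continuous_intros)
    qed (use V in \<open>auto simp: add.assoc[symmetric]\<close>)
  qed (use C in auto)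
qed

lemma UC_const: "(\<lambda>x. c) \<in> UC"
  by (rule UCI[of _ "\<bar>c\<bar>"]) (auto intro: exI[of _ UNIV])

lemma UC_sum:
  assumes "finite I" "\<And>i. i \<in> I \<Longrightarrow> f i \<in> UC"
  shows "(\<lambda>x. \<Sum>i\<in>I. f i x) \<in> UC"
  using assms by (induction I rule: finite_induct) (auto simp: UC_const UC_add)

lemma UC_uniform_limit:
  assumes "\<And>\<epsilon>. 0 < \<epsilon> \<Longrightarrow> \<exists>\<phi>\<in>UC. \<forall>x. \<bar>\<psi> x - \<phi> x\<bar> \<le> \<epsilon>"
  shows "\<psi> \<in> UC"
proof -
  obtain \<phi> where \<phi>: "\<phi> \<in> UC" "\<forall>x. \<bar>\<psi> x - \<phi> x\<bar> \<le> 1" using assms[OF zero_less_one] ..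
  obtain C where C: "\<And>x. \<bar>\<phi> x\<bar> \<le> C" using UC_bounded[OF \<phi>(1)] by metis
  show ?thesis
  proof (rule UCI[of _ "C + 1"])
    show "\<bar>\<psi> x\<bar> \<le> C + 1" for x using C[of x] \<phi>(2)[rule_format, of x] by linarith
    fix x0 and \<epsilon> :: real assume "0 < \<epsilon>"
    then have e: "0 < \<epsilon> / 3" by simp
    obtain \<phi> where \<phi>: "\<phi> \<in> UC" "\<forall>x. \<bar>\<psi> x - \<phi> x\<bar> \<le> \<epsilon> / 3" using assms[OF e] ..
    obtain V where V: "open V" "x0 \<in> V" "\<And>x t. x \<in> V \<Longrightarrow> \<bar>\<phi> (x + t) - \<phi> (x0 + t)\<bar> \<le> \<epsilon> / 3"
      using UC_nbhd[OF \<phi>(1) e, where z=x0] by metis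
    show "\<exists>V. open V \<and> x0 \<in> V \<and> (\<forall>x\<in>V. \<forall>t. \<bar>\<psi> (x + t) - \<psi> (x0 + t)\<bar> \<le> \<epsilon>)"
    proof (intro exI[of _ V] conjI ballI allI V)
      fix x t assume "x \<in> V"
      then show "\<bar>\<psi> (x + t) - \<psi> (x0 + t)\<bar> \<le> \<epsilon>"
        using V(3)[of x t] \<phi>(2)[rule_format, of "x + t"] \<phi>(2)[rule_format, of "x0 + t"] by linarith
    qed
  qed
qed

section \<open>Convolutions are bounded and lie in \<open>UC\<close>\<close>

context haar_group
begin

lemma measurable_reflect:
  assumes "\<phi> \<in> borel_measurable borel"
  shows "(\<lambda>y::'a. \<phi> (- y + x) :: real) \<in> borel_measurable borel"
proof -
  have "(\<lambda>y::'a. - y + x) \<in> borel_measurable borel"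
    by (intro borel_measurable_continuous_onI continuous_intros)
  from measurable_compose[OF this assms] show ?thesis .
qed

text \<open>The substitution of \<open>x + y\<close> for \<open>y\<close> moves the translation by
  \<open>x\<close> from \<open>\<phi>\<close> to \<open>f\<close>. Hence the continuity of the
  convolution in \<open>x\<close> is inherited from \<open>f\<close>, while \<open>\<phi>\<close>
  may be merely measurable.\<close>

lemma convolution_shift:
  assumes "f \<in> borel_measurable borel" "\<phi> \<in> borel_measurable borel"
  shows "convolution \<Lambda> f \<phi> (x + t) = (LINT y|\<Lambda>. f (x + y) * \<phi> (- y + t))"
proof -
  have "(LINT y|\<Lambda>. f (x + y) * \<phi> (- (x + y) + (x + t))) = (LINT y|\<Lambda>. f y * \<phi> (- y + (x + t)))"
    by (rule integral_left) (intro borel_measurable_times assms measurable_reflect)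
  moreover have "- (x + y) + (x + t) = - y + t" for y
    by (simp add: minus_add add.assoc[symmetric])
  ultimately show ?thesis by (simp add: convolution_def)
qed

lemma convolution_bound:
  assumes "integrable \<Lambda> f" "\<phi> \<in> borel_measurable borel" "\<And>x. \<bar>\<phi> x\<bar> \<le> C"
  shows "\<bar>convolution \<Lambda> f \<phi> x\<bar> \<le> C * (LINT x|\<Lambda>. \<bar>f x\<bar>)"
  unfolding convolution_def using integrable_mult_bounded(2)[OF assms(1) measurable_reflect[OF assms(2)] assms(3)] .

lemma convolution_diff:
  assumes "integrable \<Lambda> f" "integrable \<Lambda> g" "\<phi> \<in> borel_measurable borel" "\<And>x. \<bar>\<phi> x\<bar> \<le> C"
  shows "convolution \<Lambda> (\<lambda>x. f x - g x) \<phi> x = convolution \<Lambda> f \<phi> x - convolution \<Lambda> g \<phi> x"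
  unfolding convolution_def left_diff_distrib
  by (rule Bochner_Integration.integral_diff; rule integrable_mult_bounded(1)[OF _ measurable_reflect[OF assms(3)] assms(4)]) (rule assms)+

text \<open>By \<open>convolution_shift\<close>, the difference of two values is the integral of
  \<open>f (x + y) - f (x0 + y)\<close> against a function bounded by \<open>C\<close>. That
  difference is uniformly small in \<open>y\<close> and vanishes off a compact set \<open>M\<close>
  independent of \<open>x\<close> near \<open>x0\<close>.\<close>

lemma convolution_UC_Cc:
  assumes f: "f \<in> Cc" and \<phi>: "\<phi> \<in> borel_measurable borel" "\<And>x. \<bar>\<phi> x\<bar> \<le> C"
  shows "convolution \<Lambda> f \<phi> \<in> UC"
proof (rule UCI[of _ "C * (LINT x|\<Lambda>. \<bar>f x\<bar>)"])
  show "\<bar>convolution \<Lambda> f \<phi> x\<bar> \<le> C * (LINT x|\<Lambda>. \<bar>f x\<bar>)" for x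
    by (rule convolution_bound[OF Cc_integrable[OF f] \<phi>])
  fix x0 :: 'a and \<epsilon> :: real assume "0 < \<epsilon>"
  have C0: "0 \<le> C" using \<phi>(2)[of undefined] by linarith
  obtain K where K: "compact K" "continuous_on UNIV f" "\<And>x. x \<notin> K \<Longrightarrow> f x = 0"
    using f by (elim CcE) blast
  obtain U L where U: "open U" "compact L" "{x0} \<subseteq> U" "U \<subseteq> L"
    by (rule compact_nbhd[of "{x0}"]) auto
  define M where "M = {x + y |x y. x \<in> uminus ` L \<and> y \<in> K}"
  have "compact (uminus ` L)"
    using U by (intro compact_continuous_image continuous_intros)
  then have M: "compact M" unfolding M_def using K(1) by (rule compact_add_sets)
  have out: "f (x + t) = 0" if "x \<in> L" "t \<notin> M" for x t
  proof (rule K(3), rule notI)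
    assume "x + t \<in> K"
    moreover have "t = - x + (x + t)" by (simp add: add.assoc[symmetric])
    ultimately show False using that unfolding M_def by blast
  qed
  define \<delta> where "\<delta> = \<epsilon> / (C * measure \<Lambda> M + 1)"
  have pos: "C * measure \<Lambda> M + 1 > 0" using C0 by (simp add: add_nonneg_pos)
  then have \<delta>: "0 < \<delta>" "C * (\<delta> * measure \<Lambda> M) \<le> \<epsilon>"
    using \<open>0 < \<epsilon>\<close> by (auto simp: \<delta>_def field_simps)
  obtain V where V: "open V" "x0 \<in> V" "\<And>x t. x \<in> V \<Longrightarrow> \<bar>f (x + t) - f (x0 + t)\<bar> \<le> \<delta>"
    using UC_nbhd[OF Cc_subset_UC[OF f] \<delta>(1), where z=x0] by metis
  have fm: "f \<in> borel_measurable borel" by (rule Cc_measurable[OF f])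
  show "\<exists>V. open V \<and> x0 \<in> V \<and> (\<forall>x\<in>V. \<forall>t. \<bar>convolution \<Lambda> f \<phi> (x + t) - convolution \<Lambda> f \<phi> (x0 + t)\<bar> \<le> \<epsilon>)"
  proof (intro exI[of _ "V \<inter> U"] conjI ballI allI)
    fix x t assume x: "x \<in> V \<inter> U"
    have i: "integrable \<Lambda> (\<lambda>y. f (x + y))" for x
      by (rule integrable_left[OF Cc_integrable[OF f]])
    have eq: "convolution \<Lambda> f \<phi> (x + t) - convolution \<Lambda> f \<phi> (x0 + t) = (LINT y|\<Lambda>. (f (x + y) - f (x0 + y)) * \<phi> (- y + t))"
      unfolding convolution_shift[OF fm \<phi>(1)] left_diff_distrib
      by (rule Bochner_Integration.integral_diff[symmetric]; rule integrable_mult_bounded(1)[OF i measurable_reflect[OF \<phi>(1)] \<phi>(2)])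
    have "\<bar>\<dots>\<bar> \<le> C * (LINT y|\<Lambda>. \<bar>f (x + y) - f (x0 + y)\<bar>)"
      by (rule integrable_mult_bounded(2)[OF _ measurable_reflect[OF \<phi>(1)] \<phi>(2)]) (use i in auto)
    also have "\<dots> \<le> C * \<bar>LINT y|\<Lambda>. \<bar>f (x + y) - f (x0 + y)\<bar>\<bar>"
      using C0 by (intro mult_left_mono) auto
    also have "\<dots> \<le> C * (\<delta> * measure \<Lambda> M)"
    proof (intro mult_left_mono C0 integrable_compact(2)[OF _ M])
      show "(\<lambda>y. \<bar>f (x + y) - f (x0 + y)\<bar>) \<in> borel_measurable borel"
        using i[of x] i[of x0] unfolding measurable_Haar[symmetric] by (intro borel_measurable_abs borel_measurable_diff) auto
      show "\<bar>f (x + y) - f (x0 + y)\<bar> = 0" if "y \<notin> M" for y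
      proof -
        have "f (x + y) = 0" "f (x0 + y) = 0" using that x U by (auto intro!: out)
        then show ?thesis by simp
      qed
      show "\<bar>\<bar>f (x + y) - f (x0 + y)\<bar>\<bar> \<le> \<delta>" for y using V(3) x by simp
    qed
    finally show "\<bar>convolution \<Lambda> f \<phi> (x + t) - convolution \<Lambda> f \<phi> (x0 + t)\<bar> \<le> \<epsilon>"
      using \<delta>(2) by (simp add: eq)
  qed (use V U in auto)
qed

text \<open>Approximating \<open>f\<close> in the integral norm by elements of \<open>Cc\<close>
  approximates the convolution uniformly, and \<open>UC\<close> is closed under uniform
  limits.\<close>

lemma convolution_UC:
  assumes f: "integrable \<Lambda> f" and \<phi>: "\<phi> \<in> borel_measurable borel" "\<And>x. \<bar>\<phi> x\<bar> \<le> C"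
  shows "convolution \<Lambda> f \<phi> \<in> UC"
proof (rule UC_uniform_limit)
  fix \<epsilon> :: real assume "0 < \<epsilon>"
  have C0: "0 \<le> C" using \<phi>(2)[of undefined] by linarith
  then have "0 < \<epsilon> / (C + 1)" using \<open>0 < \<epsilon>\<close> by simp
  from Cc_dense_L1[OF f this]
  obtain h where h: "h \<in> Cc" "(LINT x|\<Lambda>. \<bar>f x - h x\<bar>) < \<epsilon> / (C + 1)" .
  show "\<exists>\<psi>\<in>UC. \<forall>x. \<bar>convolution \<Lambda> f \<phi> x - \<psi> x\<bar> \<le> \<epsilon>"
  proof (intro bexI[OF _ convolution_UC_Cc[OF h(1) \<phi>]] allI)
    fix x
    note i = f Cc_integrable[OF h(1)]
    have "\<bar>convolution \<Lambda> f \<phi> x - convolution \<Lambda> h \<phi> x\<bar> \<le> C * (LINT x|\<Lambda>. \<bar>f x - h x\<bar>)"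
      unfolding convolution_diff[OF i \<phi>, symmetric]
      by (rule convolution_bound[OF _ \<phi>]) (use i in auto)
    also have "\<dots> \<le> C * (\<epsilon> / (C + 1))" using h(2) C0 by (intro mult_left_mono) auto
    also have "\<dots> \<le> \<epsilon>" using C0 \<open>0 < \<epsilon>\<close> by (simp add: field_simps)
    finally show "\<bar>convolution \<Lambda> f \<phi> x - convolution \<Lambda> h \<phi> x\<bar> \<le> \<epsilon>" .
  qed
qed

end

text \<open>Turns approximation arguments into equalities without normalising the constant in front
  of the error.\<close>

lemma eq_if_close:
  fixes a b C :: real
  assumes "\<And>\<epsilon>. 0 < \<epsilon> \<Longrightarrow> \<bar>a - b\<bar> \<le> C * \<epsilon>"
  shows "a = b"
proof (rule ccontr)
  assume "a \<noteq> b"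
  define \<epsilon> where "\<epsilon> = \<bar>a - b\<bar> / (2 * (\<bar>C\<bar> + 1))"
  have e: "0 < \<epsilon>" using \<open>a \<noteq> b\<close> by (simp add: \<epsilon>_def)
  have "\<bar>a - b\<bar> \<le> C * \<epsilon>" by (rule assms[OF e])
  also have "\<dots> \<le> (\<bar>C\<bar> + 1) * \<epsilon>" using e by (intro mult_right_mono) auto
  also have "\<dots> = \<bar>a - b\<bar> / 2" by (simp add: \<epsilon>_def field_simps)
  finally show False using \<open>a \<noteq> b\<close> by simp
qed

context haar_group
begin

text \<open>A convolution is a uniform limit of combinations of left translates of
  \<open>\<psi>\<close> whose weights add up to the integral of \<open>f\<close>. A left-invariant
  functional sees only this total weight.\<close>

lemma convolution_Riemann_sum:
  assumes K: "compact K" and f: "integrable \<Lambda> f" "\<And>x. x \<notin> K \<Longrightarrow> f x = 0"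
    and \<psi>: "\<psi> \<in> UC" and \<epsilon>: "0 < \<epsilon>"
  shows "\<exists>(n::nat) \<alpha> p. (\<forall>j<n. p j \<in> K) \<and> (\<Sum>j<n. \<alpha> j) = (LINT x|\<Lambda>. f x) \<and>
    (\<forall>x. \<bar>convolution \<Lambda> f \<psi> x - (\<Sum>j<n. \<alpha> j * \<psi> (- p j + x))\<bar> \<le> \<epsilon>)"
proof -
  obtain C where C: "0 \<le> C" "\<And>x. \<bar>\<psi> x\<bar> \<le> C" using UC_bounded[OF \<psi>] by metis
  have m: "\<psi> \<in> borel_measurable borel"
    by (rule borel_measurable_continuous_onI[OF UC_cont[OF \<psi>]])
  show ?thesis
  proof (rule Riemann_sum[OF K f, of "\<lambda>y x. \<psi> (- y + x)" C \<epsilon>])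
    fix n :: nat and \<alpha> :: "nat \<Rightarrow> real" and p
    assume "\<And>j. j < n \<Longrightarrow> p j \<in> K" "(\<Sum>j<n. \<alpha> j) = (LINT x|\<Lambda>. f x)"
      "\<And>x. \<bar>(LINT y|\<Lambda>. f y * \<psi> (- y + x)) - (\<Sum>j<n. \<alpha> j * \<psi> (- p j + x))\<bar> \<le> \<epsilon>"
    then show ?thesis unfolding convolution_def by (intro exI[of _ n] exI[of _ \<alpha>] exI[of _ p]) simp
  qed (use UC_nbhd_minus[OF \<psi>] measurable_reflect[OF m] C \<epsilon> in auto)
qed

text \<open>Reflection exchanges left and right translations, so the statement follows from left
  uniform continuity of \<open>f (- x)\<close>.\<close>

lemma Cc_right_nbhd:
  assumes "f \<in> Cc" "0 < \<epsilon>"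
  obtains V :: "'a set" where "open V" "0 \<in> V" "\<And>x y. y \<in> V \<Longrightarrow> \<bar>f (x + y) - f x\<bar> \<le> \<epsilon>"
proof -
  obtain V where V: "open V" "0 \<in> V" "\<And>v t. v \<in> V \<Longrightarrow> \<bar>f (- (v + t)) - f (- (0 + t))\<bar> \<le> \<epsilon>"
    using UC_nbhd[OF Cc_subset_UC[OF Cc_minus[OF assms(1)]] assms(2), where z=0] by metis
  show thesis
  proof (rule that)
    show "open (uminus -` V)" by (intro open_vimage V continuous_intros)
    show "\<bar>f (x + y) - f x\<bar> \<le> \<epsilon>" if "y \<in> uminus -` V" for x y
      using V(3)[of "- y" "- x"] that by (simp add: minus_add)
  qed (use V in auto)
qed

end

section \<open>Uniqueness of invariant functionals\<close>

text \<open>Boundedness on functions supported in a fixed compact set stands in for positivity: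
  functionals such as \<open>f \<mapsto> \<Theta> s (convolution \<Lambda> f \<phi>)\<close> need
  not be positive, because \<open>\<phi>\<close> may change sign.\<close>

locale invariant_functional = haar_group \<Lambda>
  for \<Lambda> :: "'a :: {topological_group_add, t2_space} measure" +
  fixes J :: "('a \<Rightarrow> real) \<Rightarrow> real"
  assumes add: "\<And>f g. f \<in> Cc \<Longrightarrow> g \<in> Cc \<Longrightarrow> J (\<lambda>x. f x + g x) = J f + J g"
    and cmult: "\<And>c f. f \<in> Cc \<Longrightarrow> J (\<lambda>x. c * f x) = c * J f"
    and inv: "\<And>a f. f \<in> Cc \<Longrightarrow> J (\<lambda>x. f (a + x)) = J f"
    and bd: "\<And>K. compact K \<Longrightarrow> \<exists>C. \<forall>f\<in>Cc. \<forall>\<epsilon>. (\<forall>x. x \<notin> K \<longrightarrow> f x = 0) \<longrightarrow> (\<forall>x. \<bar>f x\<bar> \<le> \<epsilon>) \<longrightarrow> \<bar>J f\<bar> \<le> C * \<epsilon>"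
begin

text \<open>\<open>J\<close> is exchanged with the integral by means of Riemann sums. Each left
  translate of \<open>e\<close> contributes its weight times \<open>J e\<close>, and the errors are
  all supported in the compact set \<open>M\<close>, where \<open>J\<close> is controlled by the
  supremum.\<close>

lemma convolution_functional:
  assumes f: "f \<in> Cc" "compact K" "\<And>x. x \<notin> K \<Longrightarrow> f x = 0"
    and e: "e \<in> Cc" "compact L" "\<And>x. x \<notin> L \<Longrightarrow> e x = 0"
  shows "convolution \<Lambda> f e \<in> Cc"
    "\<And>x. x \<notin> {k + l |k l. k \<in> K \<and> l \<in> L} \<Longrightarrow> convolution \<Lambda> f e x = 0"
    "J (convolution \<Lambda> f e) = J e * (LINT x|\<Lambda>. f x)"
proof -
  define M where "M = {k + l |k l. k \<in> K \<and> l \<in> L}"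
  have M: "compact M" unfolding M_def using f(2) e(2) by (rule compact_add_sets)
  have eM: "e (- y + x) = 0" if "x \<notin> M" "y \<in> K" for x y
  proof (rule e(3), rule notI)
    assume "- y + x \<in> L"
    moreover have "x = y + (- y + x)" by (simp add: add.assoc[symmetric])
    ultimately show False using that unfolding M_def by blast
  qed
  show out: "convolution \<Lambda> f e x = 0" if "x \<notin> {k + l |k l. k \<in> K \<and> l \<in> L}" for x
  proof -
    have "f y * e (- y + x) = 0" for y
      using eM[of x y] f(3)[of y] that unfolding M_def by (cases "y \<in> K") auto
    then show ?thesis by (simp only: convolution_def) simp
  qed
  obtain C where C: "\<And>x. \<bar>e x\<bar> \<le> C" using Cc_bounded[OF e(1)] by metis
  show conv: "convolution \<Lambda> f e \<in> Cc"
    using UC_cont[OF convolution_UC_Cc[OF f(1) Cc_measurable[OF e(1)] C]] M out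
    by (intro CcI[of _ M]) (auto simp: M_def)
  obtain B where B: "\<And>f \<epsilon>. f \<in> Cc \<Longrightarrow> (\<And>x. x \<notin> M \<Longrightarrow> f x = 0) \<Longrightarrow> (\<And>x. \<bar>f x\<bar> \<le> \<epsilon>) \<Longrightarrow> \<bar>J f\<bar> \<le> B * \<epsilon>"
    using bd[OF M] by metis
  show "J (convolution \<Lambda> f e) = J e * (LINT x|\<Lambda>. f x)"
  proof (rule eq_if_close)
    fix \<epsilon> :: real assume \<epsilon>: "0 < \<epsilon>"
    have "\<exists>(n::nat) \<alpha> p. (\<forall>j<n. p j \<in> K) \<and> (\<Sum>j<n. \<alpha> j) = (LINT x|\<Lambda>. f x) \<and>
        (\<forall>x. \<bar>convolution \<Lambda> f e x - (\<Sum>j<n. \<alpha> j * e (- p j + x))\<bar> \<le> \<epsilon>)"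
      by (rule convolution_Riemann_sum[OF f(2) Cc_integrable[OF f(1)] _ Cc_subset_UC[OF e(1)] \<epsilon>]) (rule f(3))
    then obtain n :: nat and \<alpha> p where R: "\<And>j. j < n \<Longrightarrow> p j \<in> K" "(\<Sum>j<n. \<alpha> j) = (LINT x|\<Lambda>. f x)"
      "\<And>x. \<bar>convolution \<Lambda> f e x - (\<Sum>j<n. \<alpha> j * e (- p j + x))\<bar> \<le> \<epsilon>"
      by auto
    have G: "(\<lambda>x. \<Sum>j<k. \<alpha> j * e (- p j + x)) \<in> Cc \<and>
        J (\<lambda>x. \<Sum>j<k. \<alpha> j * e (- p j + x)) = (\<Sum>j<k. \<alpha> j) * J e" for k
    proof (induction k)
      case 0
      have "(\<lambda>x::'a. 0) \<in> Cc" by (auto intro!: CcI[of _ "{}"])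
      then show ?case using cmult[of "\<lambda>x. 0" 0] by simp
    next
      case (Suc k)
      have e': "(\<lambda>x. \<alpha> k * e (- p k + x)) \<in> Cc" "(\<lambda>x. e (- p k + x)) \<in> Cc"
        using Cc_cmult Cc_left e(1) by blast+
      have "J (\<lambda>x. \<alpha> k * e (- p k + x)) = \<alpha> k * J e"
        using cmult[OF e'(2)] inv[OF e(1)] by simp
      then show ?case using Suc e' add[of "\<lambda>x. \<Sum>j<k. \<alpha> j * e (- p j + x)" "\<lambda>x. \<alpha> k * e (- p k + x)"]
        by (simp add: Cc_add algebra_simps)
    qed
    let ?G = "\<lambda>x. \<Sum>j<n. \<alpha> j * e (- p j + x)"
    have "J (convolution \<Lambda> f e) = J (\<lambda>x. (convolution \<Lambda> f e x - ?G x) + ?G x)" by simp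
    also have "\<dots> = J (\<lambda>x. convolution \<Lambda> f e x - ?G x) + (\<Sum>j<n. \<alpha> j) * J e"
      using G[of n] conv by (subst add) (auto intro: Cc_diff)
    finally have "J (convolution \<Lambda> f e) - J e * (LINT x|\<Lambda>. f x) = J (\<lambda>x. convolution \<Lambda> f e x - ?G x)"
      using R(2) by simp
    also have "\<bar>\<dots>\<bar> \<le> B * \<epsilon>"
    proof (rule B)
      show "(\<lambda>x. convolution \<Lambda> f e x - ?G x) \<in> Cc" using G[of n] conv by (auto intro: Cc_diff)
      show "convolution \<Lambda> f e x - ?G x = 0" if "x \<notin> M" for x
        using out[of x] that eM[OF that R(1)] unfolding M_def[symmetric] by simp
    qed (use R in auto)
    finally show "\<bar>J (convolution \<Lambda> f e) - J e * (LINT x|\<Lambda>. f x)\<bar> \<le> B * \<epsilon>" .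
  qed
qed

text \<open>If \<open>e\<close> is concentrated near \<open>0\<close>, then \<open>f * e\<close> is uniformly close to \<open>f\<close>.\<close>

lemma functional_approx:
  assumes f: "f \<in> Cc" and W: "compact W"
  shows "\<exists>C. \<forall>e \<epsilon>. e \<in> Cc \<and> (\<forall>x. 0 \<le> e x) \<and> (\<forall>x. x \<notin> W \<longrightarrow> e x = 0) \<and>
     (LINT y|\<Lambda>. e (- y)) = 1 \<and> (\<forall>x y. e (- y) \<noteq> 0 \<longrightarrow> \<bar>f (x + y) - f x\<bar> \<le> \<epsilon>) \<longrightarrow>
     \<bar>J f - J e * (LINT x|\<Lambda>. f x)\<bar> \<le> C * \<epsilon>"
proof -
  obtain K where K: "compact K" "continuous_on UNIV f" "\<And>x. x \<notin> K \<Longrightarrow> f x = 0"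
    using f by (elim CcE) blast
  define M where "M = {k + l |k l. k \<in> K \<and> l \<in> W}"
  have M: "compact (M \<union> K)" unfolding M_def using K W by (intro compact_Un compact_add_sets)
  obtain B where B: "\<And>f \<epsilon>. f \<in> Cc \<Longrightarrow> (\<And>x. x \<notin> M \<union> K \<Longrightarrow> f x = 0) \<Longrightarrow> (\<And>x. \<bar>f x\<bar> \<le> \<epsilon>) \<Longrightarrow> \<bar>J f\<bar> \<le> B * \<epsilon>"
    using bd[OF M] by metis
  show ?thesis
  proof (intro exI[of _ B] allI impI, elim conjE)
    fix e :: "'a \<Rightarrow> real" and \<epsilon> :: real
    assume "e \<in> Cc" "\<forall>x. 0 \<le> e x" "\<forall>x. x \<notin> W \<longrightarrow> e x = 0" "(LINT y|\<Lambda>. e (- y)) = 1"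
      and "\<forall>x y. e (- y) \<noteq> 0 \<longrightarrow> \<bar>f (x + y) - f x\<bar> \<le> \<epsilon>"
    then have e: "e \<in> Cc" "\<And>x. 0 \<le> e x" "\<And>x. x \<notin> W \<Longrightarrow> e x = 0" "(LINT y|\<Lambda>. e (- y)) = 1"
      and close: "\<And>x y. e (- y) \<noteq> 0 \<Longrightarrow> \<bar>f (x + y) - f x\<bar> \<le> \<epsilon>"
      by auto
    note c = convolution_functional[OF f K(1,3) e(1) W e(3), folded M_def]
    obtain C where C: "\<And>x. \<bar>f x\<bar> \<le> C" using Cc_bounded[OF f] by metis
    have ie: "integrable \<Lambda> (\<lambda>y. e (- y))" by (rule Cc_integrable[OF Cc_minus[OF e(1)]])
    have close': "\<bar>convolution \<Lambda> f e x - f x\<bar> \<le> \<epsilon>" for x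
    proof -
      \<comment> \<open>In this form the convolution averages \<open>f (x + y)\<close> against the
        probability density \<open>e (- y)\<close>.\<close>
      have sh: "convolution \<Lambda> f e x = (LINT y|\<Lambda>. e (- y) * f (x + y))"
        using convolution_shift[OF Cc_measurable[OF f] Cc_measurable[OF e(1)], of x 0] by (simp add: mult.commute)
      have i: "integrable \<Lambda> (\<lambda>y. e (- y) * f (x + y))"
        by (rule integrable_mult_bounded(1)[OF ie Cc_measurable[OF Cc_left[OF f]] C])
      have i1: "integrable \<Lambda> (\<lambda>y. e (- y) * f x)" "(LINT y|\<Lambda>. e (- y) * f x) = f x"
        using ie e(4) by simp_all
      have "convolution \<Lambda> f e x - f x = (LINT y|\<Lambda>. e (- y) * (f (x + y) - f x))"
        unfolding sh right_diff_distrib using Bochner_Integration.integral_diff[OF i i1(1)] i1(2) by simp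
      also have "\<bar>\<dots>\<bar> \<le> (LINT y|\<Lambda>. \<bar>e (- y) * (f (x + y) - f x)\<bar>)" by (rule integral_abs_bound)
      also have "\<dots> \<le> (LINT y|\<Lambda>. e (- y) * \<epsilon>)"
      proof (rule integral_mono)
        have "integrable \<Lambda> (\<lambda>y. e (- y) * (f (x + y) - f x))"
          unfolding right_diff_distrib by (rule Bochner_Integration.integrable_diff[OF i i1(1)])
        then show "integrable \<Lambda> (\<lambda>y. \<bar>e (- y) * (f (x + y) - f x)\<bar>)" by (rule integrable_abs)
        show "\<bar>e (- y) * (f (x + y) - f x)\<bar> \<le> e (- y) * \<epsilon>" for y
          using e(2)[of "- y"] close[of y x] by (cases "e (- y) = 0") (auto simp: abs_mult)
      qed (use ie in auto)
      also have "\<dots> = \<epsilon>" using e(4) by simp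
      finally show ?thesis .
    qed
    have "J (convolution \<Lambda> f e) = J (\<lambda>x. (convolution \<Lambda> f e x - f x) + f x)" by simp
    also have "\<dots> = J (\<lambda>x. convolution \<Lambda> f e x - f x) + J f"
      using c(1) f by (subst add) (auto intro: Cc_diff)
    finally have "J f - J e * (LINT x|\<Lambda>. f x) = - J (\<lambda>x. convolution \<Lambda> f e x - f x)"
      using c(3) by simp
    moreover have "\<bar>J (\<lambda>x. convolution \<Lambda> f e x - f x)\<bar> \<le> B * \<epsilon>"
    proof (rule B)
      show "(\<lambda>x. convolution \<Lambda> f e x - f x) \<in> Cc" using c(1) f by (rule Cc_diff)
    qed (use close' c(2) K(3) in auto)
    ultimately show "\<bar>J f - J e * (LINT x|\<Lambda>. f x)\<bar> \<le> B * \<epsilon>" by simp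
  qed
qed

text \<open>For one and the same \<open>e\<close> concentrated near 0, \<open>J f\<close> and
  \<open>J g\<close> are close to \<open>J e\<close> times the integrals of \<open>f\<close> and
  \<open>g\<close>. Cross-multiplying eliminates the uncontrolled number \<open>J e\<close>.\<close>

lemma functional_unique:
  assumes f: "f \<in> Cc" and g: "g \<in> Cc"
  shows "J f * (LINT x|\<Lambda>. g x) = J g * (LINT x|\<Lambda>. f x)"
proof -
  obtain U W :: "'a set" where U: "open U" "compact W" "{0} \<subseteq> U" "U \<subseteq> W"
    by (rule compact_nbhd[of "{0}"]) auto
  obtain C where C: "\<forall>e \<epsilon>. e \<in> Cc \<and> (\<forall>x. 0 \<le> e x) \<and> (\<forall>x. x \<notin> W \<longrightarrow> e x = 0) \<and>
     (LINT y|\<Lambda>. e (- y)) = 1 \<and> (\<forall>x y. e (- y) \<noteq> 0 \<longrightarrow> \<bar>f (x + y) - f x\<bar> \<le> \<epsilon>) \<longrightarrow>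
     \<bar>J f - J e * (LINT x|\<Lambda>. f x)\<bar> \<le> C * \<epsilon>"
    using functional_approx[OF f U(2)] ..
  obtain D where D: "\<forall>e \<epsilon>. e \<in> Cc \<and> (\<forall>x. 0 \<le> e x) \<and> (\<forall>x. x \<notin> W \<longrightarrow> e x = 0) \<and>
     (LINT y|\<Lambda>. e (- y)) = 1 \<and> (\<forall>x y. e (- y) \<noteq> 0 \<longrightarrow> \<bar>g (x + y) - g x\<bar> \<le> \<epsilon>) \<longrightarrow>
     \<bar>J g - J e * (LINT x|\<Lambda>. g x)\<bar> \<le> D * \<epsilon>"
    using functional_approx[OF g U(2)] ..
  let ?f = "LINT x|\<Lambda>. f x" and ?g = "LINT x|\<Lambda>. g x"
  show ?thesis
  proof (rule eq_if_close[of _ _ "\<bar>?g\<bar> * C + \<bar>?f\<bar> * D"])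
    fix \<epsilon> :: real assume \<epsilon>: "0 < \<epsilon>"
    obtain V1 where V1: "open V1" "0 \<in> V1" "\<And>x y. y \<in> V1 \<Longrightarrow> \<bar>f (x + y) - f x\<bar> \<le> \<epsilon>"
      using Cc_right_nbhd[OF f \<epsilon>] by metis
    obtain V2 where V2: "open V2" "0 \<in> V2" "\<And>x y. y \<in> V2 \<Longrightarrow> \<bar>g (x + y) - g x\<bar> \<le> \<epsilon>"
      using Cc_right_nbhd[OF g \<epsilon>] by metis
    \<comment> \<open>The neighbourhoods are reflected because the closeness condition concerns
      those \<open>y\<close> with \<open>e (- y)\<close> nonzero.\<close>
    define O' where "O' = uminus -` (V1 \<inter> V2) \<inter> U"
    have O': "open O'" "{0} \<subseteq> O'"
      unfolding O'_def using V1 V2 U by (auto intro!: open_vimage continuous_intros)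
    obtain h where h: "h \<in> Cc" "\<And>x. 0 \<le> h x" "\<And>x. h x \<le> 1" "\<And>x. x \<in> {0} \<Longrightarrow> h x = 1" "\<And>x. x \<notin> O' \<Longrightarrow> h x = 0"
      using Cc_Urysohn[OF _ O'] by (metis compact_sing)
    \<comment> \<open>The reflected function is normalised, as it is the density in the averaging
      formula; reflection need not preserve the integral.\<close>
    define c where "c = (LINT y|\<Lambda>. h (- y))"
    have "0 < c" unfolding c_def
      by (rule Cc_integral_pos[OF Cc_minus[OF h(1)], of 0]) (use h in auto)
    define e where "e = (\<lambda>x. inverse c * h x)"
    have e: "e \<in> Cc" "\<And>x. 0 \<le> e x" "\<And>x. x \<notin> W \<Longrightarrow> e x = 0" "(LINT y|\<Lambda>. e (- y)) = 1"
      using Cc_cmult[OF h(1)] h(2,5) \<open>0 < c\<close> U(4) by (auto simp: e_def O'_def c_def[symmetric])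
    have V: "y \<in> V1 \<inter> V2" if "e (- y) \<noteq> 0" for y
      using that h(5)[of "- y"] by (auto simp: e_def O'_def)
    have 1: "\<bar>J f - J e * ?f\<bar> \<le> C * \<epsilon>" using e V V1 by (intro C[rule_format]) auto
    have 2: "\<bar>J g - J e * ?g\<bar> \<le> D * \<epsilon>" using e V V2 by (intro D[rule_format]) auto
    have "J f * ?g - J g * ?f = ?g * (J f - J e * ?f) - ?f * (J g - J e * ?g)" by (simp add: algebra_simps)
    also have "\<bar>\<dots>\<bar> \<le> \<bar>?g\<bar> * \<bar>J f - J e * ?f\<bar> + \<bar>?f\<bar> * \<bar>J g - J e * ?g\<bar>"
      by (metis abs_mult abs_triangle_ineq4)
    also have "\<dots> \<le> \<bar>?g\<bar> * (C * \<epsilon>) + \<bar>?f\<bar> * (D * \<epsilon>)" by (intro add_mono mult_left_mono 1 2) auto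
    finally show "\<bar>J f * ?g - J g * ?f\<bar> \<le> (\<bar>?g\<bar> * C + \<bar>?f\<bar> * D) * \<epsilon>" by (simp add: algebra_simps)
  qed
qed

end

section \<open>The modular function\<close>

context haar_group
begin

lemma measure_le_Cc:
  assumes "compact C" "h \<in> Cc" "\<And>x. 0 \<le> h x" "\<And>x. x \<in> C \<Longrightarrow> 1 \<le> h x"
  shows "measure \<Lambda> C \<le> (LINT x|\<Lambda>. h x)"
proof -
  have "(LINT x|\<Lambda>. indicator C x) \<le> (LINT x|\<Lambda>. h x)"
  proof (rule integral_mono)
    show "integrable \<Lambda> (\<lambda>x. indicator C x :: real)"
      using compact_fmeasurable[OF assms(1)] by (auto simp: fmeasurable_def)
    show "integrable \<Lambda> h" by (rule Cc_integrable[OF assms(2)])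
  qed (use assms(3,4) in \<open>auto simp: indicator_def\<close>)
  then show ?thesis using compact_fmeasurable[OF assms(1)] by (simp add: fmeasurable_def)
qed

lemma Cc_le_emeasure:
  assumes "O' \<in> sets borel" "h \<in> Cc" "\<And>x. 0 \<le> h x" "\<And>x. h x \<le> 1" "\<And>x. x \<notin> O' \<Longrightarrow> h x = 0"
  shows "ennreal (LINT x|\<Lambda>. h x) \<le> emeasure \<Lambda> O'"
proof -
  have "ennreal (LINT x|\<Lambda>. h x) = (\<integral>\<^sup>+x. ennreal (h x) \<partial>\<Lambda>)"
    using Cc_integrable[OF assms(2)] assms(3) by (intro nn_integral_eq_integral[symmetric]) auto
  also have "\<dots> \<le> (\<integral>\<^sup>+x. indicator O' x \<partial>\<Lambda>)"
    using assms(4,5) by (intro nn_integral_mono) (auto simp: indicator_def ennreal_le_1)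
  also have "\<dots> = emeasure \<Lambda> O'" using assms(1) by simp
  finally show ?thesis .
qed

text \<open>A fixed probability density, which normalises the modular function and later smooths
  bounded functions in \<open>thick_mean\<close>.\<close>

definition bump :: "'a \<Rightarrow> real" where
  "bump = (SOME h. h \<in> Cc \<and> (\<forall>x. 0 \<le> h x) \<and> (LINT x|\<Lambda>. h x) = 1)"

lemma bump: "bump \<in> Cc" "\<And>x. 0 \<le> bump x" "(LINT x|\<Lambda>. bump x) = 1"
proof -
  have "compact {0 :: 'a}" "open (UNIV :: 'a set)" "{0 :: 'a} \<subseteq> UNIV" by auto
  from Cc_Urysohn[OF this] obtain h :: "'a \<Rightarrow> real" where h: "h \<in> Cc" "\<And>x. 0 \<le> h x" "h 0 = 1"
    by (metis singletonI)
  have c: "0 < (LINT x|\<Lambda>. h x)" by (rule Cc_integral_pos[OF h(1,2), of 0]) (simp add: h)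
  have "(\<lambda>x. inverse (LINT x|\<Lambda>. h x) * h x) \<in> Cc \<and> (\<forall>x. 0 \<le> inverse (LINT x|\<Lambda>. h x) * h x) \<and>
      (LINT x|\<Lambda>. inverse (LINT x|\<Lambda>. h x) * h x) = 1"
    using h c Cc_cmult by simp
  then have "\<exists>h. h \<in> Cc \<and> (\<forall>x. 0 \<le> h x) \<and> (LINT x|\<Lambda>. h x) = 1" by blast
  from someI_ex[OF this] show "bump \<in> Cc" "\<And>x. 0 \<le> bump x" "(LINT x|\<Lambda>. bump x) = 1"
    unfolding bump_def[symmetric] by auto
qed

text \<open>
  The reciprocal of the usual modular function \<open>\<Delta>\<close>, which is given by \<open>|Ey| = \<Delta>(y)|E|\<close>.
\<close>

definition modular :: "'a \<Rightarrow> real" where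
  "modular y = (LINT x|\<Lambda>. bump (x + y))"

text \<open>Right translation commutes with left translation, so the integral of a right translate
  is a left-invariant functional and is proportional to the Haar integral. Evaluation at
  \<open>bump\<close> gives the factor.\<close>

lemma modular:
  assumes "f \<in> Cc"
  shows "(LINT x|\<Lambda>. f (x + y)) = modular y * (LINT x|\<Lambda>. f x)"
proof -
  interpret J: invariant_functional \<Lambda> "\<lambda>f. LINT x|\<Lambda>. f (x + y)"
  proof
    show "(LINT x|\<Lambda>. f (x + y) + g (x + y)) = (LINT x|\<Lambda>. f (x + y)) + (LINT x|\<Lambda>. g (x + y))"
      if "f \<in> Cc" "g \<in> Cc" for f g
      using that by (intro Bochner_Integration.integral_add Cc_integrable Cc_right)
    show "(LINT x|\<Lambda>. c * f (x + y)) = c * (LINT x|\<Lambda>. f (x + y))" for c :: real and f by simp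
    show "(LINT x|\<Lambda>. f (a + (x + y))) = (LINT x|\<Lambda>. f (x + y))" if "f \<in> Cc" for a f
      using integral_left[OF Cc_measurable[OF Cc_right[OF that, of y]], of a] by (simp add: add.assoc)
    show "\<exists>C. \<forall>f\<in>Cc. \<forall>\<epsilon>. (\<forall>x. x \<notin> K \<longrightarrow> f x = 0) \<longrightarrow> (\<forall>x. \<bar>f x\<bar> \<le> \<epsilon>) \<longrightarrow> \<bar>LINT x|\<Lambda>. f (x + y)\<bar> \<le> C * \<epsilon>"
      if K: "compact K" for K
    proof (intro exI[of _ "measure \<Lambda> ((\<lambda>x. x - y) ` K)"] ballI allI impI)
      fix f :: "'a \<Rightarrow> real" and \<epsilon> :: real
      assume f: "f \<in> Cc" "\<forall>x. x \<notin> K \<longrightarrow> f x = 0" "\<forall>x. \<bar>f x\<bar> \<le> \<epsilon>"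
      have "compact ((\<lambda>x. x - y) ` K)" using K by (intro compact_continuous_image continuous_intros)
      then have "\<bar>LINT x|\<Lambda>. f (x + y)\<bar> \<le> \<epsilon> * measure \<Lambda> ((\<lambda>x. x - y) ` K)"
      proof (rule integrable_compact(2)[OF Cc_measurable[OF Cc_right[OF f(1)]]])
        show "f (x + y) = 0" if "x \<notin> (\<lambda>x. x - y) ` K" for x
          using that f(2) by (metis add_diff_cancel image_eqI)
      qed (use f in auto)
      then show "\<bar>LINT x|\<Lambda>. f (x + y)\<bar> \<le> measure \<Lambda> ((\<lambda>x. x - y) ` K) * \<epsilon>" by (simp add: mult.commute)
    qed
  qed
  show ?thesis
    using J.functional_unique[OF assms bump(1)] bump(3) by (simp add: modular_def)
qed

lemma modular_add: "modular (y + z) = modular y * modular z"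
proof -
  have "(LINT x|\<Lambda>. bump (x + y + z)) = modular y * (LINT x|\<Lambda>. bump (x + z))"
    using modular[OF Cc_right[OF bump(1)], of y z] .
  then show ?thesis by (simp add: modular_def add.assoc)
qed

lemma modular_0: "modular 0 = 1"
  by (simp add: modular_def bump)

lemma modular_minus: "modular (- y) * modular y = 1"
  using modular_add[of "- y" y] modular_0 by simp

lemma modular_pos: "0 < modular y"
proof -
  have "0 \<le> modular y" unfolding modular_def using bump(2) by simp
  moreover have "modular y \<noteq> 0" using modular_minus[of y] by auto
  ultimately show ?thesis by simp
qed

lemma modular_minus': "modular (- y) = 1 / modular y"
  using modular_minus[of y] modular_pos[of y] by (simp add: field_simps)

text \<open>For \<open>v\<close> near 0 the function \<open>bump (x + v) - bump x\<close> is
  uniformly small and vanishes off a compact set \<open>M\<close> independent of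
  \<open>v\<close>.\<close>

lemma modular_near_0:
  assumes \<epsilon>: "0 < \<epsilon>"
  obtains V where "open V" "0 \<in> V" "\<And>v. v \<in> V \<Longrightarrow> \<bar>modular v - 1\<bar> \<le> \<epsilon>"
proof -
  obtain K where K: "compact K" "continuous_on UNIV bump" "\<And>x. x \<notin> K \<Longrightarrow> bump x = 0"
    using bump(1) by (elim CcE) blast
  obtain U L :: "'a set" where U: "open U" "compact L" "{0} \<subseteq> U" "U \<subseteq> L"
    by (rule compact_nbhd[of "{0}"]) auto
  define M where "M = {x + y |x y. x \<in> K \<and> y \<in> uminus ` L}"
  have "compact (uminus ` L)"
    using U by (intro compact_continuous_image continuous_intros)
  then have M: "compact M" unfolding M_def using K(1) by (intro compact_add_sets)
  have out: "bump (x + v) = 0" if "v \<in> L" "x \<notin> M" for x v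
  proof (rule K(3), rule notI)
    assume "x + v \<in> K"
    moreover have "x = (x + v) + - v" by (simp add: add.assoc)
    ultimately show False using that unfolding M_def by blast
  qed
  define \<delta> where "\<delta> = \<epsilon> / (measure \<Lambda> M + 1)"
  have "0 < measure \<Lambda> M + 1" by (simp add: add_nonneg_pos)
  then have \<delta>: "0 < \<delta>" "\<delta> * measure \<Lambda> M \<le> \<epsilon>"
    using \<epsilon> by (auto simp: \<delta>_def field_simps)
  obtain V :: "'a set" where V: "open V" "0 \<in> V" "\<And>x y. y \<in> V \<Longrightarrow> \<bar>bump (x + y) - bump x\<bar> \<le> \<delta>"
    using Cc_right_nbhd[OF bump(1) \<delta>(1)] by metis
  show thesis
  proof (rule that[of "V \<inter> U"])
    fix v assume v: "v \<in> V \<inter> U"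
    have "modular v - 1 = (LINT x|\<Lambda>. bump (x + v) - bump x)"
      using Cc_integrable[OF bump(1)] Cc_integrable[OF Cc_right[OF bump(1), of v]] bump(3)
      by (simp add: modular_def)
    also have "\<bar>\<dots>\<bar> \<le> \<delta> * measure \<Lambda> M"
    proof (rule integrable_compact(2)[OF Cc_measurable M])
      show "(\<lambda>x. bump (x + v) - bump x) \<in> Cc" by (intro Cc_diff Cc_right bump)
      show "bump (x + v) - bump x = 0" if "x \<notin> M" for x
      proof -
        have "bump (x + v) = 0" using that v U by (auto intro!: out)
        moreover have "bump (x + 0) = 0" using that U by (intro out) auto
        ultimately show ?thesis by simp
      qed
    qed (use V v in auto)
    finally show "\<bar>modular v - 1\<bar> \<le> \<epsilon>" using \<delta>(2) by linarith
  qed (use V U in auto)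
qed

text \<open>Multiplicativity transports continuity at 0 to every point.\<close>

lemma modular_continuous: "continuous_on UNIV modular"
  unfolding continuous_on_def
proof (intro ballI tendstoI)
  fix x0 and e :: real assume e: "0 < e"
  have "0 < e / (2 * modular x0)" using e modular_pos by simp
  from modular_near_0[OF this]
  obtain V where V: "open V" "0 \<in> V" "\<And>v. v \<in> V \<Longrightarrow> \<bar>modular v - 1\<bar> \<le> e / (2 * modular x0)" by metis
  have "dist (modular x) (modular x0) < e" if "x \<in> (\<lambda>x. - x0 + x) -` V" for x
  proof -
    have "modular x = modular x0 * modular (- x0 + x)"
      by (simp add: modular_add[symmetric] add.assoc[symmetric])
    then have "modular x - modular x0 = modular x0 * (modular (- x0 + x) - 1)"
      by (simp add: algebra_simps)
    then have "\<bar>modular x - modular x0\<bar> = modular x0 * \<bar>modular (- x0 + x) - 1\<bar>"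
      using modular_pos[of x0] by (simp add: abs_mult)
    also have "\<dots> \<le> modular x0 * (e / (2 * modular x0))"
      using V(3)[of "- x0 + x"] that modular_pos[of x0] by (intro mult_left_mono) auto
    also have "\<dots> < e" using e modular_pos[of x0] by simp
    finally show ?thesis by (simp add: dist_real_def)
  qed
  moreover have "open ((\<lambda>x. - x0 + x) -` V)" by (intro open_vimage V continuous_intros)
  moreover have "x0 \<in> (\<lambda>x. - x0 + x) -` V" using V by simp
  ultimately show "\<forall>\<^sub>F x in at x0. dist (modular x) (modular x0) < e"
    unfolding eventually_at_topological by blast
qed

lemma modular_bounded_above:
  assumes "compact K"
  shows "\<exists>B. \<forall>k\<in>K. modular k \<le> B"
proof -
  have "continuous_on K modular" by (rule continuous_on_subset[OF modular_continuous subset_UNIV])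
  then have "compact (modular ` K)" using assms by (rule compact_continuous_image)
  then have "bounded (modular ` K)" by (rule compact_imp_bounded)
  then obtain B where B: "\<forall>r\<in>modular ` K. norm r \<le> B" unfolding bounded_iff ..
  show ?thesis
  proof (intro exI ballI)
    fix k assume "k \<in> K"
    then have "norm (modular k) \<le> B" using B by blast
    then show "modular k \<le> B" by simp
  qed
qed

text \<open>The lower bound on \<open>K\<close> is the upper bound on the reflected set, since
  \<open>modular (- k) = 1 / modular k\<close>.\<close>

lemma modular_bounded:
  assumes "compact K"
  obtains B where "0 < B" "\<And>k. k \<in> K \<Longrightarrow> modular k \<le> B" "\<And>k. k \<in> K \<Longrightarrow> 1 / B \<le> modular k"
proof -
  obtain A where A: "\<forall>k\<in>K. modular k \<le> A" using modular_bounded_above[OF assms] ..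
  have "compact (uminus ` K)" using assms by (intro compact_continuous_image continuous_intros)
  then have "\<exists>B. \<forall>k\<in>uminus ` K. modular k \<le> B" by (rule modular_bounded_above)
  then obtain B where B: "\<forall>k\<in>uminus ` K. modular k \<le> B" ..
  define C where "C = max 1 (max A B)"
  have C: "0 < C" "A \<le> C" "B \<le> C" unfolding C_def by auto
  show thesis
  proof (rule that[OF C(1)])
    fix k assume k: "k \<in> K"
    show "modular k \<le> C" using A k C by (meson order_trans)
    have "modular (- k) \<le> C" using B k C by (meson order_trans image_eqI)
    then show "1 / C \<le> modular k"
      using modular_pos[of k] C(1) by (simp add: modular_minus' field_simps)
  qed
qed

section \<open>A trivial modular function implies unimodularity\<close>

text \<open>The transformation rule passes from \<open>Cc\<close> to open sets by Urysohn functions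
  and inner regularity, then to Borel sets by outer regularity. The reverse inequality in
  \<open>unimodularI\<close> is the same statement for \<open>- x\<close>.\<close>

lemma emeasure_right_le:
  assumes "modular (- x) = 1" "A \<in> sets borel"
  shows "emeasure \<Lambda> ((\<lambda>y. y + x) ` A) \<le> emeasure \<Lambda> A"
proof -
  have op: "open ((\<lambda>y. y + x) ` U)" if "open U" for U
  proof -
    have "(\<lambda>y. y + x) ` U = (\<lambda>y. y - x) -` U" by force
    moreover have "open ((\<lambda>y. y - x) -` U)" by (intro open_vimage that continuous_intros)
    ultimately show ?thesis by simp
  qed
  have U: "emeasure \<Lambda> ((\<lambda>y. y + x) ` U) \<le> emeasure \<Lambda> U" if "open U" for U
    unfolding Haar_inner[OF op[OF that]]
  proof (intro SUP_least, elim CollectE conjE)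
    fix C assume C: "compact C" "C \<subseteq> (\<lambda>y. y + x) ` U"
    have cC: "compact ((\<lambda>y. y - x) ` C)" using C by (intro compact_continuous_image continuous_intros)
    have "(\<lambda>y. y - x) ` C \<subseteq> U" using C by auto
    from Cc_Urysohn[OF cC \<open>open U\<close> this]
    obtain h where h: "h \<in> Cc" "\<And>x. 0 \<le> h x" "\<And>x. h x \<le> 1" "\<And>y. y \<in> (\<lambda>y. y - x) ` C \<Longrightarrow> h y = 1"
      "\<And>x. x \<notin> U \<Longrightarrow> h x = 0"
      by metis
    have "measure \<Lambda> C \<le> (LINT y|\<Lambda>. h (y + - x))"
    proof (rule measure_le_Cc[OF C(1) Cc_right[OF h(1)]])
      show "1 \<le> h (y + - x)" if "y \<in> C" for y using h(4)[of "y - x"] that by auto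
    qed (use h in auto)
    also have "\<dots> = (LINT y|\<Lambda>. h y)" using modular[OF h(1), of "- x"] assms(1) by simp
    finally have "ennreal (measure \<Lambda> C) \<le> ennreal (LINT y|\<Lambda>. h y)" by (rule ennreal_leI)
    also have "\<dots> \<le> emeasure \<Lambda> U" by (rule Cc_le_emeasure) (use that h in auto)
    finally show "emeasure \<Lambda> C \<le> emeasure \<Lambda> U"
      using emeasure_compact[OF C(1)] by (simp add: emeasure_eq_ennreal_measure less_top[symmetric])
  qed
  show ?thesis
    unfolding Haar_outer[OF assms(2)]
  proof (intro INF_greatest, elim CollectE conjE)
    fix V assume V: "open V" "A \<subseteq> V"
    have "emeasure \<Lambda> ((\<lambda>y. y + x) ` A) \<le> emeasure \<Lambda> ((\<lambda>y. y + x) ` V)"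
      using V op[OF V(1)] by (intro emeasure_mono) auto
    also have "\<dots> \<le> emeasure \<Lambda> V" by (rule U[OF V(1)])
    finally show "emeasure \<Lambda> ((\<lambda>y. y + x) ` A) \<le> emeasure \<Lambda> V" .
  qed
qed

lemma unimodularI:
  assumes "\<And>x. modular x = 1"
  shows "unimodular \<Lambda>"
  unfolding unimodular_def
proof (intro allI ballI antisym)
  fix x and A :: "'a set" assume A: "A \<in> sets borel"
  show "emeasure \<Lambda> ((\<lambda>y. y + x) ` A) \<le> emeasure \<Lambda> A"
    by (rule emeasure_right_le[OF assms A])
  have eq: "(\<lambda>y. y + x) ` A = (\<lambda>y. y + - x) -` A" by force
  have "(\<lambda>y. y + x) ` A \<in> sets borel"
    unfolding eq using measurable_sets[OF measurable_right[of "- x"] A] by simp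
  from emeasure_right_le[OF assms this, of "- x"]
  show "emeasure \<Lambda> A \<le> emeasure \<Lambda> ((\<lambda>y. y + x) ` A)"
    by (simp add: image_image add.assoc)
qed

section \<open>Right translates of compact sets with prescribed modular values\<close>

text \<open>If \<open>modular y\<close> is not 1, then \<open>y\<close> or \<open>- y\<close> has a
  value above 1, and the values at its multiples are the powers of that number.\<close>

lemma modular_unbounded:
  assumes "\<not> unimodular \<Lambda>"
  obtains x where "r < modular x"
proof -
  obtain y where "modular y \<noteq> 1" using assms unimodularI by blast
  then have "1 < modular y \<or> 1 < modular (- y)"
    using modular_pos[of y] by (auto simp: modular_minus' field_simps)
  then obtain z where z: "1 < modular z" by blast
  have "modular (((\<lambda>x. z + x) ^^ n) 0) = modular z ^ n" for n
    by (induction n) (auto simp: modular_0 modular_add)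
  then show thesis using real_arch_pow[OF z, of r] that by metis
qed

text \<open>Right translation by \<open>x\<close> multiplies \<open>modular\<close> by
  \<open>modular x\<close> and divides the measure by it, so a large \<open>modular x\<close>
  achieves both aims at once.\<close>

lemma thin_translate:
  assumes "\<not> unimodular \<Lambda>" "compact K" "0 < \<delta>"
  obtains x where "\<And>k. k \<in> K \<Longrightarrow> 1 < modular (k + x)" "measure \<Lambda> ((\<lambda>k. k + x) ` K) \<le> \<delta>"
proof -
  obtain B where B: "0 < B" "\<And>k. k \<in> K \<Longrightarrow> 1 / B \<le> modular k" using modular_bounded[OF assms(2)] by metis
  obtain h :: "'a \<Rightarrow> real" where h: "h \<in> Cc" "\<And>x. 0 \<le> h x" "\<And>x. x \<in> K \<Longrightarrow> h x = 1"
    using Cc_Urysohn[OF assms(2) open_UNIV] by (metis subset_UNIV)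
  \<comment> \<open>Exceeding \<open>B\<close> pushes \<open>modular\<close> above 1 on the
    translate; exceeding the quotient makes the measure at most \<open>\<delta>\<close>.\<close>
  obtain x where x: "max B ((LINT x|\<Lambda>. h x) / \<delta>) < modular x"
    using modular_unbounded[OF assms(1)] by metis
  show thesis
  proof (rule that)
    fix k assume "k \<in> K"
    have "1 = (1 / B) * B" using B by simp
    also have "\<dots> < (1 / B) * modular x" using x B by (intro mult_strict_left_mono) auto
    also have "\<dots> \<le> modular k * modular x" using B(2)[OF \<open>k \<in> K\<close>] modular_pos[of x] by (intro mult_right_mono) auto
    finally show "1 < modular (k + x)" by (simp add: modular_add)
  next
    have "measure \<Lambda> ((\<lambda>k. k + x) ` K) \<le> (LINT y|\<Lambda>. h (y + - x))"
    proof (rule measure_le_Cc)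
      show "compact ((\<lambda>k. k + x) ` K)" using assms(2) by (intro compact_continuous_image continuous_intros)
      show "(\<lambda>y. h (y + - x)) \<in> Cc" by (rule Cc_right[OF h(1)])
    qed (use h in auto)
    also have "\<dots> = (LINT y|\<Lambda>. h y) / modular x" using modular[OF h(1), of "- x"] by (simp add: modular_minus')
    also have "\<dots> \<le> \<delta>" using x modular_pos[of x] assms(3) by (simp add: field_simps)
    finally show "measure \<Lambda> ((\<lambda>k. k + x) ` K) \<le> \<delta>" .
  qed
qed

text \<open>The translation opposite to that of \<open>thin_translate\<close>. The lower bound
  \<open>r\<close> on \<open>modular (- x)\<close> is the factor by which measures grow, which is
  what \<open>large_compact\<close> exploits.\<close>

lemma modular_le_1_translate:
  assumes "\<not> unimodular \<Lambda>" "compact K"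
  obtains x where "r \<le> modular (- x)" "\<And>k. k \<in> K \<Longrightarrow> modular (k + x) \<le> 1"
proof -
  obtain B where B: "0 < B" "\<And>k. k \<in> K \<Longrightarrow> modular k \<le> B" using modular_bounded[OF assms(2)] by metis
  obtain x where x: "max r B < modular x" using modular_unbounded[OF assms(1)] by metis
  show thesis
  proof (rule that[of "- x"])
    fix k assume "k \<in> K"
    have "modular k \<le> modular x" using B(2)[OF \<open>k \<in> K\<close>] x by simp
    then show "modular (k + - x) \<le> 1" using modular_pos[of x] unfolding modular_add modular_minus' by simp
  qed (use x in simp)
qed

text \<open>A right translate of a compact neighbourhood of 0 by an \<open>x\<close> with small
  \<open>modular x\<close> has small modular values and large measure.\<close>

lemma large_compact:
  assumes "\<not> unimodular \<Lambda>"
  obtains U where "compact U" "\<And>x. x \<in> U \<Longrightarrow> modular x \<le> 1" "r \<le> measure \<Lambda> U"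
proof -
  obtain V W :: "'a set" where W: "open V" "compact W" "{0} \<subseteq> V" "V \<subseteq> W"
    by (rule compact_nbhd[of "{0}"]) auto
  have "compact {0::'a}" by simp
  from Cc_Urysohn[OF this W(1,3)]
  obtain h :: "'a \<Rightarrow> real" where h: "h \<in> Cc" "\<And>x. 0 \<le> h x" "\<And>x. h x \<le> 1" "h 0 = 1" "\<And>x. x \<notin> V \<Longrightarrow> h x = 0"
    by (metis singletonI)
  have c: "0 < (LINT x|\<Lambda>. h x)" by (rule Cc_integral_pos[OF h(1,2), of 0]) (simp add: h)
  obtain x where x: "r / (LINT x|\<Lambda>. h x) \<le> modular (- x)" "\<And>k. k \<in> W \<Longrightarrow> modular (k + x) \<le> 1"
    using modular_le_1_translate[OF assms W(2)] by metis
  have cW: "compact ((\<lambda>k. k + x) ` W)" using W by (intro compact_continuous_image continuous_intros)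
  show thesis
  proof (rule that[OF cW])
    have "r \<le> modular (- x) * (LINT x|\<Lambda>. h x)" using x(1) c by (simp add: field_simps)
    also have "\<dots> = (LINT y|\<Lambda>. h (y + - x))" using modular[OF h(1), of "- x"] by simp
    also have "\<dots> \<le> \<bar>LINT y|\<Lambda>. h (y + - x)\<bar>" by simp
    also have "\<dots> \<le> 1 * measure \<Lambda> ((\<lambda>k. k + x) ` W)"
    proof (rule integrable_compact(2)[OF Cc_measurable[OF Cc_right[OF h(1)]] cW])
      show "h (y + - x) = 0" if "y \<notin> (\<lambda>k. k + x) ` W" for y
      proof (rule h(5), rule notI)
        assume "y + - x \<in> V"
        then have "(y + - x) + x \<in> (\<lambda>k. k + x) ` W" using W(4) by blast
        then show False using that by (simp add: add.assoc)
      qed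
    qed (use h in auto)
    finally show "r \<le> measure \<Lambda> ((\<lambda>k. k + x) ` W)" by simp
  qed (use x in auto)
qed

section \<open>Haar measure under reflection\<close>

text \<open>Reflection turns left translations into right ones, and the weight
  \<open>modular y\<close> compensates for the effect of these on the integral. The weighted
  integral is thus left-invariant, and uniqueness applies.\<close>

lemma modular_reflect:
  assumes "f \<in> Cc" "g \<in> Cc"
  shows "(LINT y|\<Lambda>. f (- y) * modular y) * (LINT x|\<Lambda>. g x) = (LINT y|\<Lambda>. g (- y) * modular y) * (LINT x|\<Lambda>. f x)"
proof -
  have Cc': "(\<lambda>y. f (- y) * modular y) \<in> Cc" if f: "f \<in> Cc" for f
  proof -
    obtain K where K: "compact K" "continuous_on UNIV (\<lambda>y. f (- y))" "\<And>x. x \<notin> K \<Longrightarrow> f (- x) = 0"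
      using Cc_minus[OF f] by (elim CcE) blast
    show ?thesis
      by (rule CcI[OF _ K(1)]) (use K modular_continuous in \<open>auto intro!: continuous_intros\<close>)
  qed
  interpret J: invariant_functional \<Lambda> "\<lambda>f. LINT y|\<Lambda>. f (- y) * modular y"
  proof
    show "(LINT y|\<Lambda>. (f (- y) + g (- y)) * modular y) = (LINT y|\<Lambda>. f (- y) * modular y) + (LINT y|\<Lambda>. g (- y) * modular y)"
      if "f \<in> Cc" "g \<in> Cc" for f g
      unfolding distrib_right using that by (intro Bochner_Integration.integral_add Cc_integrable Cc')
    show "(LINT y|\<Lambda>. (c * f (- y)) * modular y) = c * (LINT y|\<Lambda>. f (- y) * modular y)" for c :: real and f
      by (simp add: mult.assoc)
    show "(LINT y|\<Lambda>. f (a + - y) * modular y) = (LINT y|\<Lambda>. f (- y) * modular y)" if "f \<in> Cc" for a f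
    proof -
      have "f (a + - y) * modular y = modular a * (f (- (y + - a)) * modular (y + - a))" for y
      proof -
        have "modular a * modular (y + - a) = modular y"
          using modular_pos[of a] unfolding modular_add modular_minus' by simp
        then have "modular a * (c * modular (y + - a)) = c * modular y" for c
          by (metis mult.left_commute)
        then show ?thesis by (simp only: minus_add minus_minus)
      qed
      then have "(LINT y|\<Lambda>. f (a + - y) * modular y) = modular a * (LINT y|\<Lambda>. f (- (y + - a)) * modular (y + - a))"
        by (simp only: integral_mult_right_zero)
      also have "\<dots> = modular a * (modular (- a) * (LINT y|\<Lambda>. f (- y) * modular y))"
        using modular[OF Cc'[OF that], of "- a"] by simp
      finally show ?thesis using modular_minus[of a] by (simp add: mult.assoc[symmetric] mult.commute)
    qed
    show "\<exists>C. \<forall>f\<in>Cc. \<forall>\<epsilon>. (\<forall>x. x \<notin> K \<longrightarrow> f x = 0) \<longrightarrow> (\<forall>x. \<bar>f x\<bar> \<le> \<epsilon>) \<longrightarrow> \<bar>LINT y|\<Lambda>. f (- y) * modular y\<bar> \<le> C * \<epsilon>"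
      if K: "compact K" for K
    proof -
      have cK: "compact (uminus ` K)" using K by (intro compact_continuous_image continuous_intros)
      obtain B where B: "0 < B" "\<And>k. k \<in> uminus ` K \<Longrightarrow> modular k \<le> B" using modular_bounded[OF cK] by metis
      show ?thesis
      proof (intro exI[of _ "B * measure \<Lambda> (uminus ` K)"] ballI allI impI)
        fix f :: "'a \<Rightarrow> real" and \<epsilon> :: real
        assume f: "f \<in> Cc" "\<forall>x. x \<notin> K \<longrightarrow> f x = 0" "\<forall>x. \<bar>f x\<bar> \<le> \<epsilon>"
        have out: "f (- y) * modular y = 0" if "y \<notin> uminus ` K" for y
          using that f(2) by (metis add.inverse_inverse image_eqI mult_zero_left)
        have "\<epsilon> \<ge> 0" using f(3)[rule_format, of 0] by linarith
        have "\<bar>LINT y|\<Lambda>. f (- y) * modular y\<bar> \<le> (\<epsilon> * B) * measure \<Lambda> (uminus ` K)"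
        proof (rule integrable_compact(2)[OF Cc_measurable[OF Cc'[OF f(1)]] cK out])
          show "\<bar>f (- y) * modular y\<bar> \<le> \<epsilon> * B" for y
          proof (cases "y \<in> uminus ` K")
            case True
            then show ?thesis unfolding abs_mult using f(3) B modular_pos[of y] \<open>\<epsilon> \<ge> 0\<close>
              by (intro mult_mono) auto
          next
            case False
            show ?thesis unfolding out[OF False] using \<open>\<epsilon> \<ge> 0\<close> B(1) by simp
          qed
        qed
        then show "\<bar>LINT y|\<Lambda>. f (- y) * modular y\<bar> \<le> B * measure \<Lambda> (uminus ` K) * \<epsilon>" by (simp add: algebra_simps)
      qed
    qed
  qed
  show ?thesis using J.functional_unique[OF assms] .
qed

text \<open>
  As \<open>f * \<phi>\<close> evaluates \<open>\<phi>\<close> at \<open>- y + x\<close>, it depends only on the class of \<open>\<phi>\<close> because null sets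
  have null reflections.
\<close>

lemma null_set_reflect_compact:
  assumes N: "N \<in> null_sets \<Lambda>" "N \<subseteq> K" "compact K"
  shows "uminus ` N \<in> null_sets \<Lambda>"
proof -
  obtain U L where U: "open U" "compact L" "K \<subseteq> U" "U \<subseteq> L" using compact_nbhd[OF N(3)] .
  have "compact (uminus ` L)" using U by (intro compact_continuous_image continuous_intros)
  then obtain B where B: "0 < B" "\<And>k. k \<in> uminus ` L \<Longrightarrow> 1 / B \<le> modular k" using modular_bounded by metis
  define c where "c = (LINT y|\<Lambda>. bump (- y) * modular y)"
  have c0: "0 \<le> c" unfolding c_def using bump(2) modular_pos by (simp add: less_imp_le)
  \<comment> \<open>On the reflection of \<open>L\<close> the weight is at least
    \<open>1 / B\<close>, so the integral of the reflected function is at most \<open>B\<close>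
    times the weighted one, which \<open>modular_reflect\<close> evaluates with \<open>bump\<close>
    as reference.\<close>
  have key: "(LINT y|\<Lambda>. h (- y)) \<le> B * c * (LINT x|\<Lambda>. h x)"
    if h: "h \<in> Cc" "\<And>x. 0 \<le> h x" "\<And>x. x \<notin> U \<Longrightarrow> h x = 0" for h
  proof -
    have le: "h (- y) \<le> B * (h (- y) * modular y)" for y
    proof (cases "- y \<in> U")
      case True
      then have "- (- y) \<in> uminus ` L" using U by blast
      then have "1 / B \<le> modular y" using B(2)[of y] by simp
      then have "h (- y) * (1 / B) \<le> h (- y) * modular y" using h(2) by (intro mult_left_mono)
      then show ?thesis using B(1) by (simp add: field_simps)
    qed (simp add: h(3))
    obtain K where K: "compact K" "continuous_on UNIV (\<lambda>y. h (- y))" "\<And>x. x \<notin> K \<Longrightarrow> h (- x) = 0"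
      using Cc_minus[OF h(1)] by (elim CcE) blast
    have "(\<lambda>y. h (- y) * modular y) \<in> Cc"
      by (rule CcI[OF _ K(1)]) (use K modular_continuous in \<open>auto intro!: continuous_intros\<close>)
    then have "(LINT y|\<Lambda>. h (- y)) \<le> (LINT y|\<Lambda>. B * (h (- y) * modular y))"
      using Cc_integrable[OF Cc_minus[OF h(1)]] Cc_integrable le by (intro integral_mono) auto
    also have "\<dots> = B * (c * (LINT x|\<Lambda>. h x))"
      using modular_reflect[OF h(1) bump(1)] bump(3) by (simp add: c_def)
    finally show ?thesis by (simp add: mult.assoc)
  qed
  have eq: "uminus ` N = uminus -` N" by force
  have meas: "uminus ` N \<in> sets borel"
    unfolding eq using measurable_sets[OF measurable_minus, of N] null_setsD2[OF N(1)] by simp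
  have small: "emeasure \<Lambda> (uminus ` N) \<le> ennreal \<delta>" if "0 < \<delta>" for \<delta>
  proof -
    define \<eta> where "\<eta> = \<delta> / (B * c + 1)"
    have Bc: "0 \<le> B * c" using B(1) c0 by simp
    then have \<eta>: "0 < \<eta>" "B * c * \<eta> \<le> \<delta>" using that by (auto simp: \<eta>_def field_simps)
    have N0: "N \<in> sets borel" "emeasure \<Lambda> N = 0" using N(1) by auto
    then have "emeasure \<Lambda> N \<noteq> \<infinity>" by simp
    from INF_approx_ennreal[OF _ Haar_outer[OF N0(1)] this, of \<eta>]
    obtain O' where O': "open O'" "N \<subseteq> O'" "emeasure \<Lambda> O' < ennreal \<eta>"
      using \<eta> N0 by auto
    \<comment> \<open>Intersecting with \<open>U\<close> ensures that Urysohn functions supported in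
      \<open>O2\<close> vanish off \<open>U\<close>, as \<open>key\<close> demands.\<close>
    define O2 where "O2 = O' \<inter> U"
    have O2: "open O2" "N \<subseteq> O2" "O2 \<subseteq> U" "emeasure \<Lambda> O2 \<le> ennreal \<eta>"
      unfolding O2_def using O' U N(2) emeasure_mono[of "O' \<inter> U" O' \<Lambda>] by auto
    have op: "open (uminus -` O2)" by (intro open_vimage O2 continuous_intros)
    have "emeasure \<Lambda> (uminus ` N) \<le> emeasure \<Lambda> (uminus -` O2)"
      using O2(2) op by (intro emeasure_mono) auto
    also have "\<dots> \<le> ennreal \<delta>"
      unfolding Haar_inner[OF op]
    proof (intro SUP_least, elim CollectE conjE)
      fix C assume C: "compact C" "C \<subseteq> uminus -` O2"
      have cC: "compact (uminus ` C)" using C by (intro compact_continuous_image continuous_intros)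
      have "uminus ` C \<subseteq> O2" using C by auto
      from Cc_Urysohn[OF cC O2(1) this]
      obtain h where h: "h \<in> Cc" "\<And>x. 0 \<le> h x" "\<And>x. h x \<le> 1" "\<And>x. x \<in> uminus ` C \<Longrightarrow> h x = 1" "\<And>x. x \<notin> O2 \<Longrightarrow> h x = 0"
        by metis
      have "ennreal (LINT x|\<Lambda>. h x) \<le> ennreal \<eta>"
        using Cc_le_emeasure[of O2 h] h O2 by (meson borel_open order_trans)
      then have "(LINT x|\<Lambda>. h x) \<le> \<eta>" using \<eta>(1) by (simp add: ennreal_le_iff)
      then have "B * c * (LINT x|\<Lambda>. h x) \<le> B * c * \<eta>" using Bc by (rule mult_left_mono)
      moreover have "(LINT y|\<Lambda>. h (- y)) \<le> B * c * (LINT x|\<Lambda>. h x)"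
        using h O2(3) by (intro key) (blast intro: h)+
      moreover have "measure \<Lambda> C \<le> (LINT y|\<Lambda>. h (- y))"
        by (rule measure_le_Cc[OF C(1) Cc_minus[OF h(1)]]) (use h in auto)
      ultimately have "measure \<Lambda> C \<le> \<delta>" using \<eta>(2) by linarith
      then show "emeasure \<Lambda> C \<le> ennreal \<delta>"
        using emeasure_compact[OF C(1)] by (simp add: emeasure_eq_ennreal_measure less_top[symmetric] ennreal_leI)
    qed
    finally show ?thesis .
  qed
  have "emeasure \<Lambda> (uminus ` N) = 0"
  proof (rule ccontr)
    assume "emeasure \<Lambda> (uminus ` N) \<noteq> 0"
    moreover have fin: "emeasure \<Lambda> (uminus ` N) \<noteq> \<infinity>" using small[of 1] by (auto simp: top_unique)
    ultimately have "0 < measure \<Lambda> (uminus ` N)"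
      by (metis emeasure_eq_ennreal_measure ennreal_0 infinity_ennreal_def measure_nonneg order_less_le)
    then have "emeasure \<Lambda> (uminus ` N) \<le> ennreal (measure \<Lambda> (uminus ` N) / 2)" by (intro small) simp
    then have "ennreal (measure \<Lambda> (uminus ` N)) \<le> ennreal (measure \<Lambda> (uminus ` N) / 2)"
      using fin by (simp add: emeasure_eq_ennreal_measure)
    then show False using \<open>0 < measure \<Lambda> (uminus ` N)\<close> by (simp add: ennreal_le_iff)
  qed
  then show ?thesis using meas by (auto simp: null_sets_def)
qed

end

section \<open>Means on bounded functions\<close>

locale sigma_haar_group = haar_group +
  assumes sigma_compact: "sigma_compact_space (euclidean :: 'a topology)"
begin

text \<open>A countable compact cover need not absorb every compact set. Thickening its members by a
  compact neighbourhood of 0 places each of them in an open subset of its thickening, so finitely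
  many thickenings contain a given compact set.\<close>

lemma ex_exhaustion:
  "\<exists>K :: nat \<Rightarrow> 'a set. (\<forall>n. compact (K n)) \<and> mono K \<and> (\<forall>C. compact C \<longrightarrow> (\<exists>n. C \<subseteq> K n))"
proof -
  obtain \<C> :: "'a set set" where \<C>: "countable \<C>" "\<And>K. K \<in> \<C> \<Longrightarrow> compact K" "\<Union>\<C> = UNIV"
    using sigma_compact by (auto simp: sigma_compact_space_def)
  have "\<C> \<noteq> {}" using \<C>(3) by auto
  define c where "c = from_nat_into \<C>"
  have c: "range c = \<C>" unfolding c_def by (rule range_from_nat_into[OF \<open>\<C> \<noteq> {}\<close> \<C>(1)])
  have cc: "compact (c i)" for i using c \<C>(2) by blast
  obtain V W :: "'a set" where W: "open V" "compact W" "{0} \<subseteq> V" "V \<subseteq> W"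
    by (rule compact_nbhd[of "{0}"]) auto
  define L where "L i = {x + y |x y. x \<in> c i \<and> y \<in> W}" for i
  have L: "compact (L i)" for i unfolding L_def by (rule compact_add_sets[OF cc W(2)])
  define P where "P i = (\<Union>x\<in>c i. (\<lambda>y. - x + y) -` V)" for i
  have P: "open (P i)" for i unfolding P_def by (intro open_UN ballI open_vimage W continuous_intros)
  have PL: "P i \<subseteq> L i" for i
  proof
    fix y assume "y \<in> P i"
    then obtain x where x: "x \<in> c i" "- x + y \<in> V" unfolding P_def by auto
    have "y = x + (- x + y)" by (simp add: add.assoc[symmetric])
    then show "y \<in> L i" using x W(4) unfolding L_def by blast
  qed
  have cP: "c i \<subseteq> P i" for i using W(3) unfolding P_def by auto
  have "\<exists>n. C \<subseteq> (\<Union>i\<le>n. L i)" if C: "compact C" for C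
  proof -
    have "C \<subseteq> (\<Union>i. P i)"
    proof
      fix x
      have "x \<in> \<Union>(range c)" by (simp add: c \<C>(3))
      then obtain i where "x \<in> c i" by auto
      then have "x \<in> P i" by (rule subsetD[OF cP])
      then show "x \<in> (\<Union>i. P i)" by (rule UN_I[OF UNIV_I])
    qed
    then obtain D where D: "D \<subseteq> UNIV" "finite D" "C \<subseteq> (\<Union>i\<in>D. P i)"
      by (rule compactE_image[OF C P])
    obtain n where "\<forall>i\<in>D. i \<le> n" using D(2) finite_nat_set_iff_bounded_le by auto
    then have "(\<Union>i\<in>D. P i) \<subseteq> (\<Union>i\<le>n. L i)" using PL by (intro UN_mono) auto
    then show ?thesis using D(3) by (intro exI[of _ n]) (rule subset_trans)
  qed
  moreover have "compact (\<Union>i\<le>n. L i)" for n using L by (intro compact_UN) auto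
  moreover have "mono (\<lambda>n. \<Union>i\<le>n. L i)" by (intro monoI UN_mono) auto
  ultimately show ?thesis by (intro exI[of _ "\<lambda>n. \<Union>i\<le>n. L i"] conjI allI impI)
qed

definition exhaustion :: "nat \<Rightarrow> 'a set" where
  "exhaustion = (SOME K. (\<forall>n. compact (K n)) \<and> mono K \<and> (\<forall>C. compact C \<longrightarrow> (\<exists>n. C \<subseteq> K n)))"

lemma exhaustion:
  "compact (exhaustion n)" "m \<le> n \<Longrightarrow> exhaustion m \<subseteq> exhaustion n" "compact C \<Longrightarrow> \<exists>n. C \<subseteq> exhaustion n"
  using someI_ex[OF ex_exhaustion, folded exhaustion_def] by (auto dest: monoD)

lemma exhaustion_UN: "(\<Union>n. exhaustion n) = UNIV"
proof -
  have "\<exists>n. x \<in> exhaustion n" for x using exhaustion(3)[of "{x}"] by auto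
  then show ?thesis by auto
qed

lemma exhaustion_borel: "exhaustion n \<in> sets borel"
  by (rule compact_borel[OF exhaustion(1)])

section \<open>Bounded functions in the sigma-compact case\<close>

text \<open>The exhaustion consists of sets of finite measure, so a locally measurable set is a
  countable union of Borel sets. In the same way locally null sets are null.\<close>

lemma locally_measurable_iff: "locally_measurable_set \<Lambda> E \<longleftrightarrow> E \<in> sets borel"
proof
  assume E: "locally_measurable_set \<Lambda> E"
  have "E \<inter> exhaustion n \<in> sets borel" for n
    using E compact_fmeasurable[OF exhaustion(1)[of n]] by (simp add: locally_measurable_set_def)
  then have "(\<Union>n. E \<inter> exhaustion n) \<in> sets borel" by (intro sets.countable_UN) auto
  moreover have "(\<Union>n. E \<inter> exhaustion n) = E" using exhaustion_UN by auto
  ultimately show "E \<in> sets borel" by simp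
qed (auto simp: locally_measurable_set_def dest: fmeasurableD)

lemma locally_null_iff: "locally_null \<Lambda> E \<longleftrightarrow> E \<in> null_sets \<Lambda>"
proof
  assume E: "locally_null \<Lambda> E"
  have "E \<inter> exhaustion n \<in> null_sets \<Lambda>" for n
    using E compact_fmeasurable[OF exhaustion(1)[of n]] by (simp add: locally_null_def)
  then have "(\<Union>n. E \<inter> exhaustion n) \<in> null_sets \<Lambda>" by (intro null_sets_UN) auto
  moreover have "(\<Union>n. E \<inter> exhaustion n) = E" using exhaustion_UN by auto
  ultimately show "E \<in> null_sets \<Lambda>" by simp
qed (auto simp: locally_null_def intro: null_set_Int2 fmeasurableD)

lemma Linf_iff: "\<phi> \<in> Linf \<Lambda> \<longleftrightarrow> \<phi> \<in> borel_measurable borel \<and> bounded (range \<phi>)"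
  by (auto simp: Linf_def locally_measurable_iff measurable_def)

lemma null_set_reflect:
  assumes "N \<in> null_sets \<Lambda>"
  shows "uminus ` N \<in> null_sets \<Lambda>"
proof -
  have "uminus ` (N \<inter> exhaustion n) \<in> null_sets \<Lambda>" for n
    using assms exhaustion_borel exhaustion(1)
    by (intro null_set_reflect_compact[of _ "exhaustion n"] null_set_Int2) auto
  then have "(\<Union>n. uminus ` (N \<inter> exhaustion n)) \<in> null_sets \<Lambda>" by (intro null_sets_UN) auto
  moreover have "(\<Union>n. uminus ` (N \<inter> exhaustion n)) = uminus ` N"
    unfolding image_UN[symmetric] using exhaustion_UN by (metis Int_UN_distrib Int_UNIV_right)
  ultimately show ?thesis by simp
qed

text \<open>The integrands can differ at \<open>y\<close> only if \<open>- y + x\<close> lies in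
  \<open>N\<close>, that is, if \<open>y\<close> lies in the left translate by \<open>x\<close> of
  the reflection of \<open>N\<close>, which is null.\<close>

lemma convolution_cong_null:
  assumes "f \<in> borel_measurable borel" "\<phi> \<in> borel_measurable borel" "\<psi> \<in> borel_measurable borel" "{x. \<phi> x \<noteq> \<psi> x} \<in> null_sets \<Lambda>"
  shows "convolution \<Lambda> f \<phi> x = convolution \<Lambda> f \<psi> x"
proof -
  define N where "N = {x. \<phi> x \<noteq> \<psi> x}"
  have N: "uminus ` N \<in> null_sets \<Lambda>" unfolding N_def by (rule null_set_reflect[OF assms(4)])
  have "(+) x ` S = (\<lambda>y. - x + y) -` S" for S
    by (force simp: add.assoc[symmetric] image_iff)
  from this[of "uminus ` N"] have "(+) x ` uminus ` N = (\<lambda>y. - x + y) -` (uminus ` N)" .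
  moreover have "(\<lambda>y. - x + y) -` (uminus ` N) \<in> sets borel"
    using measurable_sets[OF measurable_left, of "uminus ` N" "- x"] null_setsD2[OF N] by simp
  ultimately have null: "(+) x ` uminus ` N \<in> null_sets \<Lambda>"
    using N Haar_left[of "uminus ` N" x] by (auto simp: null_sets_def)
  have "AE y in \<Lambda>. f y * \<phi> (- y + x) = f y * \<psi> (- y + x)"
  proof (rule AE_I'[OF null], rule subsetI, elim CollectE conjE)
    fix y assume "f y * \<phi> (- y + x) \<noteq> f y * \<psi> (- y + x)"
    then have "- y + x \<in> N" by (auto simp: N_def)
    moreover have "y = x + - (- y + x)" by (simp add: minus_add add.assoc[symmetric])
    ultimately show "y \<in> (+) x ` uminus ` N" by blast
  qed
  then show ?thesis
    unfolding convolution_def using assms(1-3)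
    by (intro integral_cong_AE) (auto simp: measurable_Haar intro!: borel_measurable_times measurable_reflect)
qed

lemma LinfI: "\<phi> \<in> borel_measurable borel \<Longrightarrow> (\<And>x. \<bar>\<phi> x\<bar> \<le> C) \<Longrightarrow> \<phi> \<in> Linf \<Lambda>"
  by (auto simp: Linf_iff bounded_iff)

lemma LinfE:
  assumes "\<phi> \<in> Linf \<Lambda>"
  obtains C where "\<phi> \<in> borel_measurable borel" "0 \<le> C" "\<And>x. \<bar>\<phi> x\<bar> \<le> C"
proof -
  obtain C where "\<forall>y\<in>range \<phi>. norm y \<le> C" using assms unfolding Linf_iff bounded_iff by auto
  then have C: "\<bar>\<phi> x\<bar> \<le> C" for x by simp
  have "0 \<le> C" using C[of undefined] by linarith
  with C that assms show thesis unfolding Linf_iff by metis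
qed

lemma Linf_const: "(\<lambda>_. c) \<in> Linf \<Lambda>"
  by (rule LinfI[of _ "\<bar>c\<bar>"]) auto

lemma Linf_add:
  assumes "\<phi> \<in> Linf \<Lambda>" "\<psi> \<in> Linf \<Lambda>" shows "(\<lambda>x. \<phi> x + \<psi> x) \<in> Linf \<Lambda>"
proof -
  obtain C where C: "\<phi> \<in> borel_measurable borel" "0 \<le> C" "\<And>x. \<bar>\<phi> x\<bar> \<le> C" using LinfE[OF assms(1)] by metis
  obtain D where D: "\<psi> \<in> borel_measurable borel" "0 \<le> D" "\<And>x. \<bar>\<psi> x\<bar> \<le> D" using LinfE[OF assms(2)] by metis
  show ?thesis
  proof (rule LinfI)
    show "\<bar>\<phi> x + \<psi> x\<bar> \<le> C + D" for x using C(3)[of x] D(3)[of x] by linarith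
  qed (intro borel_measurable_add C D)
qed

lemma Linf_cmult:
  assumes "\<phi> \<in> Linf \<Lambda>" shows "(\<lambda>x. c * \<phi> x) \<in> Linf \<Lambda>"
proof -
  obtain C where C: "\<phi> \<in> borel_measurable borel" "0 \<le> C" "\<And>x. \<bar>\<phi> x\<bar> \<le> C" using LinfE[OF assms(1)] by metis
  show ?thesis
  proof (rule LinfI)
    show "\<bar>c * \<phi> x\<bar> \<le> \<bar>c\<bar> * C" for x using C(3)[of x] by (simp add: abs_mult mult_left_mono)
  qed (intro borel_measurable_times C borel_measurable_const)
qed

lemma Linf_diff:
  assumes "\<phi> \<in> Linf \<Lambda>" "\<psi> \<in> Linf \<Lambda>" shows "(\<lambda>x. \<phi> x - \<psi> x) \<in> Linf \<Lambda>"
  using Linf_add[OF assms(1) Linf_cmult[OF assms(2), of "-1"]] by simp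

lemma Linf_sum:
  assumes "finite I" "\<And>i. i \<in> I \<Longrightarrow> f i \<in> Linf \<Lambda>"
  shows "(\<lambda>x. \<Sum>i\<in>I. f i x) \<in> Linf \<Lambda>"
  using assms by (induction I rule: finite_induct) (auto simp: Linf_const Linf_add)

lemma Linf_indicator: "E \<in> sets borel \<Longrightarrow> indicator E \<in> Linf \<Lambda>"
  by (rule LinfI[of _ 1]) (auto simp: indicator_def)

lemma UC_Linf: "\<psi> \<in> UC \<Longrightarrow> \<psi> \<in> Linf \<Lambda>"
  by (meson LinfI UC_bounded UC_cont borel_measurable_continuous_onI)

lemma Linf_left: "\<phi> \<in> Linf \<Lambda> \<Longrightarrow> (\<lambda>x. \<phi> (a + x)) \<in> Linf \<Lambda>"
  by (erule LinfE, rule LinfI) (rule measurable_compose[OF measurable_left])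

text \<open>The norm is an infimum, so at first only the sets where
  \<open>\<bar>\<phi>\<bar>\<close> exceeds \<open>1 + 1 / Suc n\<close> are seen to be null; their
  union over \<open>n\<close> is the set in question.\<close>

lemma Linf_norm_le_1:
  assumes "\<phi> \<in> Linf \<Lambda>" "Linf_norm \<Lambda> \<phi> \<le> 1"
  shows "{x. 1 < \<bar>\<phi> x\<bar>} \<in> null_sets \<Lambda>"
proof -
  obtain C where C: "\<phi> \<in> borel_measurable borel" "0 \<le> C" "\<And>x. \<bar>\<phi> x\<bar> \<le> C" using LinfE[OF assms(1)] by metis
  define S where "S = {c. 0 \<le> c \<and> locally_null \<Lambda> {x \<in> space \<Lambda>. c < \<bar>\<phi> x\<bar>}}"
  have "{x. C < \<bar>\<phi> x\<bar>} = {}" using C(3) by (auto simp: not_less)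
  then have "C \<in> S" using C(2) by (simp add: S_def locally_null_iff)
  have meas: "{x. c < \<bar>\<phi> x\<bar>} \<in> sets borel" for c :: real
    using C(1) by measurable
  have "{x. 1 + 1 / real (Suc n) < \<bar>\<phi> x\<bar>} \<in> null_sets \<Lambda>" for n
  proof -
    have "Inf S \<le> 1" using assms(2) by (simp add: Linf_norm_def S_def)
    also have "1 < 1 + 1 / real (Suc n)" by simp
    finally obtain c where c: "c \<in> S" "c < 1 + 1 / real (Suc n)"
      using cInf_lessD[of S] \<open>C \<in> S\<close> by blast
    from c(1) have "{x. c < \<bar>\<phi> x\<bar>} \<in> null_sets \<Lambda>" by (simp add: S_def locally_null_iff)
    then show ?thesis by (rule null_sets_subset) (use c(2) meas in auto)
  qed
  then have "(\<Union>n. {x. 1 + 1 / real (Suc n) < \<bar>\<phi> x\<bar>}) \<in> null_sets \<Lambda>" by (intro null_sets_UN) auto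
  moreover have "(\<Union>n. {x. 1 + 1 / real (Suc n) < \<bar>\<phi> x\<bar>}) = {x. 1 < \<bar>\<phi> x\<bar>}"
  proof (intro equalityI subsetI)
    fix x assume "x \<in> {x. 1 < \<bar>\<phi> x\<bar>}"
    then have "0 < \<bar>\<phi> x\<bar> - 1" by simp
    then obtain n where "inverse (real (Suc n)) < \<bar>\<phi> x\<bar> - 1" using reals_Archimedean by blast
    then show "x \<in> (\<Union>n. {x. 1 + 1 / real (Suc n) < \<bar>\<phi> x\<bar>})" by (auto simp: field_simps intro!: exI[of _ n])
  next
    fix x assume "x \<in> (\<Union>n. {x. 1 + 1 / real (Suc n) < \<bar>\<phi> x\<bar>})"
    then obtain n where "1 + 1 / real (Suc n) < \<bar>\<phi> x\<bar>" by auto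
    moreover have "0 < 1 / real (Suc n)" by simp
    ultimately show "x \<in> {x. 1 < \<bar>\<phi> x\<bar>}" unfolding mem_Collect_eq by linarith
  qed
  ultimately show ?thesis by simp
qed

section \<open>Means as normalised positive functionals\<close>

text \<open>If \<open>\<phi>\<close> has norm at most 1, then \<open>1 + \<phi>\<close> and
  \<open>1 - \<phi>\<close> are nonnegative off a null set, so positivity bounds
  \<open>\<bar>\<mu> \<phi>\<bar>\<close> by the value at 1, where the supremum is attained.\<close>

lemma Linf_dual_norm_positive:
  assumes lin: "\<mu> \<in> Linf_linear_functionals \<Lambda>"
    and pos: "\<And>\<phi>. \<phi> \<in> Linf \<Lambda> \<Longrightarrow> {x. \<phi> x < 0} \<in> null_sets \<Lambda> \<Longrightarrow> 0 \<le> \<mu> \<phi>"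
  shows "Linf_dual_norm \<Lambda> \<mu> = ereal (\<mu> (\<lambda>_. 1))"
  unfolding Linf_dual_norm_def
proof (rule antisym)
  have add: "\<mu> (\<lambda>x. \<phi> x + \<psi> x) = \<mu> \<phi> + \<mu> \<psi>" if "\<phi> \<in> Linf \<Lambda>" "\<psi> \<in> Linf \<Lambda>" for \<phi> \<psi>
    using lin that by (simp add: Linf_linear_functionals_def)
  have cm: "\<mu> (\<lambda>x. c * \<phi> x) = c * \<mu> \<phi>" if "\<phi> \<in> Linf \<Lambda>" for c \<phi>
    using lin that by (simp add: Linf_linear_functionals_def)
  show "(SUP \<phi>\<in>{\<phi> \<in> Linf \<Lambda>. Linf_norm \<Lambda> \<phi> \<le> 1}. ereal \<bar>\<mu> \<phi>\<bar>) \<le> ereal (\<mu> (\<lambda>_. 1))"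
  proof (rule SUP_least, elim CollectE conjE)
    fix \<phi> assume \<phi>: "\<phi> \<in> Linf \<Lambda>" "Linf_norm \<Lambda> \<phi> \<le> 1"
    note N = Linf_norm_le_1[OF \<phi>]
    have m: "\<phi> \<in> borel_measurable borel" using \<phi>(1) by (simp add: Linf_iff)
    have "0 \<le> \<mu> (\<lambda>x. 1 + s * \<phi> x)" if "\<bar>s\<bar> = 1" for s
    proof (rule pos)
      show "(\<lambda>x. 1 + s * \<phi> x) \<in> Linf \<Lambda>" by (intro Linf_add Linf_cmult Linf_const \<phi>)
      show "{x. 1 + s * \<phi> x < 0} \<in> null_sets \<Lambda>"
      proof (rule null_sets_subset[OF N])
        show "{x. 1 + s * \<phi> x < 0} \<in> sets \<Lambda>" using m by simp
        show "{x. 1 + s * \<phi> x < 0} \<subseteq> {x. 1 < \<bar>\<phi> x\<bar>}"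
          using that by (auto simp: abs_if split: if_splits)
      qed
    qed
    moreover have "\<mu> (\<lambda>x. 1 + s * \<phi> x) = \<mu> (\<lambda>_. 1) + s * \<mu> \<phi>" for s
      by (simp add: add[OF Linf_const Linf_cmult[OF \<phi>(1)]] cm[OF \<phi>(1)])
    ultimately have "0 \<le> \<mu> (\<lambda>_. 1) + 1 * \<mu> \<phi>" "0 \<le> \<mu> (\<lambda>_. 1) + (-1) * \<mu> \<phi>"
      by (metis abs_one, metis abs_minus_cancel abs_one)
    then show "ereal \<bar>\<mu> \<phi>\<bar> \<le> ereal (\<mu> (\<lambda>_. 1))" by simp
  qed
  have "Linf_norm \<Lambda> (\<lambda>_. 1) \<le> 1"
    unfolding Linf_norm_def by (rule cInf_lower) (auto simp: locally_null_iff intro!: bdd_belowI[of _ 0])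
  then have "ereal \<bar>\<mu> (\<lambda>_. 1)\<bar> \<le> (SUP \<phi>\<in>{\<phi> \<in> Linf \<Lambda>. Linf_norm \<Lambda> \<phi> \<le> 1}. ereal \<bar>\<mu> \<phi>\<bar>)"
    by (intro SUP_upper) (simp add: Linf_const)
  then show "ereal (\<mu> (\<lambda>_. 1)) \<le> (SUP \<phi>\<in>{\<phi> \<in> Linf \<Lambda>. Linf_norm \<Lambda> \<phi> \<le> 1}. ereal \<bar>\<mu> \<phi>\<bar>)"
    by (rule order_trans[rotated]) simp
qed

lemma means_iff:
  "\<mu> \<in> means \<Lambda> \<longleftrightarrow> \<mu> \<in> Linf_linear_functionals \<Lambda> \<and>
     (\<forall>\<phi>\<in>Linf \<Lambda>. {x. \<phi> x < 0} \<in> null_sets \<Lambda> \<longrightarrow> 0 \<le> \<mu> \<phi>) \<and> \<mu> (\<lambda>_. 1) = 1"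
proof -
  have "Linf_dual_norm \<Lambda> \<mu> = 1 \<longleftrightarrow> \<mu> (\<lambda>_. 1) = 1"
    if "\<mu> \<in> Linf_linear_functionals \<Lambda>" "\<forall>\<phi>\<in>Linf \<Lambda>. {x. \<phi> x < 0} \<in> null_sets \<Lambda> \<longrightarrow> 0 \<le> \<mu> \<phi>"
    using Linf_dual_norm_positive[OF that(1)] that(2) by (auto simp: one_ereal_def)
  then show ?thesis unfolding means_def locally_null_iff by auto
qed

lemma mean_add: "\<mu> \<in> means \<Lambda> \<Longrightarrow> \<phi> \<in> Linf \<Lambda> \<Longrightarrow> \<psi> \<in> Linf \<Lambda> \<Longrightarrow> \<mu> (\<lambda>x. \<phi> x + \<psi> x) = \<mu> \<phi> + \<mu> \<psi>"
  unfolding means_iff Linf_linear_functionals_def by blast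

lemma mean_cmult: "\<mu> \<in> means \<Lambda> \<Longrightarrow> \<phi> \<in> Linf \<Lambda> \<Longrightarrow> \<mu> (\<lambda>x. c * \<phi> x) = c * \<mu> \<phi>"
  unfolding means_iff Linf_linear_functionals_def by blast

lemma mean_cong: "\<mu> \<in> means \<Lambda> \<Longrightarrow> \<phi> \<in> Linf \<Lambda> \<Longrightarrow> \<psi> \<in> Linf \<Lambda> \<Longrightarrow> {x. \<phi> x \<noteq> \<psi> x} \<in> null_sets \<Lambda> \<Longrightarrow> \<mu> \<phi> = \<mu> \<psi>"
proof -
  assume asm: "\<mu> \<in> means \<Lambda>" "\<phi> \<in> Linf \<Lambda>" "\<psi> \<in> Linf \<Lambda>" "{x. \<phi> x \<noteq> \<psi> x} \<in> null_sets \<Lambda>"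
  then have "\<mu> \<in> Linf_linear_functionals \<Lambda>" unfolding means_iff by (elim conjE)
  note this[unfolded Linf_linear_functionals_def mem_Collect_eq, THEN conjunct2, THEN conjunct1]
  from bspec[OF bspec[OF this asm(2)] asm(3)] show "\<mu> \<phi> = \<mu> \<psi>"
    by (rule mp) (use asm(4) in \<open>simp add: locally_null_iff\<close>)
qed

lemma mean_one: "\<mu> \<in> means \<Lambda> \<Longrightarrow> \<mu> (\<lambda>_. 1) = 1"
  unfolding means_iff by (elim conjE)

lemma mean_const: "\<mu> \<in> means \<Lambda> \<Longrightarrow> \<mu> (\<lambda>_. c) = c"
  using mean_cmult[OF _ Linf_const, of \<mu> c 1] mean_one by simp

lemma mean_nonneg: "\<mu> \<in> means \<Lambda> \<Longrightarrow> \<phi> \<in> Linf \<Lambda> \<Longrightarrow> (\<And>x. 0 \<le> \<phi> x) \<Longrightarrow> 0 \<le> \<mu> \<phi>"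
proof -
  assume "\<mu> \<in> means \<Lambda>" "\<phi> \<in> Linf \<Lambda>" and nn: "\<And>x. 0 \<le> \<phi> x"
  moreover have "{x. \<phi> x < 0} = {}" using nn by (auto simp: not_less)
  ultimately show "0 \<le> \<mu> \<phi>" unfolding means_iff by simp
qed

lemma mean_diff: "\<mu> \<in> means \<Lambda> \<Longrightarrow> \<phi> \<in> Linf \<Lambda> \<Longrightarrow> \<psi> \<in> Linf \<Lambda> \<Longrightarrow> \<mu> (\<lambda>x. \<phi> x - \<psi> x) = \<mu> \<phi> - \<mu> \<psi>"
  using mean_add[OF _ _ Linf_cmult[of \<psi> "-1"], of \<mu> \<phi>] mean_cmult[of \<mu> \<psi> "-1"] by simp

lemma mean_mono: "\<mu> \<in> means \<Lambda> \<Longrightarrow> \<phi> \<in> Linf \<Lambda> \<Longrightarrow> \<psi> \<in> Linf \<Lambda> \<Longrightarrow> (\<And>x. \<phi> x \<le> \<psi> x) \<Longrightarrow> \<mu> \<phi> \<le> \<mu> \<psi>"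
  using mean_nonneg[OF _ Linf_diff[of \<psi> \<phi>], of \<mu>] mean_diff[of \<mu> \<psi> \<phi>] by simp

text \<open>The bound \<open>\<theta>\<close> is a function because a mean may annihilate it without
  its being small: for \<open>\<theta>\<close> the indicator of a compact set this expresses that
  exceptions on the set are ignored.\<close>

lemma mean_dist_le:
  assumes "\<mu> \<in> means \<Lambda>" "\<phi> \<in> Linf \<Lambda>" "\<psi> \<in> Linf \<Lambda>" "\<theta> \<in> Linf \<Lambda>" "\<And>x. \<bar>\<phi> x - \<psi> x\<bar> \<le> \<theta> x"
  shows "\<bar>\<mu> \<phi> - \<mu> \<psi>\<bar> \<le> \<mu> \<theta>"
proof -
  have le: "\<phi> x \<le> \<psi> x + \<theta> x" "\<psi> x \<le> \<phi> x + \<theta> x" for x using assms(5)[of x] by linarith+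
  have "\<mu> \<phi> \<le> \<mu> (\<lambda>x. \<psi> x + \<theta> x)" "\<mu> \<psi> \<le> \<mu> (\<lambda>x. \<phi> x + \<theta> x)"
    by (rule mean_mono[OF assms(1,2) Linf_add[OF assms(3,4)] le(1)], rule mean_mono[OF assms(1,3) Linf_add[OF assms(2,4)] le(2)])
  then show ?thesis unfolding mean_add[OF assms(1,3,4)] mean_add[OF assms(1,2,4)] by linarith
qed

lemma mean_sum:
  assumes "\<mu> \<in> means \<Lambda>" "finite I" "\<And>i. i \<in> I \<Longrightarrow> f i \<in> Linf \<Lambda>"
  shows "\<mu> (\<lambda>x. \<Sum>i\<in>I. f i x) = (\<Sum>i\<in>I. \<mu> (f i))"
  using assms(2,3)
proof (induction I rule: finite_induct)
  case empty
  show ?case using mean_const[OF assms(1), of 0] by simp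
next
  case (insert i I)
  then show ?case using mean_add[OF assms(1), of "f i" "\<lambda>x. \<Sum>i\<in>I. f i x"] by (simp add: Linf_sum)
qed

lemma convolution_add_right:
  assumes "integrable \<Lambda> f" "\<phi> \<in> Linf \<Lambda>" "\<psi> \<in> Linf \<Lambda>"
  shows "convolution \<Lambda> f (\<lambda>x. \<phi> x + \<psi> x) x = convolution \<Lambda> f \<phi> x + convolution \<Lambda> f \<psi> x"
proof -
  obtain C where C: "\<phi> \<in> borel_measurable borel" "0 \<le> C" "\<And>x. \<bar>\<phi> x\<bar> \<le> C" using LinfE[OF assms(2)] by metis
  obtain D where D: "\<psi> \<in> borel_measurable borel" "0 \<le> D" "\<And>x. \<bar>\<psi> x\<bar> \<le> D" using LinfE[OF assms(3)] by metis
  show ?thesis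
    unfolding convolution_def distrib_left
    by (intro Bochner_Integration.integral_add integrable_mult_bounded(1)[OF assms(1)])
       (rule measurable_reflect[OF C(1)] C(3) measurable_reflect[OF D(1)] D(3))+
qed

lemma convolution_cmult_right: "convolution \<Lambda> f (\<lambda>x. c * \<phi> x) x = c * convolution \<Lambda> f \<phi> x"
  unfolding convolution_def by (simp add: mult.left_commute)

lemma convolution_Linf_UC:
  assumes "integrable \<Lambda> f" "\<phi> \<in> Linf \<Lambda>"
  shows "convolution \<Lambda> f \<phi> \<in> UC"
  using LinfE[OF assms(2)] convolution_UC[OF assms(1)] by metis

end

section \<open>Topologically invariant means on thick sets\<close>

locale nonunimodular_mean = sigma_haar_group +
  fixes m :: "('a \<Rightarrow> real) \<Rightarrow> real"
  assumes mean: "m \<in> means \<Lambda>"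
    and invariant: "\<phi> \<in> Linf \<Lambda> \<Longrightarrow> m (\<lambda>y. \<phi> (a + y)) = m \<phi>"
    and nonunimodular: "\<not> unimodular \<Lambda>"
begin

lemma mean_bound_const: "\<phi> \<in> Linf \<Lambda> \<Longrightarrow> (\<And>x. \<bar>\<phi> x\<bar> \<le> C) \<Longrightarrow> \<bar>m \<phi>\<bar> \<le> C"
  using mean_dist_le[OF mean _ Linf_const Linf_const, of \<phi> 0 C] by (simp add: mean_const[OF mean])

text \<open>\<open>K\<close> lies in a band \<open>S\<close> of values of \<open>modular\<close>.
  Multiples of an element with large modular value move \<open>S\<close> to arbitrarily many
  pairwise disjoint translates of equal mean, so \<open>S\<close> has mean 0.\<close>

lemma mean_compact:
  assumes "compact K"
  shows "m (indicator K) = 0"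
proof -
  obtain B where B: "0 < B" "\<And>k. k \<in> K \<Longrightarrow> modular k \<le> B" "\<And>k. k \<in> K \<Longrightarrow> 1 / B \<le> modular k"
    using modular_bounded[OF assms] by metis
  define S where "S = {w. 1 / B \<le> modular w \<and> modular w \<le> B}"
  have "closed S" unfolding S_def
    by (intro closed_Collect_conj closed_Collect_le modular_continuous continuous_on_const)
  then have S: "S \<in> sets borel" by simp
  have "K \<subseteq> S" using B by (auto simp: S_def)
  \<comment> \<open>The values on the band vary by a factor of at most \<open>B * B\<close>, so this
    shift moves the band off itself. The value 1 makes the powers of \<open>modular x\<close>
    increase.\<close>
  obtain x where x: "max 1 (B * B) < modular x" using modular_unbounded[OF nonunimodular] by metis
  define z where "z n = ((\<lambda>v. x + v) ^^ n) 0" for n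
  have z: "modular (z n) = modular x ^ n" for n
    unfolding z_def by (induction n) (auto simp: modular_0 modular_add)
  have uniq: "i = j" if "z i + w \<in> S" "z j + w \<in> S" for i j w
  proof -
    have *: False if "i < j" "z i + w \<in> S" "z j + w \<in> S" for i j
    proof -
      have "modular x * (1 / B) \<le> modular x * (modular x ^ i * modular w)"
        using that(2) modular_pos[of x] by (intro mult_left_mono) (auto simp: S_def modular_add z)
      also have "\<dots> = modular x ^ Suc i * modular w" by simp
      also have "\<dots> \<le> modular x ^ j * modular w"
        using that(1) x modular_pos[of w] by (intro mult_right_mono power_increasing) auto
      also have "\<dots> \<le> B" using that(3) by (simp add: S_def modular_add z)
      finally have "modular x \<le> B * B" using B(1) by (simp add: field_simps)
      then show False using x by simp
    qed
    show ?thesis using *[of i j] *[of j i] that by (cases i j rule: linorder_cases) auto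
  qed
  have "real N * m (indicator S) \<le> 1" for N
  proof -
    have L: "(\<lambda>w. indicator S (z i + w)) \<in> Linf \<Lambda>" for i by (rule Linf_left[OF Linf_indicator[OF S]])
    have "(\<Sum>i<N. indicator S (z i + w) :: real) \<le> 1" for w
    proof -
      have "(\<Sum>i<N. indicator S (z i + w) :: real) = real (card {i \<in> {..<N}. z i + w \<in> S})"
        by (simp add: indicator_def sum.If_cases Int_def)
      moreover have "card {i \<in> {..<N}. z i + w \<in> S} \<le> Suc 0"
        by (subst card_le_Suc0_iff_eq) (auto dest: uniq)
      ultimately show ?thesis by simp
    qed
    then have "m (\<lambda>w. \<Sum>i<N. indicator S (z i + w)) \<le> m (\<lambda>_. 1)"
      by (intro mean_mono[OF mean] Linf_sum Linf_const L) auto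
    also have "m (\<lambda>w. \<Sum>i<N. indicator S (z i + w)) = (\<Sum>i<N. m (\<lambda>w. indicator S (z i + w)))"
      by (rule mean_sum[OF mean]) (auto intro: L)
    also have "\<dots> = real N * m (indicator S)" using invariant[OF Linf_indicator[OF S]] by simp
    finally show ?thesis using mean_const[OF mean, of 1] by simp
  qed
  then have "m (indicator S) \<le> 0"
    by (metis mult.commute not_le order_less_le_trans reals_Archimedean3 less_irrefl)
  moreover have "m (indicator K) \<le> m (indicator S)"
    using \<open>K \<subseteq> S\<close> by (intro mean_mono[OF mean] Linf_indicator S compact_borel assms) (auto simp: indicator_def)
  moreover have "0 \<le> m (indicator K)"
    by (intro mean_nonneg[OF mean] Linf_indicator compact_borel assms) simp
  ultimately show ?thesis by linarith
qed

section \<open>Generalised limits along a sequence of right translations\<close>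

definition level :: "'a \<Rightarrow> nat" where
  "level w = (LEAST n. w \<in> exhaustion n)"

lemma level_measurable: "level \<in> borel \<rightarrow>\<^sub>M count_space UNIV"
  unfolding level_def using exhaustion_borel by (intro measurable_Least) (auto simp: pred_def)

lemma level_le: "level w \<le> n \<longleftrightarrow> w \<in> exhaustion n"
proof
  assume "level w \<le> n"
  moreover have "\<exists>n. w \<in> exhaustion n" using exhaustion_UN by auto
  then have "w \<in> exhaustion (level w)" unfolding level_def by (rule LeastI_ex)
  ultimately show "w \<in> exhaustion n" using exhaustion(2) by blast
qed (simp add: level_def Least_le)

text \<open>
  As \<open>m\<close> vanishes on compact sets, its image under \<^term>\<open>level\<close> is a mean on bounded sequences that
  vanishes on finite sets; \<open>sample s \<psi> x\<close> is the resulting generalised limit of \<open>\<psi> (x + s n)\<close>.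
\<close>

definition sample :: "(nat \<Rightarrow> 'a) \<Rightarrow> ('a \<Rightarrow> real) \<Rightarrow> 'a \<Rightarrow> real" where
  "sample s \<psi> x = m (\<lambda>w. \<psi> (x + s (level w)))"

lemma sample_Linf:
  assumes "\<psi> \<in> UC" shows "(\<lambda>w. \<psi> (x + s (level w))) \<in> Linf \<Lambda>"
proof -
  obtain C where "\<And>x. \<bar>\<psi> x\<bar> \<le> C" using UC_bounded[OF assms] by metis
  moreover have "(\<lambda>n. \<psi> (x + s n)) \<in> count_space UNIV \<rightarrow>\<^sub>M borel" by simp
  from measurable_compose[OF level_measurable this] have "(\<lambda>w. \<psi> (x + s (level w))) \<in> borel_measurable borel" .
  ultimately show ?thesis by (intro LinfI)
qed

text \<open>The estimate defining \<open>UC\<close> is uniform in the right-hand summand, so it is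
  unaffected by the shift \<open>s (level w)\<close> and by averaging over \<open>w\<close>.\<close>

lemma sample_UC:
  assumes "\<psi> \<in> UC" shows "sample s \<psi> \<in> UC"
proof -
  obtain C where C: "\<And>x. \<bar>\<psi> x\<bar> \<le> C" using UC_bounded[OF assms] by metis
  show ?thesis
  proof (rule UCI[of _ C])
    show "\<bar>sample s \<psi> x\<bar> \<le> C" for x
      unfolding sample_def by (rule mean_bound_const[OF sample_Linf[OF assms] C])
    fix x0 and \<epsilon> :: real assume e: "0 < \<epsilon>"
    obtain V where V: "open V" "x0 \<in> V" "\<And>x t. x \<in> V \<Longrightarrow> \<bar>\<psi> (x + t) - \<psi> (x0 + t)\<bar> \<le> \<epsilon>"
      using UC_nbhd[OF assms e, where z=x0] by metis
    show "\<exists>V. open V \<and> x0 \<in> V \<and> (\<forall>x\<in>V. \<forall>t. \<bar>sample s \<psi> (x + t) - sample s \<psi> (x0 + t)\<bar> \<le> \<epsilon>)"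
    proof (intro exI[of _ V] conjI ballI allI V)
      fix x t assume "x \<in> V"
      have "\<bar>sample s \<psi> (x + t) - sample s \<psi> (x0 + t)\<bar> \<le> m (\<lambda>_. \<epsilon>)"
        unfolding sample_def
      proof (rule mean_dist_le[OF mean sample_Linf[OF assms] sample_Linf[OF assms] Linf_const])
        fix w
        show "\<bar>\<psi> (x + t + s (level w)) - \<psi> (x0 + t + s (level w))\<bar> \<le> \<epsilon>"
          using V(3)[OF \<open>x \<in> V\<close>, of "t + s (level w)"] by (simp add: add.assoc)
      qed
      then show "\<bar>sample s \<psi> (x + t) - sample s \<psi> (x0 + t)\<bar> \<le> \<epsilon>" by (simp add: mean_const[OF mean])
    qed
  qed
qed

text \<open>The mean \<open>m\<close> occurs twice: within \<open>sample\<close> it serves as a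
  limit along \<open>s\<close>, and on the outside it makes the result left-invariant.\<close>

definition \<Theta> :: "(nat \<Rightarrow> 'a) \<Rightarrow> ('a \<Rightarrow> real) \<Rightarrow> real" where
  "\<Theta> s \<psi> = m (sample s \<psi>)"

lemma \<Theta>_add:
  assumes "\<phi> \<in> UC" "\<psi> \<in> UC" shows "\<Theta> s (\<lambda>x. \<phi> x + \<psi> x) = \<Theta> s \<phi> + \<Theta> s \<psi>"
proof -
  have "sample s (\<lambda>x. \<phi> x + \<psi> x) = (\<lambda>x. sample s \<phi> x + sample s \<psi> x)"
    unfolding sample_def by (rule ext) (rule mean_add[OF mean sample_Linf[OF assms(1)] sample_Linf[OF assms(2)]])
  then show ?thesis unfolding \<Theta>_def using mean_add[OF mean UC_Linf UC_Linf, OF sample_UC sample_UC] assms by simp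
qed

lemma \<Theta>_cmult:
  assumes "\<psi> \<in> UC" shows "\<Theta> s (\<lambda>x. c * \<psi> x) = c * \<Theta> s \<psi>"
proof -
  have "sample s (\<lambda>x. c * \<psi> x) = (\<lambda>x. c * sample s \<psi> x)"
    unfolding sample_def by (rule ext) (rule mean_cmult[OF mean sample_Linf[OF assms(1)]])
  then show ?thesis unfolding \<Theta>_def using mean_cmult[OF mean UC_Linf, OF sample_UC] assms by simp
qed

lemma \<Theta>_left:
  assumes "\<psi> \<in> UC" shows "\<Theta> s (\<lambda>x. \<psi> (a + x)) = \<Theta> s \<psi>"
proof -
  have "sample s (\<lambda>x. \<psi> (a + x)) = (\<lambda>x. sample s \<psi> (a + x))"
    unfolding sample_def by (simp add: add.assoc)
  then show ?thesis unfolding \<Theta>_def using invariant[OF UC_Linf[OF sample_UC[OF assms]]] by simp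
qed

lemma \<Theta>_nonneg:
  assumes "\<psi> \<in> UC" "\<And>x. 0 \<le> \<psi> x" shows "0 \<le> \<Theta> s \<psi>"
  unfolding \<Theta>_def
  by (rule mean_nonneg[OF mean UC_Linf[OF sample_UC[OF assms(1)]]])
     (unfold sample_def, rule mean_nonneg[OF mean sample_Linf[OF assms(1)]], rule assms(2))

lemma \<Theta>_bound:
  assumes "\<psi> \<in> UC" "\<And>x. \<bar>\<psi> x\<bar> \<le> C" shows "\<bar>\<Theta> s \<psi>\<bar> \<le> C"
  unfolding \<Theta>_def
  by (rule mean_bound_const[OF UC_Linf[OF sample_UC[OF assms(1)]]])
     (unfold sample_def, rule mean_bound_const[OF sample_Linf[OF assms(1)]], rule assms(2))

lemma \<Theta>_dist:
  assumes "\<phi> \<in> UC" "\<psi> \<in> UC" "\<And>x. \<bar>\<phi> x - \<psi> x\<bar> \<le> C" shows "\<bar>\<Theta> s \<phi> - \<Theta> s \<psi>\<bar> \<le> C"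
proof -
  have "\<Theta> s (\<lambda>x. \<phi> x + (-1) * \<psi> x) = \<Theta> s \<phi> + (-1) * \<Theta> s \<psi>"
    using assms by (simp only: \<Theta>_add \<Theta>_cmult UC_cmult)
  moreover have "\<bar>\<Theta> s (\<lambda>x. \<phi> x + (-1) * \<psi> x)\<bar> \<le> C"
    by (rule \<Theta>_bound) (use assms in \<open>auto simp only: UC_add UC_cmult\<close>, simp)
  ultimately show ?thesis by simp
qed

lemma \<Theta>_const: "\<Theta> s (\<lambda>_. c) = c"
proof -
  have "sample s (\<lambda>_. c) = (\<lambda>_. c)" by (rule ext) (simp add: sample_def mean_const[OF mean])
  then show ?thesis by (simp add: \<Theta>_def mean_const[OF mean])
qed

text \<open>Replace the convolution by Riemann sums of left translates of \<open>\<psi>\<close>, on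
  all of which \<open>\<Theta> s\<close> has the same value. In \<open>thick_mean_TLIM\<close> this
  removes the outer convolution with \<open>bump\<close>.\<close>

lemma \<Theta>_convolution_Cc:
  assumes f: "f \<in> Cc" and \<psi>: "\<psi> \<in> UC"
  shows "\<Theta> s (convolution \<Lambda> f \<psi>) = (LINT x|\<Lambda>. f x) * \<Theta> s \<psi>"
proof (rule eq_if_close[of _ _ 1])
  fix \<epsilon> :: real assume \<epsilon>: "0 < \<epsilon>"
  obtain K where K: "compact K" "continuous_on UNIV f" "\<And>x. x \<notin> K \<Longrightarrow> f x = 0"
    using f by (elim CcE) blast
  have "\<exists>(n::nat) \<alpha> p. (\<forall>j<n. p j \<in> K) \<and> (\<Sum>j<n. \<alpha> j) = (LINT x|\<Lambda>. f x) \<and>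
      (\<forall>x. \<bar>convolution \<Lambda> f \<psi> x - (\<Sum>j<n. \<alpha> j * \<psi> (- p j + x))\<bar> \<le> \<epsilon>)"
    by (rule convolution_Riemann_sum[OF K(1) Cc_integrable[OF f] _ \<psi> \<epsilon>]) (rule K(3))
  then obtain n :: nat and \<alpha> p where R: "(\<Sum>j<n. \<alpha> j) = (LINT x|\<Lambda>. f x)"
    "\<And>x. \<bar>convolution \<Lambda> f \<psi> x - (\<Sum>j<n. \<alpha> j * \<psi> (- p j + x))\<bar> \<le> \<epsilon>" by auto
  have U: "(\<lambda>x. \<alpha> j * \<psi> (- p j + x)) \<in> UC" for j by (intro UC_cmult UC_left \<psi>)
  have "\<Theta> s (\<lambda>x. \<Sum>j<k. \<alpha> j * \<psi> (- p j + x)) = (\<Sum>j<k. \<alpha> j) * \<Theta> s \<psi>" for k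
  proof (induction k)
    case 0
    show ?case by (simp add: \<Theta>_const)
  next
    case (Suc k)
    have "\<Theta> s (\<lambda>x. \<alpha> k * \<psi> (- p k + x)) = \<alpha> k * \<Theta> s \<psi>"
      using \<Theta>_cmult[OF UC_left[OF \<psi>]] \<Theta>_left[OF \<psi>] by simp
    moreover have "(\<lambda>x. \<Sum>j<k. \<alpha> j * \<psi> (- p j + x)) \<in> UC" by (rule UC_sum) (auto intro: U)
    ultimately show ?case using Suc \<Theta>_add[OF _ U[of k], of "\<lambda>x. \<Sum>j<k. \<alpha> j * \<psi> (- p j + x)" s]
      by (simp add: distrib_right)
  qed
  note Rs = this[of n, unfolded R(1)]
  have "convolution \<Lambda> f \<psi> \<in> UC" by (rule convolution_Linf_UC[OF Cc_integrable[OF f] UC_Linf[OF \<psi>]])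
  moreover have "(\<lambda>x. \<Sum>j<n. \<alpha> j * \<psi> (- p j + x)) \<in> UC" by (rule UC_sum) (auto intro: U)
  ultimately show "\<bar>\<Theta> s (convolution \<Lambda> f \<psi>) - (LINT x|\<Lambda>. f x) * \<Theta> s \<psi>\<bar> \<le> 1 * \<epsilon>"
    unfolding Rs[symmetric] mult_1 using R(2) by (rule \<Theta>_dist)
qed

text \<open>For fixed \<open>\<phi>\<close> the left-hand side is a left-invariant functional of
  \<open>f \<in> Cc\<close>, so it is proportional to the integral; density extends this to
  integrable \<open>f\<close>. Here \<open>\<phi>\<close> itself may lie outside \<open>UC\<close>,
  so the value at \<open>bump\<close> takes the place of \<open>\<Theta> s \<phi>\<close>.\<close>

lemma \<Theta>_convolution_proportional:
  assumes f: "integrable \<Lambda> f" and \<phi>: "\<phi> \<in> Linf \<Lambda>"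
  shows "\<Theta> s (convolution \<Lambda> f \<phi>) = (LINT x|\<Lambda>. f x) * \<Theta> s (convolution \<Lambda> bump \<phi>)"
proof -
  obtain C where C: "\<phi> \<in> borel_measurable borel" "0 \<le> C" "\<And>x. \<bar>\<phi> x\<bar> \<le> C" using LinfE[OF \<phi>] by metis
  have U: "convolution \<Lambda> f \<phi> \<in> UC" if "integrable \<Lambda> f" for f
    by (rule convolution_Linf_UC[OF that \<phi>])
  interpret J: invariant_functional \<Lambda> "\<lambda>f. \<Theta> s (convolution \<Lambda> f \<phi>)"
  proof
    show "\<Theta> s (convolution \<Lambda> (\<lambda>x. f x + g x) \<phi>) = \<Theta> s (convolution \<Lambda> f \<phi>) + \<Theta> s (convolution \<Lambda> g \<phi>)"
      if "f \<in> Cc" "g \<in> Cc" for f g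
    proof -
      have "convolution \<Lambda> (\<lambda>x. f x + g x) \<phi> x = convolution \<Lambda> f \<phi> x + convolution \<Lambda> g \<phi> x" for x
        unfolding convolution_def distrib_right
        by (rule Bochner_Integration.integral_add; rule integrable_mult_bounded(1)[OF _ measurable_reflect[OF C(1)] C(3)])
           (rule Cc_integrable that)+
      then have "convolution \<Lambda> (\<lambda>x. f x + g x) \<phi> = (\<lambda>x. convolution \<Lambda> f \<phi> x + convolution \<Lambda> g \<phi> x)" by (rule ext)
      then show ?thesis using \<Theta>_add[OF U[OF Cc_integrable[OF that(1)]] U[OF Cc_integrable[OF that(2)]]] by simp
    qed
    show "\<Theta> s (convolution \<Lambda> (\<lambda>x. c * f x) \<phi>) = c * \<Theta> s (convolution \<Lambda> f \<phi>)" if "f \<in> Cc" for c f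
    proof -
      have "convolution \<Lambda> (\<lambda>x. c * f x) \<phi> = (\<lambda>x. c * convolution \<Lambda> f \<phi> x)"
        unfolding convolution_def by (simp add: mult.assoc)
      then show ?thesis using \<Theta>_cmult[OF U[OF Cc_integrable[OF that]]] by simp
    qed
    show "\<Theta> s (convolution \<Lambda> (\<lambda>x. f (a + x)) \<phi>) = \<Theta> s (convolution \<Lambda> f \<phi>)" if "f \<in> Cc" for a f
    proof -
      have "convolution \<Lambda> (\<lambda>x. f (a + x)) \<phi> = (\<lambda>x. convolution \<Lambda> f \<phi> (a + x))"
        by (rule ext) (simp add: convolution_shift[OF Cc_measurable[OF that] C(1)], simp add: convolution_def)
      then show ?thesis using \<Theta>_left[OF U[OF Cc_integrable[OF that]]] by simp
    qed
    show "\<exists>D. \<forall>f\<in>Cc. \<forall>\<epsilon>. (\<forall>x. x \<notin> K \<longrightarrow> f x = 0) \<longrightarrow> (\<forall>x. \<bar>f x\<bar> \<le> \<epsilon>) \<longrightarrow> \<bar>\<Theta> s (convolution \<Lambda> f \<phi>)\<bar> \<le> D * \<epsilon>"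
      if K: "compact K" for K
    proof (intro exI[of _ "C * measure \<Lambda> K"] ballI allI impI)
      fix f :: "'a \<Rightarrow> real" and \<epsilon> :: real
      assume f: "f \<in> Cc" "\<forall>x. x \<notin> K \<longrightarrow> f x = 0" "\<forall>x. \<bar>f x\<bar> \<le> \<epsilon>"
      have "\<bar>LINT x|\<Lambda>. \<bar>f x\<bar>\<bar> \<le> \<epsilon> * measure \<Lambda> K"
        by (rule integrable_compact(2)[OF _ K]) (use f Cc_measurable[OF f(1)] in auto)
      then have "(LINT x|\<Lambda>. \<bar>f x\<bar>) \<le> \<epsilon> * measure \<Lambda> K" by linarith
      then have "C * (LINT x|\<Lambda>. \<bar>f x\<bar>) \<le> C * (\<epsilon> * measure \<Lambda> K)" using C(2) by (rule mult_left_mono)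
      moreover have "\<bar>\<Theta> s (convolution \<Lambda> f \<phi>)\<bar> \<le> C * (LINT x|\<Lambda>. \<bar>f x\<bar>)"
        by (rule \<Theta>_bound[OF U convolution_bound[OF _ C(1,3)]]) (rule Cc_integrable[OF f(1)])+
      ultimately show "\<bar>\<Theta> s (convolution \<Lambda> f \<phi>)\<bar> \<le> C * measure \<Lambda> K * \<epsilon>" by (simp add: algebra_simps)
    qed
  qed
  let ?c = "\<Theta> s (convolution \<Lambda> bump \<phi>)"
  show ?thesis
  proof (rule eq_if_close[of _ _ "C + \<bar>?c\<bar>"])
    fix \<epsilon> :: real assume \<epsilon>: "0 < \<epsilon>"
    obtain h where h: "h \<in> Cc" "(LINT x|\<Lambda>. \<bar>f x - h x\<bar>) < \<epsilon>" using Cc_dense_L1[OF f \<epsilon>] by metis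
    note i = f Cc_integrable[OF h(1)]
    have hc: "\<Theta> s (convolution \<Lambda> h \<phi>) = (LINT x|\<Lambda>. h x) * ?c"
      using J.functional_unique[OF h(1) bump(1)] bump(3) by (simp add: mult.commute)
    have "\<bar>convolution \<Lambda> f \<phi> x - convolution \<Lambda> h \<phi> x\<bar> \<le> C * \<epsilon>" for x
    proof -
      have "\<bar>convolution \<Lambda> f \<phi> x - convolution \<Lambda> h \<phi> x\<bar> \<le> C * (LINT x|\<Lambda>. \<bar>f x - h x\<bar>)"
        unfolding convolution_diff[OF i C(1,3), symmetric]
        by (rule convolution_bound[OF _ C(1,3)]) (use i in auto)
      also have "\<dots> \<le> C * \<epsilon>" using h(2) C(2) by (intro mult_left_mono) auto
      finally show ?thesis .
    qed
    then have 1: "\<bar>\<Theta> s (convolution \<Lambda> f \<phi>) - (LINT x|\<Lambda>. h x) * ?c\<bar> \<le> C * \<epsilon>"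
      unfolding hc[symmetric] by (intro \<Theta>_dist U i)
    have "(LINT x|\<Lambda>. h x) - (LINT x|\<Lambda>. f x) = - (LINT x|\<Lambda>. f x - h x)" using i by simp
    then have "\<bar>(LINT x|\<Lambda>. h x) - (LINT x|\<Lambda>. f x)\<bar> \<le> \<epsilon>"
      using integral_abs_bound[of \<Lambda> "\<lambda>x. f x - h x"] h(2) by linarith
    then have "\<bar>(LINT x|\<Lambda>. h x) - (LINT x|\<Lambda>. f x)\<bar> * \<bar>?c\<bar> \<le> \<epsilon> * \<bar>?c\<bar>" by (rule mult_right_mono) simp
    then have "\<bar>(LINT x|\<Lambda>. h x) * ?c - (LINT x|\<Lambda>. f x) * ?c\<bar> \<le> \<epsilon> * \<bar>?c\<bar>"
      by (simp add: abs_mult[symmetric] left_diff_distrib)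
    then show "\<bar>\<Theta> s (convolution \<Lambda> f \<phi>) - (LINT x|\<Lambda>. f x) * ?c\<bar> \<le> (C + \<bar>?c\<bar>) * \<epsilon>"
      using 1 by (simp add: algebra_simps)
  qed
qed

section \<open>The topologically invariant mean attached to a sequence of translations\<close>

text \<open>Convolution with \<open>bump\<close> brings \<open>\<phi>\<close> into
  \<open>UC\<close>, where \<open>\<Theta>\<close> has its invariance properties, and removes the
  dependence on the representative.\<close>

definition thick_mean :: "(nat \<Rightarrow> 'a) \<Rightarrow> ('a \<Rightarrow> real) \<Rightarrow> real" where
  "thick_mean s = (\<lambda>\<phi>\<in>Linf \<Lambda>. \<Theta> s (convolution \<Lambda> bump \<phi>))"

lemma bump_UC: "\<phi> \<in> Linf \<Lambda> \<Longrightarrow> convolution \<Lambda> bump \<phi> \<in> UC"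
  by (rule convolution_Linf_UC[OF Cc_integrable[OF bump(1)]])

lemma convolution_bump_const: "convolution \<Lambda> bump (\<lambda>_. 1) = (\<lambda>_. 1)"
  by (simp add: convolution_def bump)

lemma thick_mean_means: "thick_mean s \<in> means \<Lambda>"
  unfolding means_iff Linf_linear_functionals_def mem_Collect_eq
proof (intro conjI ballI impI allI)
  show "thick_mean s \<in> extensional (Linf \<Lambda>)" by (simp add: thick_mean_def)
  show "thick_mean s (\<lambda>_. 1) = 1"
    by (simp add: thick_mean_def Linf_const convolution_bump_const \<Theta>_const)
  fix \<phi> assume \<phi>: "\<phi> \<in> Linf \<Lambda>"
  show "thick_mean s (\<lambda>x. c * \<phi> x) = c * thick_mean s \<phi>" for c
  proof -
    have "convolution \<Lambda> bump (\<lambda>x. c * \<phi> x) = (\<lambda>x. c * convolution \<Lambda> bump \<phi> x)"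
      by (rule ext) (rule convolution_cmult_right)
    then show ?thesis using \<phi> by (simp add: thick_mean_def Linf_cmult \<Theta>_cmult bump_UC)
  qed
  show "0 \<le> thick_mean s \<phi>" if null: "{x. \<phi> x < 0} \<in> null_sets \<Lambda>"
  proof -
    \<comment> \<open>Off a null set \<open>\<phi>\<close> equals its absolute value, whose
      convolution with \<open>bump\<close> is nonnegative everywhere.\<close>
    have ab: "(\<lambda>x. \<bar>\<phi> x\<bar>) \<in> Linf \<Lambda>"
    proof -
      obtain C where "\<phi> \<in> borel_measurable borel" "\<And>x. \<bar>\<phi> x\<bar> \<le> C" using LinfE[OF \<phi>] by metis
      then show ?thesis by (intro LinfI[of _ C] borel_measurable_abs) simp_all
    qed
    have "{x. \<phi> x \<noteq> \<bar>\<phi> x\<bar>} = {x. \<phi> x < 0}" by auto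
    then have "convolution \<Lambda> bump \<phi> x = convolution \<Lambda> bump (\<lambda>x. \<bar>\<phi> x\<bar>) x" for x
      using \<phi> ab null Cc_measurable[OF bump(1)] by (intro convolution_cong_null) (auto simp: Linf_iff)
    then have "convolution \<Lambda> bump \<phi> = convolution \<Lambda> bump (\<lambda>x. \<bar>\<phi> x\<bar>)" by (rule ext)
    moreover have "0 \<le> \<Theta> s (convolution \<Lambda> bump (\<lambda>x. \<bar>\<phi> x\<bar>))"
      by (rule \<Theta>_nonneg[OF bump_UC[OF ab]]) (simp add: convolution_def bump)
    ultimately show ?thesis using \<phi> by (simp add: thick_mean_def)
  qed
  fix \<psi> assume \<psi>: "\<psi> \<in> Linf \<Lambda>"
  show "thick_mean s (\<lambda>x. \<phi> x + \<psi> x) = thick_mean s \<phi> + thick_mean s \<psi>"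
  proof -
    have "convolution \<Lambda> bump (\<lambda>x. \<phi> x + \<psi> x) = (\<lambda>x. convolution \<Lambda> bump \<phi> x + convolution \<Lambda> bump \<psi> x)"
      by (rule ext) (rule convolution_add_right[OF Cc_integrable[OF bump(1)] \<phi> \<psi>])
    then show ?thesis using \<phi> \<psi> by (simp add: thick_mean_def Linf_add \<Theta>_add bump_UC)
  qed
  show "thick_mean s \<phi> = thick_mean s \<psi>" if null: "locally_null \<Lambda> {x \<in> space \<Lambda>. \<phi> x \<noteq> \<psi> x}"
  proof -
    have "convolution \<Lambda> bump \<phi> x = convolution \<Lambda> bump \<psi> x" for x
      using \<phi> \<psi> null Cc_measurable[OF bump(1)] by (intro convolution_cong_null) (auto simp: Linf_iff locally_null_iff)
    then have "convolution \<Lambda> bump \<phi> = convolution \<Lambda> bump \<psi>" by (rule ext)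
    then show ?thesis using \<phi> \<psi> by (simp add: thick_mean_def)
  qed
qed

text \<open>The convolution of \<open>bump\<close> with that of \<open>f\<close> and
  \<open>\<phi>\<close> has the same \<open>\<Theta> s\<close> as the inner convolution, by
  \<open>\<Theta>_convolution_Cc\<close>. By proportionality the latter agrees with the value for
  \<open>bump\<close> and \<open>\<phi>\<close>, as \<open>f\<close> has integral 1.\<close>

lemma thick_mean_TLIM: "thick_mean s \<in> TLIM \<Lambda>"
  unfolding TLIM_def mem_Collect_eq
proof (intro conjI ballI)
  show "thick_mean s \<in> means \<Lambda>" by (rule thick_mean_means)
  fix f \<phi> assume f: "f \<in> P1 \<Lambda>" and \<phi>: "\<phi> \<in> Linf \<Lambda>"
  have i: "integrable \<Lambda> f" "(LINT x|\<Lambda>. f x) = 1" using f by (auto simp: P1_def)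
  have U: "convolution \<Lambda> f \<phi> \<in> UC" by (rule convolution_Linf_UC[OF i(1) \<phi>])
  show "thick_mean s (convolution \<Lambda> f \<phi>) = thick_mean s \<phi>"
    using \<Theta>_convolution_Cc[OF bump(1) U] \<Theta>_convolution_proportional[OF i(1) \<phi>] UC_Linf[OF U] \<phi> i(2) bump(3)
    by (simp add: thick_mean_def)
qed

text \<open>For fixed \<open>x\<close> the set \<open>- K + x\<close>, with \<open>K\<close>
  supporting \<open>bump\<close>, lies in some \<open>exhaustion n0\<close>. Whenever
  \<open>level w \<ge> n0\<close>, translating it by \<open>s (level w)\<close> puts it into
  \<open>E\<close>, so the smoothed indicator equals 1 there. The remaining \<open>w\<close> lie in
  a compact set, which \<open>m\<close> ignores.\<close>

lemma thick_mean_eq_1: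
  assumes E: "E \<in> sets borel" "\<And>n k. k \<in> exhaustion n \<Longrightarrow> k + s n \<in> E"
  shows "thick_mean s (indicator E) = 1"
proof -
  let ?\<psi> = "convolution \<Lambda> bump (indicator E)"
  have U: "?\<psi> \<in> UC" by (rule bump_UC[OF Linf_indicator[OF E(1)]])
  obtain K where K: "compact K" "continuous_on UNIV bump" "\<And>x. x \<notin> K \<Longrightarrow> bump x = 0"
    using bump(1) by (elim CcE) blast
  have range: "0 \<le> ?\<psi> x \<and> ?\<psi> x \<le> 1" for x
  proof -
    have ib: "integrable \<Lambda> bump" by (rule Cc_integrable[OF bump(1)])
    have "integrable \<Lambda> (\<lambda>y. bump y * indicator E (- y + x))"
      by (rule integrable_mult_bounded(1)[OF ib measurable_reflect, where C=1]) (use E in \<open>auto simp: indicator_def\<close>)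
    then have "(LINT y|\<Lambda>. bump y * indicator E (- y + x)) \<le> (LINT y|\<Lambda>. bump y)"
      using ib bump(2) by (intro integral_mono) (auto simp: indicator_def)
    then show ?thesis using bump by (simp add: convolution_def)
  qed
  have "sample s ?\<psi> x = 1" for x
  proof -
    have "compact ((\<lambda>y. - y + x) ` K)" using K(1) by (intro compact_continuous_image continuous_intros)
    then obtain n0 where n0: "(\<lambda>y. - y + x) ` K \<subseteq> exhaustion n0" using exhaustion(3) by blast
    have one: "?\<psi> (x + s (level w)) = 1" if "w \<notin> exhaustion n0" for w
    proof -
      have "n0 \<le> level w" using that level_le[of w n0] by simp
      have "bump y * indicator E (- y + (x + s (level w))) = bump y" for y
      proof (cases "y \<in> K")
        case True
        then have "- y + x \<in> exhaustion (level w)" using n0 exhaustion(2)[OF \<open>n0 \<le> level w\<close>] by blast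
        then have "- y + x + s (level w) \<in> E" by (rule E(2))
        then show ?thesis by (simp add: add.assoc)
      qed (simp add: K(3))
      then show ?thesis unfolding convolution_def by (simp only: bump(3))
    qed
    have "\<bar>m (\<lambda>w. ?\<psi> (x + s (level w))) - m (\<lambda>_. 1)\<bar> \<le> m (indicator (exhaustion n0))"
    proof (rule mean_dist_le[OF mean sample_Linf[OF U] Linf_const Linf_indicator[OF exhaustion_borel]])
      fix w
      show "\<bar>?\<psi> (x + s (level w)) - 1\<bar> \<le> indicator (exhaustion n0) w"
        using one[of w] range[of "x + s (level w)"] by (cases "w \<in> exhaustion n0") auto
    qed
    then show ?thesis
      using mean_compact[OF exhaustion(1)] mean_const[OF mean, of 1] by (simp add: sample_def)
  qed
  then have "sample s ?\<psi> = (\<lambda>_. 1)" by (rule ext)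
  then show ?thesis using mean_const[OF mean, of 1] Linf_indicator[OF E(1)] by (simp add: thick_mean_def \<Theta>_def)
qed

end

section \<open>Folner sets of non-unimodular groups\<close>

context haar_group
begin

text \<open>
  Averaging over \<open>U\<close> and \<open>B\<close> yields \<open>y \<in> B\<close> with at least half of \<open>U\<close> in \<open>By\<^sup>-\<^sup>1\<close>, up to
  replacing \<open>B\<close> by a slightly larger open set, and \<open>|By\<^sup>-\<^sup>1| \<le> |B|\<close>.
\<close>

lemma self_overlap_bound:
  assumes U: "compact U" and B: "compact B" "0 < measure \<Lambda> B" "\<And>y. y \<in> B \<Longrightarrow> modular y \<le> 1"
    and overlap: "\<And>x. x \<in> U \<Longrightarrow> 3/4 * measure \<Lambda> B \<le> measure \<Lambda> {y \<in> B. x + y \<in> B}"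
  shows "measure \<Lambda> U \<le> 2 * measure \<Lambda> B + 2"
proof (rule ccontr)
  assume "\<not> ?thesis"
  then have large: "2 * measure \<Lambda> B + 2 < measure \<Lambda> U" by (simp add: not_le)
  have fB: "B \<in> fmeasurable \<Lambda>" by (rule compact_fmeasurable[OF B(1)])
  have Bb: "B \<in> sets borel" by (rule compact_borel[OF B(1)])
  have "emeasure \<Lambda> B \<noteq> \<infinity>" using emeasure_compact[OF B(1)] by simp
  \<comment> \<open>The excess 1 accounts for the summand 2 of the conclusion: it gives
    \<open>h\<close> an integral of at most \<open>measure \<Lambda> B + 1\<close>, which is less
    than half of \<open>measure \<Lambda> U\<close>.\<close>
  from INF_approx_ennreal[OF _ Haar_outer[OF Bb] this, of 1]
  obtain V where V: "open V" "B \<subseteq> V" "emeasure \<Lambda> V < emeasure \<Lambda> B + 1" by auto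
  obtain h where h: "h \<in> Cc" "\<And>x. 0 \<le> h x" "\<And>x. h x \<le> 1" "\<And>x. x \<in> B \<Longrightarrow> h x = 1" "\<And>x. x \<notin> V \<Longrightarrow> h x = 0"
    using Cc_Urysohn[OF B(1) V(1,2)] by metis
  have "ennreal (LINT x|\<Lambda>. h x) \<le> emeasure \<Lambda> V" by (rule Cc_le_emeasure) (use V h in auto)
  also have "\<dots> \<le> emeasure \<Lambda> B + 1" using V(3) by simp
  also have "\<dots> = ennreal (measure \<Lambda> B + 1)"
    using fB by (simp add: emeasure_eq_measure2 ennreal_plus)
  finally have hB: "(LINT x|\<Lambda>. h x) \<le> measure \<Lambda> B + 1"
    by (subst (asm) ennreal_le_iff) (simp_all add: add_nonneg_nonneg)
  have mU: "0 < measure \<Lambda> U" by (rule order_le_less_trans[OF _ large]) (use B(2) in simp)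
  have iU: "integrable \<Lambda> (\<lambda>x. indicator U x :: real)" "(LINT x|\<Lambda>. indicator U x) = measure \<Lambda> U"
    using compact_fmeasurable[OF U] by (auto simp: fmeasurable_def)
  have hm: "(\<lambda>x. h (x + t)) \<in> Cc" for t by (rule Cc_right[OF h(1)])
  have le_half: "(LINT x|\<Lambda>. indicator U x * h (x + y)) \<le> measure \<Lambda> U / 2" if y: "y \<in> B" for y
  proof -
    have "(LINT x|\<Lambda>. indicator U x * h (x + y)) \<le> (LINT x|\<Lambda>. h (x + y))"
    proof (rule integral_mono[OF _ Cc_integrable[OF hm]])
      show "integrable \<Lambda> (\<lambda>x. indicator U x * h (x + y))"
        by (rule integrable_mult_bounded(1)[OF iU(1) Cc_measurable[OF hm], where C=1]) (use h in auto)
    qed (use h(2) in \<open>auto simp: indicator_def\<close>)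
    also have "\<dots> = modular y * (LINT x|\<Lambda>. h x)" by (rule modular[OF h(1)])
    also have "\<dots> \<le> 1 * (LINT x|\<Lambda>. h x)" using B(3)[OF y] h(2) by (intro mult_right_mono) auto
    also have "\<dots> \<le> measure \<Lambda> U / 2" using hB large by linarith
    finally show ?thesis .
  qed
  \<comment> \<open>The tolerance of one eighth leaves 1/2 + 1/8 = 5/8, still below the overlap
    3/4.\<close>
  obtain n :: nat and \<alpha> p where R: "\<And>j. j < n \<Longrightarrow> p j \<in> U" "(\<Sum>j<n. \<alpha> j) = measure \<Lambda> U"
    "\<And>t. \<bar>(LINT x|\<Lambda>. indicator U x * h (x + t)) - (\<Sum>j<n. \<alpha> j * h (p j + t))\<bar> \<le> measure \<Lambda> U / 8"
    "\<And>j. 0 \<le> \<alpha> j"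
  proof (rule Riemann_sum[OF U iU(1), of "\<lambda>x t. h (x + t)" 1 "measure \<Lambda> U / 8"])
    show "\<exists>V. open V \<and> x0 \<in> V \<and> (\<forall>x\<in>V. \<forall>t. \<bar>h (x + t) - h (x0 + t)\<bar> \<le> \<epsilon>)" if "0 < \<epsilon>" for x0 \<epsilon>
      using UC_nbhd[OF Cc_subset_UC[OF h(1)] that, where z=x0] by metis
    fix n :: nat and \<alpha> :: "nat \<Rightarrow> real" and p
    assume "\<And>j. j < n \<Longrightarrow> p j \<in> U" "sum \<alpha> {..<n} = (LINT x|\<Lambda>. indicator U x)"
      "\<And>t. \<bar>(LINT x|\<Lambda>. indicator U x * h (x + t)) - (\<Sum>j<n. \<alpha> j * h (p j + t))\<bar> \<le> measure \<Lambda> U / 8"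
      "\<And>j. (\<And>x. 0 \<le> (indicator U x :: real)) \<Longrightarrow> 0 \<le> \<alpha> j"
    then show thesis by (intro that) (simp_all add: iU(2))
  qed (use h mU Cc_measurable[OF hm] in auto)
  define S where "S j = {y \<in> B. p j + y \<in> B}" for j
  have S_eq: "S j = B \<inter> (\<lambda>y. p j + y) -` B" for j unfolding S_def by auto
  have S: "S j \<in> fmeasurable \<Lambda>" for j
    unfolding S_eq using measurable_sets[OF measurable_left, OF Bb, of "p j"] by (intro fmeasurable_Int_fmeasurable[OF fB]) simp
  have iS: "integrable \<Lambda> (\<lambda>y. \<alpha> j * indicator (S j) y)" for j
    using S[of j] by (auto simp: fmeasurable_def)
  \<comment> \<open>The weighted sum of the overlaps is bounded below by hypothesis. Exchanging it
    with the integral over \<open>B\<close> bounds it above through the Riemann sums of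
    \<open>h\<close>, and the two bounds conflict.\<close>
  have "3/4 * measure \<Lambda> B * measure \<Lambda> U = (\<Sum>j<n. \<alpha> j * (3/4 * measure \<Lambda> B))"
    unfolding sum_distrib_right[symmetric] R(2) by (rule mult.commute)
  also have "\<dots> \<le> (\<Sum>j<n. \<alpha> j * measure \<Lambda> (S j))"
    unfolding S_def by (intro sum_mono mult_left_mono overlap R) auto
  also have "\<dots> = (LINT y|\<Lambda>. (\<Sum>j<n. \<alpha> j * indicator (S j) y))"
    using iS S by (subst Bochner_Integration.integral_sum) (auto simp: fmeasurable_def)
  also have "\<dots> \<le> (LINT y|\<Lambda>. 5/8 * measure \<Lambda> U * indicator B y)"
  proof (rule integral_mono)
    show "integrable \<Lambda> (\<lambda>y. \<Sum>j<n. \<alpha> j * indicator (S j) y)"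
      using iS by (intro Bochner_Integration.integrable_sum) auto
    show "integrable \<Lambda> (\<lambda>y. 5/8 * measure \<Lambda> U * indicator B y)" using fB by (auto simp: fmeasurable_def)
    fix y
    show "(\<Sum>j<n. \<alpha> j * indicator (S j) y) \<le> 5/8 * measure \<Lambda> U * indicator B y"
    proof (cases "y \<in> B")
      case True
      have "(\<Sum>j<n. \<alpha> j * indicator (S j) y) \<le> (\<Sum>j<n. \<alpha> j * h (p j + y))"
        using h(2,4) R(4) by (intro sum_mono mult_left_mono) (auto simp: S_def indicator_def)
      also have "\<dots> \<le> measure \<Lambda> U / 2 + measure \<Lambda> U / 8" using R(3)[of y] le_half[OF True] by linarith
      finally show ?thesis using True by simp
    next
      case False
      then have "indicator (S j) y = (0::real)" for j by (simp add: S_def)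
      then show ?thesis using False by simp
    qed
  qed
  also have "\<dots> = 5/8 * measure \<Lambda> U * measure \<Lambda> B" using fB by (simp add: fmeasurable_def)
  finally have "3/4 * (measure \<Lambda> U * measure \<Lambda> B) \<le> 5/8 * (measure \<Lambda> U * measure \<Lambda> B)" by (simp add: mult_ac)
  then show False using mult_pos_pos[OF mU B(2)] by linarith
qed

end

section \<open>Averages of invariant means, and means of sets\<close>

context sigma_haar_group
begin

lemma TLIM_convex:
  assumes "\<mu> \<in> TLIM \<Lambda>" "\<nu> \<in> TLIM \<Lambda>"
  shows "(\<lambda>\<phi>\<in>Linf \<Lambda>. (\<mu> \<phi> + \<nu> \<phi>) / 2) \<in> TLIM \<Lambda>"
proof -
  let ?\<kappa> = "\<lambda>\<phi>\<in>Linf \<Lambda>. (\<mu> \<phi> + \<nu> \<phi>) / 2"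
  have m: "\<mu> \<in> means \<Lambda>" "\<nu> \<in> means \<Lambda>" using assms by (auto simp: TLIM_def)
  have pos: "0 \<le> \<mu> \<phi>" "0 \<le> \<nu> \<phi>" if "\<phi> \<in> Linf \<Lambda>" "{x. \<phi> x < 0} \<in> null_sets \<Lambda>" for \<phi>
    using m that unfolding means_iff by blast+
  have "?\<kappa> \<in> means \<Lambda>"
    unfolding means_iff Linf_linear_functionals_def mem_Collect_eq
  proof (intro conjI ballI impI allI)
    fix \<phi> assume \<phi>: "\<phi> \<in> Linf \<Lambda>"
    show "?\<kappa> (\<lambda>x. c * \<phi> x) = c * ?\<kappa> \<phi>" for c
      using \<phi> mean_cmult[OF m(1) \<phi>] mean_cmult[OF m(2) \<phi>] by (simp add: Linf_cmult algebra_simps)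
    show "0 \<le> ?\<kappa> \<phi>" if "{x. \<phi> x < 0} \<in> null_sets \<Lambda>"
      using pos[OF \<phi> that] \<phi> by simp
    fix \<psi> assume \<psi>: "\<psi> \<in> Linf \<Lambda>"
    show "?\<kappa> (\<lambda>x. \<phi> x + \<psi> x) = ?\<kappa> \<phi> + ?\<kappa> \<psi>"
      using \<phi> \<psi> mean_add[OF m(1) \<phi> \<psi>] mean_add[OF m(2) \<phi> \<psi>] by (simp add: Linf_add add_divide_distrib)
    show "?\<kappa> \<phi> = ?\<kappa> \<psi>" if "locally_null \<Lambda> {x \<in> space \<Lambda>. \<phi> x \<noteq> \<psi> x}"
    proof -
      have "\<mu> \<phi> = \<mu> \<psi>" "\<nu> \<phi> = \<nu> \<psi>"
        using that by (auto intro!: mean_cong[OF m(1) \<phi> \<psi>] mean_cong[OF m(2) \<phi> \<psi>] simp: locally_null_iff)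
      then show ?thesis using \<phi> \<psi> by simp
    qed
  qed (use m in \<open>simp_all add: Linf_const mean_one\<close>)
  moreover have "?\<kappa> (convolution \<Lambda> f \<phi>) = ?\<kappa> \<phi>" if "f \<in> P1 \<Lambda>" "\<phi> \<in> Linf \<Lambda>" for f \<phi>
  proof -
    have "integrable \<Lambda> f" using that(1) by (simp add: P1_def)
    then have "convolution \<Lambda> f \<phi> \<in> Linf \<Lambda>" using convolution_Linf_UC UC_Linf that(2) by blast
    moreover have "\<mu> (convolution \<Lambda> f \<phi>) = \<mu> \<phi>" "\<nu> (convolution \<Lambda> f \<phi>) = \<nu> \<phi>"
      using assms that by (simp_all add: TLIM_def)
    ultimately show ?thesis using that(2) by simp
  qed
  ultimately show ?thesis by (simp add: TLIM_def)
qed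

lemma mean_of_set_indicator:
  assumes "compact A" "E \<in> sets borel"
  shows "mean_of_set \<Lambda> A (indicator E) = measure \<Lambda> (A \<inter> E) / measure \<Lambda> A"
proof -
  have "(LINT x:A|\<Lambda>. indicator E x) = (LINT x|\<Lambda>. indicator (A \<inter> E) x)"
    unfolding set_lebesgue_integral_def by (rule Bochner_Integration.integral_cong) (auto simp: indicator_def)
  also have "\<dots> = measure \<Lambda> (A \<inter> E)"
    using assms compact_borel by simp
  finally show ?thesis using Linf_indicator[OF assms(2)] by (simp add: mean_of_set_def)
qed

end

section \<open>A topologically invariant mean outside \<open>TLIM0\<close>\<close>

context nonunimodular_mean
begin

text \<open>The \<open>n\<close>-th set of the exhaustion has a thin translate of measure at most
  \<open>(1/2) ^ Suc n\<close>; these bounds add up to 1.\<close>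

lemma ex_thin_thick_set:
  "\<exists>s E. E \<in> sets borel \<and> (\<forall>n. \<forall>k\<in>exhaustion n. k + s n \<in> E) \<and> (\<forall>y\<in>E. 1 < modular y) \<and> emeasure \<Lambda> E \<le> 1"
proof -
  have "\<exists>x. (\<forall>k\<in>exhaustion n. 1 < modular (k + x)) \<and> measure \<Lambda> ((\<lambda>k. k + x) ` exhaustion n) \<le> (1/2) ^ Suc n" for n
  proof -
    have "(0::real) < (1/2) ^ Suc n" by simp
    from thin_translate[OF nonunimodular exhaustion(1) this] show ?thesis by metis
  qed
  then obtain s where s: "\<And>n k. k \<in> exhaustion n \<Longrightarrow> 1 < modular (k + s n)"
    "\<And>n. measure \<Lambda> ((\<lambda>k. k + s n) ` exhaustion n) \<le> (1/2) ^ Suc n" by metis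
  let ?A = "\<lambda>n. (\<lambda>k. k + s n) ` exhaustion n"
  have A: "compact (?A n)" for n using exhaustion(1) by (intro compact_continuous_image continuous_intros)
  have "emeasure \<Lambda> (\<Union>n. ?A n) \<le> (\<Sum>n. emeasure \<Lambda> (?A n))"
    using compact_borel[OF A] by (intro emeasure_subadditive_countably) auto
  also have "\<dots> \<le> (\<Sum>n. ennreal ((1/2) ^ Suc n))"
  proof (intro suminf_le summableI)
    fix n
    have "emeasure \<Lambda> (?A n) = ennreal (measure \<Lambda> (?A n))"
      using compact_fmeasurable[OF A[of n]] by (simp add: emeasure_eq_measure2)
    also have "\<dots> \<le> ennreal ((1/2) ^ Suc n)" by (rule ennreal_leI[OF s(2)])
    finally show "emeasure \<Lambda> (?A n) \<le> ennreal ((1/2) ^ Suc n)" .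
  qed
  also have "\<dots> = ennreal 1"
    by (rule suminf_ennreal_eq[OF _ power_half_series]) simp
  finally have "emeasure \<Lambda> (\<Union>n. ?A n) \<le> 1" by simp
  then show ?thesis
    using s(1) compact_borel[OF A] by (intro exI[of _ s] exI[of _ "\<Union>n. ?A n"]) (auto intro!: sets.countable_UN)
qed

lemma TLIM0_neq_TLIM: "TLIM0 \<Lambda> \<noteq> TLIM \<Lambda>"
proof
  assume eq: "TLIM0 \<Lambda> = TLIM \<Lambda>"
  obtain s E1 where E1: "E1 \<in> sets borel" "\<And>n k. k \<in> exhaustion n \<Longrightarrow> k + s n \<in> E1"
    "\<And>y. y \<in> E1 \<Longrightarrow> 1 < modular y" "emeasure \<Lambda> E1 \<le> 1"
    using ex_thin_thick_set by metis
  define E2 where "E2 = {y. modular y \<le> 1}"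
  have clE2: "closed E2" unfolding E2_def by (intro closed_Collect_le modular_continuous continuous_on_const)
  then have E2: "E2 \<in> sets borel" by simp
  have "\<exists>x. \<forall>k\<in>exhaustion n. modular (k + x) \<le> 1" for n
    using modular_le_1_translate[OF nonunimodular exhaustion(1)[of n], of 0] by metis
  then obtain t where t: "\<And>n k. k \<in> exhaustion n \<Longrightarrow> k + t n \<in> E2" unfolding E2_def by (metis mem_Collect_eq)
  have disj: "E1 \<inter> E2 = {}" using E1(3) by (fastforce simp: E2_def)
  have ms: "thick_mean s (indicator E1) = 1" by (rule thick_mean_eq_1[OF E1(1,2)])
  have mt: "thick_mean t (indicator E2) = 1" by (rule thick_mean_eq_1[OF E2 t])
  have sum_le: "\<nu> (indicator E1) + \<nu> (indicator E2) \<le> 1" if "\<nu> \<in> means \<Lambda>" for \<nu>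
  proof -
    have "\<nu> (\<lambda>x. indicator E1 x + indicator E2 x) \<le> \<nu> (\<lambda>_. 1)"
      using disj by (intro mean_mono[OF that] Linf_add Linf_const Linf_indicator E1 E2) (auto simp: indicator_def)
    then show ?thesis
      using mean_add[OF that Linf_indicator[OF E1(1)] Linf_indicator[OF E2]] mean_one[OF that] by simp
  qed
  have nn: "0 \<le> \<nu> (indicator E)" if "\<nu> \<in> means \<Lambda>" "E \<in> sets borel" for \<nu> E
    by (rule mean_nonneg[OF that(1) Linf_indicator[OF that(2)]]) simp
  \<comment> \<open>The two sets are disjoint, so full mass on one of them leaves mass 0 for the
    other.\<close>
  have ms2: "thick_mean s (indicator E2) = 0"
    using sum_le[OF thick_mean_means[of s]] ms nn[OF thick_mean_means[of s] E2] by simp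
  have mt1: "thick_mean t (indicator E1) = 0"
    using sum_le[OF thick_mean_means[of t]] mt nn[OF thick_mean_means[of t] E1(1)] by simp
  define \<mu> where "\<mu> = (\<lambda>\<phi>\<in>Linf \<Lambda>. (thick_mean s \<phi> + thick_mean t \<phi>) / 2)"
  have "\<mu> \<in> TLIM \<Lambda>" unfolding \<mu>_def by (rule TLIM_convex[OF thick_mean_TLIM thick_mean_TLIM])
  then have \<mu>0: "\<mu> \<in> TLIM0 \<Lambda>" by (simp add: eq)
  have \<mu>: "\<mu> (indicator E1) = 1/2" "\<mu> (indicator E2) = 1/2"
    using Linf_indicator E1(1) E2 by (simp_all add: \<mu>_def ms mt ms2 mt1)
  \<comment> \<open>The complement of the two sets may be empty, while the blocks of a partition
    must not be. \<open>E1\<close> and \<open>E2\<close> survive the removal because each has mass 1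
    under some mean.\<close>
  define P where "P = {E1, E2, - (E1 \<union> E2)} - {{}}"
  have "thick_mean r (indicator {}) = 0" for r
  proof -
    have "indicator {} = (\<lambda>_::'a. 0::real)" by (rule ext) simp
    then show ?thesis by (simp only: mean_const[OF thick_mean_means])
  qed
  note empty = this
  have ne: "E1 \<noteq> {}" "E2 \<noteq> {}"
    using ms mt empty[of s] empty[of t] by (metis zero_neq_one)+
  have P: "finite_measurable_partition \<Lambda> P"
    unfolding finite_measurable_partition_def
  proof (intro conjI)
    show "finite P" by (simp add: P_def)
    have "- (E1 \<union> E2) \<in> sets borel" using E1(1) E2 by (simp add: Compl_Un sets.Int)
    then show "P \<subseteq> sets \<Lambda>" unfolding P_def sets_Haar using E1(1) E2 by blast
    show "partition_on (space \<Lambda>) P"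
      unfolding partition_on_def
    proof (intro conjI)
      show "\<Union>P = space \<Lambda>" unfolding P_def space_Haar by blast
      have "disjoint {E1, E2, - (E1 \<union> E2)}" using disj by (simp add: disjoint_def) blast
      then show "disjoint P" by (rule pairwise_subset) (simp add: P_def)
      show "{} \<notin> P" by (simp add: P_def)
    qed
  qed
  \<comment> \<open>The number 8 exceeds 7 = 2 * (5/2) + 2, which bounds the measure of
    \<open>U\<close> once the measure of \<open>A\<close> is known to be less than 5/2.\<close>
  obtain U where U: "compact U" "\<And>x. x \<in> U \<Longrightarrow> modular x \<le> 1" "8 \<le> measure \<Lambda> U"
    using large_compact[OF nonunimodular, of 8] by metis
  \<comment> \<open>The reflected set is used because \<open>x + y\<close> lies in \<open>A\<close>
    exactly if \<open>y\<close> lies in the translate of \<open>A\<close> by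
    \<open>- x\<close>.\<close>
  have cU: "compact (uminus ` U)" using U(1) by (intro compact_continuous_image continuous_intros)
  have "\<forall>\<P> K \<epsilon>. finite_measurable_partition \<Lambda> \<P> \<and> compact K \<and> 0 < \<epsilon> \<and> \<epsilon> < 1 \<longrightarrow>
       (\<exists>A\<in>Folner_sets \<Lambda> K \<epsilon>. mean_of_set \<Lambda> A \<in> mean_nbhd \<Lambda> \<mu> \<P> \<epsilon>)"
    using \<mu>0 by (simp add: TLIM0_def)
  \<comment> \<open>With 1/10, both \<open>A \<inter> E1\<close> and \<open>A \<inter> E2\<close>
    occupy more than 2/5 of \<open>A\<close>. The translation error, a tenth of \<open>A\<close>, is
    then less than a quarter of \<open>A \<inter> E2\<close>, as the factor 3/4 in
    \<open>self_overlap_bound\<close> requires.\<close>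
  from this[rule_format, of P "uminus ` U" "1/10"]
  have "\<exists>A\<in>Folner_sets \<Lambda> (uminus ` U) (1/10). mean_of_set \<Lambda> A \<in> mean_nbhd \<Lambda> \<mu> P (1/10)"
    using P cU by simp
  then obtain A where A: "A \<in> Folner_sets \<Lambda> (uminus ` U) (1/10)" "mean_of_set \<Lambda> A \<in> mean_nbhd \<Lambda> \<mu> P (1/10)" ..
  have Ac: "compact A" "0 < measure \<Lambda> A" using A(1) by (auto simp: Folner_sets_def)
  have Fol: "measure \<Lambda> (sym_diff ((+) (- x) ` A) A) < measure \<Lambda> A / 10" if "x \<in> U" for x
    using A(1) that Ac(2) by (auto simp: Folner_sets_def field_simps)
  have in_P: "E1 \<in> P" "E2 \<in> P" using ne by (auto simp: P_def)
  have close: "\<bar>1/2 - measure \<Lambda> (A \<inter> E1) / measure \<Lambda> A\<bar> < 1/10" "\<bar>1/2 - measure \<Lambda> (A \<inter> E2) / measure \<Lambda> A\<bar> < 1/10"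
    using bspec[OF CollectD[OF A(2)[unfolded mean_nbhd_def], THEN conjunct2] in_P(1)]
      bspec[OF CollectD[OF A(2)[unfolded mean_nbhd_def], THEN conjunct2] in_P(2)]
    unfolding \<mu> mean_of_set_indicator[OF Ac(1) E1(1)] mean_of_set_indicator[OF Ac(1) E2] by simp_all
  then have "2/5 < measure \<Lambda> (A \<inter> E1) / measure \<Lambda> A" "2/5 < measure \<Lambda> (A \<inter> E2) / measure \<Lambda> A" by linarith+
  then have AE: "2/5 * measure \<Lambda> A < measure \<Lambda> (A \<inter> E1)" "2/5 * measure \<Lambda> A < measure \<Lambda> (A \<inter> E2)"
    using Ac(2) by (simp_all add: field_simps)
  have fA: "A \<in> fmeasurable \<Lambda>" by (rule compact_fmeasurable[OF Ac(1)])
  have "emeasure \<Lambda> (A \<inter> E1) \<le> 1" using E1(1,4) emeasure_mono[of "A \<inter> E1" E1 \<Lambda>] by auto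
  then have "measure \<Lambda> (A \<inter> E1) \<le> 1"
    unfolding measure_def by (intro enn2real_leI) simp_all
  then have A_le: "measure \<Lambda> A < 5/2" using AE(1) by linarith
  define B where "B = A \<inter> E2"
  have B: "compact B" unfolding B_def using Ac(1) clE2 by (rule compact_Int_closed)
  have fB: "B \<in> fmeasurable \<Lambda>" by (rule compact_fmeasurable[OF B])
  have B_pos: "0 < measure \<Lambda> B" using AE(2) Ac(2) by (simp add: B_def)
  have "measure \<Lambda> U \<le> 2 * measure \<Lambda> B + 2"
  proof (rule self_overlap_bound[OF U(1) B B_pos])
    show "modular y \<le> 1" if "y \<in> B" for y using that by (simp add: B_def E2_def)
    fix x assume x: "x \<in> U"
    let ?S = "{y \<in> B. x + y \<in> B}" and ?T = "(+) (- x) ` A"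
    have T: "?T \<in> fmeasurable \<Lambda>"
      using Ac(1) by (intro compact_fmeasurable compact_continuous_image continuous_intros)
    have S_eq: "?S = B \<inter> (\<lambda>y. x + y) -` B" by auto
    have S: "?S \<in> fmeasurable \<Lambda>"
      unfolding S_eq using measurable_sets[OF measurable_left, OF compact_borel[OF B], of x]
      by (intro fmeasurable_Int_fmeasurable[OF fB]) simp
    \<comment> \<open>As \<open>modular\<close> is multiplicative and at most 1 on \<open>U\<close>,
      left translation by \<open>x\<close> maps \<open>E2\<close> into itself. A point of
      \<open>B\<close> therefore leaves \<open>B\<close> only by leaving \<open>A\<close>.\<close>
    have "B \<subseteq> ?S \<union> sym_diff ?T A"
    proof
      fix y assume y: "y \<in> B"
      show "y \<in> ?S \<union> sym_diff ?T A"
      proof (cases "y \<in> ?T")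
        case True
        then have "x + y \<in> A" by (auto simp: add.assoc[symmetric])
        moreover have "modular (x + y) \<le> 1"
        proof -
          have "modular x * modular y \<le> 1 * 1"
            using U(2)[OF x] y modular_pos[of x] modular_pos[of y]
            by (intro mult_mono) (auto simp: B_def E2_def)
          then show ?thesis by (simp add: modular_add)
        qed
        ultimately show ?thesis using y by (simp add: B_def E2_def)
      next
        case False
        then show ?thesis using y by (auto simp: B_def)
      qed
    qed
    then have "measure \<Lambda> B \<le> measure \<Lambda> (?S \<union> sym_diff ?T A)"
      using fB S T fA by (intro measure_mono_fmeasurable) (auto intro!: fmeasurable.Un fmeasurable.Diff)
    also have "\<dots> \<le> measure \<Lambda> ?S + measure \<Lambda> (sym_diff ?T A)"
      by (intro measure_Un_le sets.Un sets.Diff fmeasurableD S T fA)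
    finally show "3/4 * measure \<Lambda> B \<le> measure \<Lambda> ?S"
      using Fol[OF x] AE(2) unfolding B_def[symmetric] by linarith
  qed
  moreover have "measure \<Lambda> B \<le> measure \<Lambda> A"
    using fA fB by (intro measure_mono_fmeasurable) (auto simp: B_def)
  ultimately show False using A_le U(3) by linarith
qed

end

theorem mainTheorem12:
  fixes \<Lambda> :: "'a :: {topological_group_add, t2_space} measure"
  assumes "locally_compact_space (euclidean :: 'a topology)"
    and "sigma_compact_space (euclidean :: 'a topology)"
    and "left_haar_measure \<Lambda>"
    and "amenable \<Lambda>"
    and "\<not> unimodular \<Lambda>"
  shows "TLIM0 \<Lambda> \<noteq> TLIM \<Lambda>"
proof -
  \<comment> \<open>Amenability supplies the left-invariant mean from which the means on thick sets
    are built.\<close>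
  from \<open>amenable \<Lambda>\<close> obtain m where m: "m \<in> means \<Lambda>"
    "\<And>x \<phi>. \<phi> \<in> Linf \<Lambda> \<Longrightarrow> m (\<lambda>y. \<phi> (- x + y)) = m \<phi>"
    unfolding amenable_def by blast
  have inv: "m (\<lambda>y. \<phi> (a + y)) = m \<phi>" if "\<phi> \<in> Linf \<Lambda>" for \<phi> a
    using m(2)[OF that, of "- a"] by simp
  interpret nonunimodular_mean \<Lambda> m
    by unfold_locales (fact assms m(1) inv)+
  show ?thesis by (rule TLIM0_neq_TLIM)
qed

end
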